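(* Let $M$ be an orientable smooth manifold with $H^1(M,\mathbb{R})=\{0\}$, and let $D:\mathfrak{X}(M)\to\mathcal{A}(M)$ be a linear operator. Then $D$ satisfies both (i) $D([X_1,X_2]) = X_1(D(X_2)) - X_2(D(X_1))$ for all $X_1,X_2\in\mathfrak{X}(M)$, and (ii) $D(f\cdot X) = f\,D(X) + X(f)$ for all $f\in\mathcal{A}(M)$ and $X\in\mathfrak{X}(M)$, if and only if there exists a volume form $\Omega$ on $M$ such that $D=\operatorname{div}_\Omega$. In particular, this equivalence holds on any simply connected smooth manifold $M$.
   Context: $\mathcal{A}(M)$ denotes the ring of all smooth real-valued functions on the smooth manifold $M$, and $\mathfrak{X}(M)$ denotes the $\mathcal{A}(M)$-module of all smooth vector fields on $M$ (smooth sections of $TM$), with Lie bracket $[\cdot,\cdot]$. Linear means $\mathbb{R}$-linear. For $X\in\mathfrak{X}(M)$ and $f\in\mathcal{A}(M)$, $X(f)$ is the derivative of $f$ along $X$. $H^1(M,\mathbb{R})$ is the first (de Rham) cohomology of $M$ with real coefficients. A volume form on $M$ is a nowhere-vanishing smooth differential form of top degree $n=\dim_{\mathbb{R}} M$. For a volume form $\Omega$, the divergence operator $\operatorname{div}_\Omega:\mathfrak{X}(M)\to\mathcal{A}(M)$ is defined by $L_X\Omega=\operatorname{div}_\Omega(X)\,\Omega$, where $L_X$ is the Lie derivative along $X$. *)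

theory Defs
  imports "HOL-Analysis.Analysis"
begin

primrec Ck_on :: "nat \<Rightarrow> (real^'n) set \<Rightarrow> (real^'n \<Rightarrow> 'b::real_normed_vector) \<Rightarrow> bool" where
  "Ck_on 0 S f \<longleftrightarrow> continuous_on S f"
| "Ck_on (Suc k) S f \<longleftrightarrow>
     (\<forall>x\<in>S. f differentiable (at x)) \<and>
     (\<forall>v. Ck_on k S (\<lambda>x. frechet_derivative f (at x) v))"

definition smooth_on :: "(real^'n) set \<Rightarrow> (real^'n \<Rightarrow> 'b::real_normed_vector) \<Rightarrow> bool" where
  "smooth_on S f \<longleftrightarrow> (\<forall>k. Ck_on k S f)"

text \<open>
  A manifold of dimension \<open>CARD('n)\<close> is a second countable Hausdorff type \<open>'a\<close> together
  with a smooth atlas. A chart is a pair of a domain and a coordinate map; the values of the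
  coordinate map outside the domain are irrelevant.
\<close>

type_synonym ('a, 'n) chart = "'a set \<times> ('a \<Rightarrow> real^'n)"

definition chart_image :: "('a, 'n) chart \<Rightarrow> (real^'n) set" where
  "chart_image c = snd c ` fst c"

definition chart_inv :: "('a, 'n) chart \<Rightarrow> real^'n \<Rightarrow> 'a" where
  "chart_inv c = inv_into (fst c) (snd c)"

definition is_chart :: "('a::topological_space, 'n::finite) chart \<Rightarrow> bool" where
  "is_chart c \<longleftrightarrow> open (fst c) \<and> open (chart_image c) \<and>
     homeomorphism (fst c) (chart_image c) (snd c) (chart_inv c)"

definition transition :: "('a, 'n) chart \<Rightarrow> ('a, 'n) chart \<Rightarrow> real^'n \<Rightarrow> real^'n" where
  "transition c d = snd d \<circ> chart_inv c"

definition smooth_atlas :: "('a::{t2_space,second_countable_topology}, 'n::finite) chart set \<Rightarrow> bool"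
  where
  "smooth_atlas A \<longleftrightarrow> (\<forall>c\<in>A. is_chart c) \<and> (\<Union>c\<in>A. fst c) = UNIV \<and>
     (\<forall>c\<in>A. \<forall>d\<in>A. smooth_on (snd c ` (fst c \<inter> fst d)) (transition c d))"

text \<open>
  That \<open>A \<union> B\<close> is again a smooth atlas says that \<open>B\<close> consists of charts of the smooth
  structure given by \<open>A\<close>.
\<close>

definition orientable :: "('a::{t2_space,second_countable_topology}, 'n::finite) chart set \<Rightarrow> bool"
  where
  "orientable A \<longleftrightarrow> (\<exists>B. smooth_atlas B \<and> smooth_atlas (A \<union> B) \<and>
     (\<forall>c\<in>B. \<forall>d\<in>B. \<forall>p \<in> fst c \<inter> fst d.
        0 < det (matrix (frechet_derivative (transition c d) (at (snd c p))))))"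

definition smooth_functions :: "('a, 'n::finite) chart set \<Rightarrow> ('a \<Rightarrow> real) set" where
  "smooth_functions A = {f. \<forall>c\<in>A. smooth_on (chart_image c) (f \<circ> chart_inv c)}"

text \<open>
  A tangent vector at a point is a derivation of the ring of smooth functions at that point.
  It is set to 0 on functions that are not smooth, so that equality of derivations is equality
  in HOL.
\<close>

type_synonym 'a tangent_vector = "('a \<Rightarrow> real) \<Rightarrow> real"

definition tangent_space :: "('a, 'n::finite) chart set \<Rightarrow> 'a \<Rightarrow> 'a tangent_vector set" where
  "tangent_space A p = {v.
     (\<forall>f. f \<notin> smooth_functions A \<longrightarrow> v f = 0) \<and>
     (\<forall>f\<in>smooth_functions A. \<forall>g\<in>smooth_functions A.
        v (\<lambda>q. f q + g q) = v f + v g \<and>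
        v (\<lambda>q. f q * g q) = f p * v g + g p * v f) \<and>
     (\<forall>r. \<forall>f\<in>smooth_functions A. v (\<lambda>q. r * f q) = r * v f)}"

text \<open>
  The tangent vector at \<open>p\<close> whose components in the chart \<open>c\<close> are \<open>\<xi>\<close>; the case
  \<open>\<xi> = axis i 1\<close> is the \<open>i\<close>-th coordinate vector.
\<close>

definition coord_vector ::
  "('a, 'n::finite) chart set \<Rightarrow> ('a, 'n) chart \<Rightarrow> 'a \<Rightarrow> real^'n \<Rightarrow> 'a tangent_vector" where
  "coord_vector A c p \<xi> = (\<lambda>f. if f \<in> smooth_functions A
     then frechet_derivative (f \<circ> chart_inv c) (at (snd c p)) \<xi> else 0)"

type_synonym 'a vector_field = "'a \<Rightarrow> 'a tangent_vector"

text \<open>Smoothness of a section of the tangent bundle: its components in each chart are smooth.\<close>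

definition vector_fields :: "('a, 'n::finite) chart set \<Rightarrow> 'a vector_field set" where
  "vector_fields A = {X. (\<forall>p. X p \<in> tangent_space A p) \<and>
     (\<forall>c\<in>A. \<exists>\<xi> :: real^'n \<Rightarrow> real^'n. smooth_on (chart_image c) \<xi> \<and>
        (\<forall>p\<in>fst c. X p = coord_vector A c p (\<xi> (snd c p))))}"

definition vf_add :: "'a vector_field \<Rightarrow> 'a vector_field \<Rightarrow> 'a vector_field" where
  "vf_add X Y = (\<lambda>p h. X p h + Y p h)"

definition vf_scale :: "('a \<Rightarrow> real) \<Rightarrow> 'a vector_field \<Rightarrow> 'a vector_field" where
  "vf_scale f X = (\<lambda>p h. f p * X p h)"

definition vf_apply :: "'a vector_field \<Rightarrow> ('a \<Rightarrow> real) \<Rightarrow> 'a \<Rightarrow> real" where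
  "vf_apply X f = (\<lambda>p. X p f)"

definition lie_bracket :: "'a vector_field \<Rightarrow> 'a vector_field \<Rightarrow> 'a vector_field" where
  "lie_bracket X Y = (\<lambda>p h. X p (vf_apply Y h) - Y p (vf_apply X h))"

definition linear_operator ::
  "('a, 'n::finite) chart set \<Rightarrow> ('a vector_field \<Rightarrow> 'a \<Rightarrow> real) \<Rightarrow> bool" where
  "linear_operator A D \<longleftrightarrow>
     (\<forall>X\<in>vector_fields A. D X \<in> smooth_functions A) \<and>
     (\<forall>X\<in>vector_fields A. \<forall>Y\<in>vector_fields A. D (vf_add X Y) = (\<lambda>p. D X p + D Y p)) \<and>
     (\<forall>r. \<forall>X\<in>vector_fields A. D (vf_scale (\<lambda>_. r) X) = (\<lambda>p. r * D X p))"

text \<open>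
  A differential form of degree \<open>CARD('k)\<close>: a family of alternating multilinear maps, with
  arguments indexed by \<open>'k\<close>, on the tangent spaces, whose components in each chart are smooth.
  The values are 0 on arguments outside the tangent space.
\<close>

definition alternating_form ::
  "('a, 'n::finite) chart set \<Rightarrow> 'a \<Rightarrow> (('k \<Rightarrow> 'a tangent_vector) \<Rightarrow> real) \<Rightarrow> bool" where
  "alternating_form A p \<omega> \<longleftrightarrow>
     (\<forall>v. (\<exists>i. v i \<notin> tangent_space A p) \<longrightarrow> \<omega> v = 0) \<and>
     (\<forall>v i u w. (\<forall>j. v j \<in> tangent_space A p) \<longrightarrow> u \<in> tangent_space A p \<longrightarrow>
        w \<in> tangent_space A p \<longrightarrow>
        \<omega> (v(i := (\<lambda>h. u h + w h))) = \<omega> (v(i := u)) + \<omega> (v(i := w))) \<and>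
     (\<forall>v i u r. (\<forall>j. v j \<in> tangent_space A p) \<longrightarrow> u \<in> tangent_space A p \<longrightarrow>
        \<omega> (v(i := (\<lambda>h. r * u h))) = r * \<omega> (v(i := u))) \<and>
     (\<forall>v i j. (\<forall>k. v k \<in> tangent_space A p) \<longrightarrow> i \<noteq> j \<longrightarrow> v i = v j \<longrightarrow> \<omega> v = 0)"

definition differential_forms ::
  "('a, 'n::finite) chart set \<Rightarrow> ('a \<Rightarrow> ('k::finite \<Rightarrow> 'a tangent_vector) \<Rightarrow> real) set" where
  "differential_forms A = {\<omega>. (\<forall>p. alternating_form A p (\<omega> p)) \<and>
     (\<forall>c\<in>A. \<forall>\<iota> :: 'k \<Rightarrow> 'n. smooth_on (chart_image c)
        (\<lambda>x. \<omega> (chart_inv c x) (\<lambda>k. coord_vector A c (chart_inv c x) (axis (\<iota> k) 1))))}"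

definition form_eval ::
  "('a \<Rightarrow> ('k \<Rightarrow> 'a tangent_vector) \<Rightarrow> real) \<Rightarrow> ('k \<Rightarrow> 'a vector_field) \<Rightarrow> 'a \<Rightarrow> real" where
  "form_eval \<omega> Xs = (\<lambda>p. \<omega> p (\<lambda>k. Xs k p))"

text \<open>One-forms are the differential forms whose arguments are indexed by the one-element type.\<close>

type_synonym 'a one_form = "'a \<Rightarrow> (unit \<Rightarrow> 'a tangent_vector) \<Rightarrow> real"

definition ext_deriv1 ::
  "'a one_form \<Rightarrow> 'a vector_field \<Rightarrow> 'a vector_field \<Rightarrow> 'a \<Rightarrow> real" where
  "ext_deriv1 \<alpha> X Y = (\<lambda>p. vf_apply X (form_eval \<alpha> (\<lambda>_. Y)) p
     - vf_apply Y (form_eval \<alpha> (\<lambda>_. X)) p - form_eval \<alpha> (\<lambda>_. lie_bracket X Y) p)"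

definition closed_one_forms :: "('a, 'n::finite) chart set \<Rightarrow> 'a one_form set" where
  "closed_one_forms A = {\<alpha> \<in> differential_forms A.
     \<forall>X\<in>vector_fields A. \<forall>Y\<in>vector_fields A. ext_deriv1 \<alpha> X Y = (\<lambda>p. 0)}"

definition ext_deriv0 :: "('a, 'n::finite) chart set \<Rightarrow> ('a \<Rightarrow> real) \<Rightarrow> 'a one_form" where
  "ext_deriv0 A f = (\<lambda>p v. if v () \<in> tangent_space A p then v () f else 0)"

definition exact_one_forms :: "('a, 'n::finite) chart set \<Rightarrow> 'a one_form set" where
  "exact_one_forms A = ext_deriv0 A ` smooth_functions A"

definition de_Rham_class :: "('a, 'n::finite) chart set \<Rightarrow> 'a one_form \<Rightarrow> 'a one_form set" where
  "de_Rham_class A \<alpha> =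
     {\<beta> \<in> closed_one_forms A. (\<lambda>p v. \<beta> p v - \<alpha> p v) \<in> exact_one_forms A}"

definition de_Rham_H1 :: "('a, 'n::finite) chart set \<Rightarrow> 'a one_form set set" where
  "de_Rham_H1 A = de_Rham_class A ` closed_one_forms A"

text \<open>Forms of top degree are those whose arguments are indexed by the type \<open>'n\<close> of coordinates.\<close>

definition volume_form ::
  "('a, 'n::finite) chart set \<Rightarrow> ('a \<Rightarrow> ('n \<Rightarrow> 'a tangent_vector) \<Rightarrow> real) \<Rightarrow> bool" where
  "volume_form A \<Omega> \<longleftrightarrow> \<Omega> \<in> differential_forms A \<and> (\<forall>p. \<Omega> p \<noteq> (\<lambda>v. 0))"

text \<open>
  The Lie derivative along \<open>X\<close> is the tensor derivation that is \<open>X\<close> on functions and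
  \<open>[X, _]\<close> on vector fields; on forms this is, evaluated on vector fields, the following.
\<close>

definition lie_derivative ::
  "'a vector_field \<Rightarrow> ('a \<Rightarrow> ('k::finite \<Rightarrow> 'a tangent_vector) \<Rightarrow> real)
     \<Rightarrow> ('k \<Rightarrow> 'a vector_field) \<Rightarrow> 'a \<Rightarrow> real" where
  "lie_derivative X \<omega> Xs = (\<lambda>p. vf_apply X (form_eval \<omega> Xs) p
     - (\<Sum>k\<in>UNIV. form_eval \<omega> (Xs(k := lie_bracket X (Xs k))) p))"

definition divergence ::
  "('a, 'n::finite) chart set \<Rightarrow> ('a \<Rightarrow> ('n \<Rightarrow> 'a tangent_vector) \<Rightarrow> real)
     \<Rightarrow> 'a vector_field \<Rightarrow> 'a \<Rightarrow> real" where
  "divergence A \<Omega> X = (THE g. g \<in> smooth_functions A \<and>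
     (\<forall>Xs. (\<forall>i. Xs i \<in> vector_fields A) \<longrightarrow>
        lie_derivative X \<Omega> Xs = (\<lambda>p. g p * form_eval \<Omega> Xs p)))"

definition bracket_rule ::
  "('a, 'n::finite) chart set \<Rightarrow> ('a vector_field \<Rightarrow> 'a \<Rightarrow> real) \<Rightarrow> bool" where
  "bracket_rule A D \<longleftrightarrow> (\<forall>X1\<in>vector_fields A. \<forall>X2\<in>vector_fields A.
     D (lie_bracket X1 X2) = (\<lambda>p. vf_apply X1 (D X2) p - vf_apply X2 (D X1) p))"

definition product_rule ::
  "('a, 'n::finite) chart set \<Rightarrow> ('a vector_field \<Rightarrow> 'a \<Rightarrow> real) \<Rightarrow> bool" where
  "product_rule A D \<longleftrightarrow> (\<forall>f\<in>smooth_functions A. \<forall>X\<in>vector_fields A.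
     D (vf_scale f X) = (\<lambda>p. f p * D X p + vf_apply X f p))"

end

theory Submission
  imports Defs
begin

text \<open>
  In a chart, an operator \<open>D\<close> that satisfies the product rule has the form
  \<open>D X = div \<xi> + b \<bullet> \<xi>\<close>, where \<open>\<xi>\<close> are the components of \<open>X\<close>, and the bracket rule says that the
  one-form \<open>b\<close> is closed. For the divergence of a volume form with component \<open>\<rho>\<close> one has
  \<open>b = d (ln \<bar>\<rho>\<bar>)\<close>, so \<open>D\<close> is the divergence of a volume form if and only if the local potentials of the
  forms \<open>b\<close> fit together to components \<open>\<rho>\<close> of a top form.

  If \<open>M\<close> is orientable, it carries some volume form; the difference of \<open>D\<close> and its divergence is a closed
  one-form on \<open>M\<close>, and if this is \<open>df\<close>, then multiplying the volume form by \<open>exp f\<close> gives \<open>D\<close>.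

  In general, the local volume forms with divergence \<open>D\<close> are unique up to constant factors and so form
  a local system of rank one, which has a nonzero global section if \<open>M\<close> is simply connected. This needs
  neither an orientation nor \<open>H\<^sup>1\<close>.
\<close>

section \<open>Smooth functions on Euclidean space\<close>

text \<open>The coefficient \<open>b\<close> is not a one-form on the manifold: under a change of
  coordinates it picks up the differential of \<open>ln \<bar>jac\<bar>\<close>. Only the difference
  of two such operators is a one-form, hence the reference volume form in the orientable case. That
  form splits into a positive density, which exists on every manifold because logarithms of
  Jacobians can be averaged, and a sign, which is all that an orientation supplies. In the simply
  connected case the constants of the local system are nonzero reals of either sign, so trivial
  monodromy delivers the sign together with the density. Components are therefore compared through
  \<open>ln \<bar>\<rho>\<bar>\<close>.

  A second difficulty shapes the details: tangent vectors act on globally defined smooth functions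
  and vector fields are global, so \<open>D\<close> cannot simply be restricted to a chart. Every
  local statement is reached through cut-off functions; in particular the locality of
  \<open>D\<close> is not assumed but follows from the product rule, applied to a bump function
  times a field.\<close>

lemma frechet_derivative_cong_open:
  assumes "open S" "x \<in> S" "\<And>y. y \<in> S \<Longrightarrow> f y = g y"
  shows "frechet_derivative f (at x) = frechet_derivative g (at x)"
proof -
  have "(f has_derivative D) (at x) \<longleftrightarrow> (g has_derivative D) (at x)" for D
    using has_derivative_transform_within_open[OF _ assms(1,2)] assms(3) by metis
  then show ?thesis by (simp add: frechet_derivative_def)
qed

lemma differentiable_cong_open:
  assumes "open S" "x \<in> S" "\<And>y. y \<in> S \<Longrightarrow> f y = g y"
  shows "f differentiable (at x) \<longleftrightarrow> g differentiable (at x)"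
  unfolding differentiable_def
  using has_derivative_transform_within_open[OF _ assms(1,2)] assms(3) by metis

lemma Ck_on_subset: "Ck_on k S f \<Longrightarrow> T \<subseteq> S \<Longrightarrow> Ck_on k T f"
  by (induction k arbitrary: f) (auto intro: continuous_on_subset)

lemma Ck_on_cong_imp:
  assumes "open S" "\<And>y. y \<in> S \<Longrightarrow> f y = g y" "Ck_on k S f"
  shows "Ck_on k S g"
  using assms(2,3)
proof (induction k arbitrary: f g)
  case 0
  then show ?case by (simp cong: continuous_on_cong)
next
  case (Suc k)
  have "g differentiable (at x)" if "x \<in> S" for x
    using Suc.prems(2) that differentiable_cong_open[OF assms(1) that, of f g] Suc.prems(1) by auto
  moreover have "Ck_on k S (\<lambda>x. frechet_derivative g (at x) v)" for v
  proof (rule Suc.IH)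
    show "Ck_on k S (\<lambda>x. frechet_derivative f (at x) v)" using Suc.prems(2) by simp
    show "frechet_derivative f (at y) v = frechet_derivative g (at y) v" if "y \<in> S" for y
      using frechet_derivative_cong_open[OF assms(1) that, of f g] Suc.prems(1) by simp
  qed
  ultimately show ?case by simp
qed

text \<open>\<open>Ck_on\<close> uses derivatives at \<open>x\<close> in the full space, so it is a
  condition at each point of \<open>S\<close>; the neighbourhood \<open>T\<close> may even stick out
  of \<open>S\<close>.\<close>

lemma Ck_on_local:
  assumes "\<And>x. x \<in> S \<Longrightarrow> \<exists>T. open T \<and> x \<in> T \<and> Ck_on k T f"
  shows "Ck_on k S f"
  using assms
proof (induction k arbitrary: f)
  case 0
  have "continuous (at x) f" if x: "x \<in> S" for x
    using 0[OF x] by (auto simp: continuous_on_eq_continuous_at)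
  then show ?case by (simp add: continuous_at_imp_continuous_on)
next
  case (Suc k)
  have "f differentiable (at x)" if "x \<in> S" for x
    using Suc.prems[OF that] by auto
  moreover have "Ck_on k S (\<lambda>x. frechet_derivative f (at x) v)" for v
    by (rule Suc.IH) (use Suc.prems in fastforce)
  ultimately show ?case by simp
qed

lemma Ck_on_Suc_imp: "Ck_on (Suc k) S f \<Longrightarrow> Ck_on k S f"
proof (induction k arbitrary: f)
  case 0
  have "continuous (at x) f" if "x \<in> S" for x
    using 0 that by (intro differentiable_imp_continuous_within) simp
  then show ?case by (simp add: continuous_at_imp_continuous_on)
next
  case (Suc k)
  have "Ck_on k S (\<lambda>x. frechet_derivative f (at x) v)" for v
    by (rule Suc.IH) (use Suc.prems Ck_on.simps(2)[of "Suc k" S f] in blast)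
  then show ?case using Suc.prems Ck_on.simps(2)[of "Suc k" S f] Ck_on.simps(2)[of k S f] by blast
qed

text \<open>The closure proofs below run by induction on \<open>k\<close> through this rule: it
  admits an explicit derivative \<open>f'\<close> in place of \<open>frechet_derivative\<close>,
  since the two agree on the open set \<open>S\<close>.\<close>

lemma Ck_on_SucI:
  assumes "open S" "\<And>x. x \<in> S \<Longrightarrow> (f has_derivative f' x) (at x)"
    "\<And>v. Ck_on k S (\<lambda>x. f' x v)"
  shows "Ck_on (Suc k) S f"
proof -
  have *: "frechet_derivative f (at x) = f' x" if "x \<in> S" for x
    using assms(2)[OF that] frechet_derivative_at by metis
  have "Ck_on k S (\<lambda>x. frechet_derivative f (at x) v)" for v
    by (rule Ck_on_cong_imp[OF assms(1) _ assms(3)[of v]]) (simp add: *)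
  then show ?thesis using assms(2) by (auto simp: differentiable_def)
qed

lemma Ck_on_Suc_has_derivative:
  assumes "Ck_on (Suc k) S f" "x \<in> S"
  shows "(f has_derivative frechet_derivative f (at x)) (at x)"
  using assms frechet_derivative_works by auto

lemma Ck_on_const: "Ck_on k S (\<lambda>x. c)"
proof (induction k arbitrary: c)
  case (Suc k)
  show ?case using Suc[of 0] by (simp add: frechet_derivative_const)
qed auto

lemma Ck_on_bounded_linear:
  assumes "bounded_linear L" "open S" "Ck_on k S f"
  shows "Ck_on k S (\<lambda>x. L (f x))"
  using assms(3)
proof (induction k arbitrary: f)
  case 0
  then show ?case using bounded_linear.continuous_on[OF assms(1)] by simp
next
  case (Suc k)
  show ?case
  proof (rule Ck_on_SucI[OF assms(2)])
    show "((\<lambda>x. L (f x)) has_derivative (\<lambda>v. L (frechet_derivative f (at x) v))) (at x)"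
      if "x \<in> S" for x
      by (rule bounded_linear.has_derivative[OF assms(1) Ck_on_Suc_has_derivative[OF Suc.prems that]])
    show "Ck_on k S (\<lambda>x. L (frechet_derivative f (at x) v))" for v
      using Suc by simp
  qed
qed

lemma Ck_on_add:
  assumes "open S" "Ck_on k S f" "Ck_on k S g"
  shows "Ck_on k S (\<lambda>x. f x + g x)"
  using assms(2,3)
proof (induction k arbitrary: f g)
  case 0
  then show ?case by (simp add: continuous_on_add)
next
  case (Suc k)
  show ?case
  proof (rule Ck_on_SucI[OF assms(1)])
    show "((\<lambda>x. f x + g x) has_derivative
        (\<lambda>v. frechet_derivative f (at x) v + frechet_derivative g (at x) v)) (at x)"
      if "x \<in> S" for x
      by (rule has_derivative_add[OF Ck_on_Suc_has_derivative[OF Suc.prems(1) that] Ck_on_Suc_has_derivative[OF Suc.prems(2) that]])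
    show "Ck_on k S (\<lambda>x. frechet_derivative f (at x) v + frechet_derivative g (at x) v)" for v
      using Suc by simp
  qed
qed

text \<open>By Leibniz a directional derivative is a sum of two terms built with \<open>B\<close>
  again, so the induction closes once \<open>f\<close> and \<open>g\<close> are generalised. One
  proof serves multiplication, scaling and inner products.\<close>

lemma Ck_on_bilinear:
  assumes B: "bounded_bilinear B" and "open S" "Ck_on k S f" "Ck_on k S g"
  shows "Ck_on k S (\<lambda>x. B (f x) (g x))"
  using assms(3,4)
proof (induction k arbitrary: f g)
  case 0
  then show ?case using bounded_bilinear.continuous_on[OF B] by simp
next
  case (Suc k)
  show ?case
  proof (rule Ck_on_SucI[OF assms(2)])
    show "((\<lambda>x. B (f x) (g x)) has_derivative
        (\<lambda>v. B (f x) (frechet_derivative g (at x) v) + B (frechet_derivative f (at x) v) (g x))) (at x)"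
      if "x \<in> S" for x
      by (rule bounded_bilinear.FDERIV[OF B Ck_on_Suc_has_derivative[OF Suc.prems(1) that] Ck_on_Suc_has_derivative[OF Suc.prems(2) that]])
    show "Ck_on k S (\<lambda>x. B (f x) (frechet_derivative g (at x) v) + B (frechet_derivative f (at x) v) (g x))" for v
      using Suc Ck_on_Suc_imp[OF Suc.prems(1)] Ck_on_Suc_imp[OF Suc.prems(2)]
      by (intro Ck_on_add assms(2)) auto
  qed
qed

lemma Ck_on_sum:
  assumes "open S" "\<And>i. i \<in> I \<Longrightarrow> Ck_on k S (f i)"
  shows "Ck_on k S (\<lambda>x. \<Sum>i\<in>I. f i x)"
  using assms(2)
  by (induction I rule: infinite_finite_induct) (auto simp: Ck_on_const Ck_on_add[OF assms(1)])

lemma smooth_onD: "smooth_on S f \<Longrightarrow> x \<in> S \<Longrightarrow> (f has_derivative frechet_derivative f (at x)) (at x)"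
  unfolding smooth_on_def using Ck_on_Suc_has_derivative by blast

lemma smooth_on_differentiable: "smooth_on S f \<Longrightarrow> x \<in> S \<Longrightarrow> f differentiable (at x)"
  using smooth_onD differentiable_def by blast

lemma smooth_on_continuous: "smooth_on S f \<Longrightarrow> continuous_on S f"
  unfolding smooth_on_def using Ck_on.simps(1) by blast

lemma smooth_on_frechet: "smooth_on S f \<Longrightarrow> smooth_on S (\<lambda>x. frechet_derivative f (at x) v)"
  unfolding smooth_on_def using Ck_on.simps(2) by blast

lemma smooth_onI:
  assumes "open S" "\<And>x. x \<in> S \<Longrightarrow> (f has_derivative f' x) (at x)"
    "\<And>v. smooth_on S (\<lambda>x. f' x v)"
  shows "smooth_on S f"
  unfolding smooth_on_def
proof
  fix k
  have "Ck_on (Suc k) S f"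
    by (rule Ck_on_SucI[OF assms(1,2)]) (use assms(3) smooth_on_def in auto)
  then show "Ck_on k S f" by (rule Ck_on_Suc_imp)
qed

lemma smooth_on_subset: "smooth_on S f \<Longrightarrow> T \<subseteq> S \<Longrightarrow> smooth_on T f"
  unfolding smooth_on_def using Ck_on_subset by blast

lemma smooth_on_cong:
  assumes "open S" "\<And>y. y \<in> S \<Longrightarrow> f y = g y"
  shows "smooth_on S f \<longleftrightarrow> smooth_on S g"
  unfolding smooth_on_def
  by (intro iff_allI iffI; erule Ck_on_cong_imp[OF assms(1), rotated]) (simp_all add: assms(2))

lemma smooth_on_local:
  assumes "\<And>x. x \<in> S \<Longrightarrow> \<exists>T. open T \<and> x \<in> T \<and> smooth_on T f"
  shows "smooth_on S f"
  unfolding smooth_on_def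
proof
  fix k show "Ck_on k S f"
    by (rule Ck_on_local) (use assms smooth_on_def in blast)
qed

lemma smooth_on_const [simp]: "smooth_on S (\<lambda>x. c)"
  by (simp add: smooth_on_def Ck_on_const)

lemma smooth_on_add:
  "open S \<Longrightarrow> smooth_on S f \<Longrightarrow> smooth_on S g \<Longrightarrow> smooth_on S (\<lambda>x. f x + g x)"
  by (simp add: smooth_on_def Ck_on_add)

lemma smooth_on_bounded_linear:
  "bounded_linear L \<Longrightarrow> open S \<Longrightarrow> smooth_on S f \<Longrightarrow> smooth_on S (\<lambda>x. L (f x))"
  by (simp add: smooth_on_def Ck_on_bounded_linear)

lemma smooth_on_bilinear:
  "bounded_bilinear B \<Longrightarrow> open S \<Longrightarrow> smooth_on S f \<Longrightarrow> smooth_on S g \<Longrightarrow> smooth_on S (\<lambda>x. B (f x) (g x))"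
  by (simp add: smooth_on_def Ck_on_bilinear)

lemma smooth_on_sum:
  "open S \<Longrightarrow> (\<And>i. i \<in> I \<Longrightarrow> smooth_on S (f i)) \<Longrightarrow> smooth_on S (\<lambda>x. \<Sum>i\<in>I. f i x)"
  by (simp add: smooth_on_def Ck_on_sum)

lemma smooth_on_mult:
  fixes f g :: "real^'n \<Rightarrow> real"
  shows "open S \<Longrightarrow> smooth_on S f \<Longrightarrow> smooth_on S g \<Longrightarrow> smooth_on S (\<lambda>x. f x * g x)"
  by (rule smooth_on_bilinear[OF bounded_bilinear_mult])

lemma smooth_on_scaleR:
  "open S \<Longrightarrow> smooth_on S f \<Longrightarrow> smooth_on S g \<Longrightarrow> smooth_on S (\<lambda>x. f x *\<^sub>R g x)"
  by (rule smooth_on_bilinear[OF bounded_bilinear_scaleR])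

lemma smooth_on_inner:
  "open S \<Longrightarrow> smooth_on S f \<Longrightarrow> smooth_on S g \<Longrightarrow> smooth_on S (\<lambda>x. f x \<bullet> g x)"
  by (rule smooth_on_bilinear[OF bounded_bilinear_inner])

lemma smooth_on_minus: "open S \<Longrightarrow> smooth_on S f \<Longrightarrow> smooth_on S (\<lambda>x. - f x)"
  by (rule smooth_on_bounded_linear[OF bounded_linear_minus[OF bounded_linear_ident]])

lemma smooth_on_diff:
  "open S \<Longrightarrow> smooth_on S f \<Longrightarrow> smooth_on S g \<Longrightarrow> smooth_on S (\<lambda>x. f x - g x)"
  using smooth_on_add[of S f "\<lambda>x. - g x"] smooth_on_minus[of S g] by simp

lemma smooth_on_id: "open S \<Longrightarrow> smooth_on S (\<lambda>x. x)"
  by (rule smooth_onI[where f'="\<lambda>x v. v"]) auto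

lemma smooth_on_nth: "open S \<Longrightarrow> smooth_on S f \<Longrightarrow> smooth_on S (\<lambda>x. f x $ i)"
  by (rule smooth_on_bounded_linear[OF bounded_linear_vec_nth])

lemma smooth_on_vec_iff:
  fixes f :: "real^'n \<Rightarrow> real^'m"
  assumes "open S"
  shows "smooth_on S f \<longleftrightarrow> (\<forall>i. smooth_on S (\<lambda>x. f x $ i))"
proof
  assume *: "\<forall>i. smooth_on S (\<lambda>x. f x $ i)"
  have "smooth_on S (\<lambda>x. \<Sum>i\<in>UNIV. (f x $ i) *\<^sub>R axis i (1::real))"
    by (intro smooth_on_sum smooth_on_scaleR assms) (use * in auto)
  moreover have "(\<lambda>x. \<Sum>i\<in>UNIV. (f x $ i) *\<^sub>R axis i (1::real)) = f"
    using basis_expansion[of "f _"] by (simp add: scalar_mult_eq_scaleR)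
  ultimately show "smooth_on S f" by simp
qed (use smooth_on_nth assms in blast)

text \<open>Turns a derivative in a moving direction into a finite sum of derivatives in fixed
  directions, which are what \<open>Ck_on\<close> speaks about.\<close>

lemma linear_axis_sum:
  fixes L :: "real^'n \<Rightarrow> 'b::real_vector"
  assumes "linear L"
  shows "L v = (\<Sum>i\<in>UNIV. (v $ i) *\<^sub>R L (axis i 1))"
proof -
  have "L v = L (\<Sum>i\<in>UNIV. (v $ i) *\<^sub>R axis i 1)"
    using basis_expansion[of v] by (simp add: scalar_mult_eq_scaleR)
  also have "\<dots> = (\<Sum>i\<in>UNIV. (v $ i) *\<^sub>R L (axis i 1))"
    by (simp add: linear_sum[OF assms] linear_cmul[OF assms])
  finally show ?thesis .
qed

lemma smooth_on_linear_frechet: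
  "smooth_on S f \<Longrightarrow> x \<in> S \<Longrightarrow> linear (frechet_derivative f (at x))"
  using linear_frechet_derivative smooth_on_differentiable by blast

lemma smooth_on_compose:
  fixes f :: "real^'m \<Rightarrow> 'b::real_normed_vector" and g :: "real^'n \<Rightarrow> real^'m"
  assumes "open S" "open T" "smooth_on T f" "smooth_on S g" "g ` S \<subseteq> T"
  shows "smooth_on S (\<lambda>x. f (g x))"
  unfolding smooth_on_def
proof
  fix k
  show "Ck_on k S (\<lambda>x. f (g x))" using assms(3)
  proof (induction k arbitrary: f)
    case 0
    then show ?case
      using continuous_on_compose2[OF smooth_on_continuous smooth_on_continuous[OF assms(4)] assms(5), of f] by simp
  next
    case (Suc k)
    show ?case
    proof (rule Ck_on_SucI[OF assms(1)])
      fix x assume x: "x \<in> S"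
      then have gx: "g x \<in> T" using assms(5) by auto
      \<comment> \<open>The chain rule, expanded over the axes: each summand contains a derivative
        of \<open>f\<close> in a fixed direction composed with \<open>g\<close>, so the induction
        hypothesis applies to it.\<close>
      let ?D = "\<lambda>x v. \<Sum>i\<in>UNIV. (frechet_derivative g (at x) v $ i) *\<^sub>R frechet_derivative f (at (g x)) (axis i 1)"
      have "((\<lambda>x. f (g x)) has_derivative (\<lambda>v. frechet_derivative f (at (g x)) (frechet_derivative g (at x) v))) (at x)"
        by (rule has_derivative_compose[OF smooth_onD[OF assms(4) x] smooth_onD[OF Suc.prems gx]])
      then show "((\<lambda>x. f (g x)) has_derivative ?D x) (at x)"
        by (subst (asm) linear_axis_sum[OF smooth_on_linear_frechet[OF Suc.prems gx]])
    next
      fix v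
      show "Ck_on k S (\<lambda>x. \<Sum>i\<in>UNIV. (frechet_derivative g (at x) v $ i) *\<^sub>R frechet_derivative f (at (g x)) (axis i 1))"
      proof (intro Ck_on_sum Ck_on_bilinear[OF bounded_bilinear_scaleR] assms(1))
        fix i
        show "Ck_on k S (\<lambda>x. frechet_derivative g (at x) v $ i)"
          using smooth_on_nth[OF assms(1) smooth_on_frechet[OF assms(4)]] smooth_on_def by blast
        show "Ck_on k S (\<lambda>x. frechet_derivative f (at (g x)) (axis i 1))"
          by (rule Suc.IH[OF smooth_on_frechet[OF Suc.prems]])
      qed
    qed
  qed
qed

text \<open>The derivative contains \<open>exp (g x)\<close> itself as a factor, so order
  \<open>k\<close> gives order \<open>k + 1\<close>; the proof for \<open>inverse\<close> below is
  of the same kind.\<close>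

lemma smooth_on_exp:
  fixes g :: "real^'n \<Rightarrow> real"
  assumes "open S" "smooth_on S g"
  shows "smooth_on S (\<lambda>x. exp (g x))"
  unfolding smooth_on_def
proof
  fix k
  show "Ck_on k S (\<lambda>x. exp (g x))"
  proof (induction k)
    case 0
    then show ?case using smooth_on_continuous[OF assms(2)] by (simp add: continuous_on_exp)
  next
    case (Suc k)
    show ?case
    proof (rule Ck_on_SucI[OF assms(1)])
      fix x assume x: "x \<in> S"
      have "(exp has_derivative (\<lambda>h. exp (g x) * h)) (at (g x))"
        using DERIV_exp[of "g x"] by (simp add: has_field_derivative_def)
      from has_derivative_compose[OF smooth_onD[OF assms(2) x] this]
      show "((\<lambda>x. exp (g x)) has_derivative (\<lambda>v. exp (g x) * frechet_derivative g (at x) v)) (at x)" .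
    next
      show "Ck_on k S (\<lambda>x. exp (g x) * frechet_derivative g (at x) v)" for v
        using Suc smooth_on_frechet[OF assms(2)] smooth_on_def
        by (intro Ck_on_bilinear[OF bounded_bilinear_mult] assms(1)) auto
    qed
  qed
qed

lemma smooth_on_inverse:
  fixes g :: "real^'n \<Rightarrow> real"
  assumes "open S" "smooth_on S g" "\<And>x. x \<in> S \<Longrightarrow> g x \<noteq> 0"
  shows "smooth_on S (\<lambda>x. inverse (g x))"
  unfolding smooth_on_def
proof
  fix k
  show "Ck_on k S (\<lambda>x. inverse (g x))"
  proof (induction k)
    case 0
    then show ?case using smooth_on_continuous[OF assms(2)] assms(3) by (simp add: continuous_on_inverse)
  next
    case (Suc k)
    show ?case
    proof (rule Ck_on_SucI[OF assms(1)])
      fix x assume x: "x \<in> S"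
      from has_derivative_compose[OF smooth_onD[OF assms(2) x] has_derivative_inverse'[OF assms(3)[OF x]]]
      show "((\<lambda>x. inverse (g x)) has_derivative
          (\<lambda>v. - (inverse (g x) * frechet_derivative g (at x) v * inverse (g x)))) (at x)" .
    next
      show "Ck_on k S (\<lambda>x. - (inverse (g x) * frechet_derivative g (at x) v * inverse (g x)))" for v
        using Suc smooth_on_frechet[OF assms(2)] smooth_on_def
        by (intro Ck_on_bilinear[OF bounded_bilinear_mult] Ck_on_bounded_linear[OF bounded_linear_minus[OF bounded_linear_ident]] assms(1)) auto
    qed
  qed
qed

lemma smooth_on_divide:
  fixes f g :: "real^'n \<Rightarrow> real"
  assumes "open S" "smooth_on S f" "smooth_on S g" "\<And>x. x \<in> S \<Longrightarrow> g x \<noteq> 0"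
  shows "smooth_on S (\<lambda>x. f x / g x)"
  unfolding divide_inverse by (intro smooth_on_mult smooth_on_inverse assms)

text \<open>The absolute value makes logarithmic derivatives available for volume forms whose
  components are negative.\<close>

lemma DERIV_ln_abs:
  fixes t :: real
  assumes "t \<noteq> 0"
  shows "((\<lambda>t. ln \<bar>t\<bar>) has_real_derivative inverse t) (at t)"
proof (cases "t > 0")
  case True
  have "(ln has_real_derivative inverse t) (at t)" using DERIV_ln[OF True] .
  then show ?thesis
    by (rule has_field_derivative_transform_within_open[of _ _ _ "{0<..}"]) (use True in auto)
next
  case False
  have "((\<lambda>t. ln (- t)) has_real_derivative inverse t) (at t)"
    using False assms by (auto intro!: derivative_eq_intros simp: field_simps)
  then show ?thesis
    by (rule has_field_derivative_transform_within_open[of _ _ _ "{..<0}"]) (use False assms in auto)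
qed

lemma smooth_on_ln_abs:
  fixes g :: "real^'n \<Rightarrow> real"
  assumes "open S" "smooth_on S g" "\<And>x. x \<in> S \<Longrightarrow> g x \<noteq> 0"
  shows "smooth_on S (\<lambda>x. ln \<bar>g x\<bar>)"
proof (rule smooth_onI[OF assms(1)])
  fix x assume x: "x \<in> S"
  have "((\<lambda>t::real. ln \<bar>t\<bar>) has_derivative (\<lambda>h. inverse (g x) * h)) (at (g x))"
    using DERIV_ln_abs[OF assms(3)[OF x]] by (simp add: has_field_derivative_def)
  from has_derivative_compose[OF smooth_onD[OF assms(2) x] this]
  show "((\<lambda>x. ln \<bar>g x\<bar>) has_derivative (\<lambda>v. inverse (g x) * frechet_derivative g (at x) v)) (at x)" .
next
  show "smooth_on S (\<lambda>x. inverse (g x) * frechet_derivative g (at x) v)" for v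
    by (intro smooth_on_mult smooth_on_inverse smooth_on_frechet assms)
qed

section \<open>Bump functions on Euclidean space\<close>

lemma tendsto_power_exp_at_right_0:
  "((\<lambda>t::real. inverse t ^ k * exp (- inverse t)) \<longlongrightarrow> 0) (at_right 0)"
proof -
  have "((\<lambda>x::real. x ^ k / exp x) \<longlongrightarrow> 0) at_top" by (rule tendsto_power_div_exp_0)
  from filterlim_compose[OF this filterlim_inverse_at_top_right]
  show ?thesis by (simp add: exp_minus divide_inverse)
qed

text \<open>The classical flat function is the member \<open>k = 0\<close>. The powers of
  \<open>inverse t\<close> make the family closed under differentiation up to linear combinations,
  as an induction for smoothness requires.\<close>

definition flat_exp :: "nat \<Rightarrow> real \<Rightarrow> real" where
  "flat_exp k t = (if t > 0 then inverse t ^ k * exp (- inverse t) else 0)"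

lemma flat_exp_has_derivative:
  "(flat_exp k has_real_derivative flat_exp (k + 2) t - real k * flat_exp (k + 1) t) (at t)"
proof (cases "t = 0")
  case False
  show ?thesis
  proof (cases "t > 0")
    case True
    \<comment> \<open>The power rule yields the exponent \<open>k - Suc 0\<close>, which is
      truncated at \<open>k = 0\<close>; there the factor \<open>real k\<close> vanishes.\<close>
    have k: "real k * inverse t ^ (k - Suc 0) * inverse t = real k * inverse t ^ k"
      by (cases k) auto
    have "((\<lambda>t. inverse t ^ k * exp (- inverse t)) has_real_derivative
        inverse t ^ k * inverse t ^ 2 * exp (- inverse t)
        - (real k * inverse t ^ (k - Suc 0) * inverse t) * inverse t * exp (- inverse t)) (at t)"
      using True by (auto intro!: derivative_eq_intros simp: power2_eq_square algebra_simps)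
    then have "((\<lambda>t. inverse t ^ k * exp (- inverse t)) has_real_derivative
        flat_exp (k + 2) t - real k * flat_exp (k + 1) t) (at t)"
      unfolding k using True by (simp add: flat_exp_def power2_eq_square algebra_simps)
    then show ?thesis
      by (rule has_field_derivative_transform_within_open[of _ _ _ "{0<..}"])
        (use True in \<open>auto simp: flat_exp_def\<close>)
  next
    case neg: False
    have "((\<lambda>t. 0) has_real_derivative flat_exp (k + 2) t - real k * flat_exp (k + 1) t) (at t)"
      using neg by (auto simp: flat_exp_def)
    then show ?thesis
      by (rule has_field_derivative_transform_within_open[of _ _ _ "{..<0}"])
        (use False neg in \<open>auto simp: flat_exp_def\<close>)
  qed
next
  case True
  \<comment> \<open>At 0 the difference quotient from the right is
    \<open>flat_exp (Suc k) h\<close>, which tends to 0; from the left it is 0.\<close>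
  have "((\<lambda>h. flat_exp k h / h) \<longlongrightarrow> 0) (at 0)"
  proof (subst filterlim_split_at_real)
    show "filterlim (\<lambda>h. flat_exp k h / h) (nhds 0) (at_right 0)"
      using tendsto_power_exp_at_right_0[of "Suc k"]
      by (rule Lim_transform_eventually)
        (auto simp: eventually_at_filter flat_exp_def divide_inverse)
    show "filterlim (\<lambda>h. flat_exp k h / h) (nhds 0) (at_left 0)"
      using tendsto_const[of 0 "at_left 0"]
      by (rule Lim_transform_eventually)
        (auto simp: eventually_at_filter flat_exp_def)
  qed simp
  then show ?thesis unfolding True by (simp add: DERIV_def flat_exp_def)
qed

lemma smooth_on_flat_exp:
  fixes g :: "real^'n \<Rightarrow> real"
  assumes "open S" "smooth_on S g"
  shows "smooth_on S (\<lambda>x. flat_exp m (g x))"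
  unfolding smooth_on_def
proof
  fix k
  show "Ck_on k S (\<lambda>x. flat_exp m (g x))"
  proof (induction k arbitrary: m)
    case 0
    have "continuous_on UNIV (flat_exp m)"
      using flat_exp_has_derivative DERIV_isCont continuous_at_imp_continuous_on by blast
    then show ?case
      using continuous_on_compose2[OF _ smooth_on_continuous[OF assms(2)]] by auto
  next
    case (Suc k)
    let ?D = "\<lambda>x v. (flat_exp (m + 2) (g x) + (- real m) * flat_exp (m + 1) (g x)) * frechet_derivative g (at x) v"
    show ?case
    proof (rule Ck_on_SucI[OF assms(1)])
      fix x assume x: "x \<in> S"
      have "(flat_exp m has_derivative (\<lambda>h. (flat_exp (m + 2) (g x) + (- real m) * flat_exp (m + 1) (g x)) * h)) (at (g x))"
        using flat_exp_has_derivative[of m "g x"] by (simp add: has_field_derivative_def)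
      from has_derivative_compose[OF smooth_onD[OF assms(2) x] this]
      show "((\<lambda>x. flat_exp m (g x)) has_derivative ?D x) (at x)" .
    next
      fix v
      show "Ck_on k S (\<lambda>x. ?D x v)"
        by (intro Ck_on_bilinear[OF bounded_bilinear_mult] Ck_on_add assms(1) Ck_on_const Suc
            smooth_on_frechet[OF assms(2), unfolded smooth_on_def, rule_format])
    qed
  qed
qed

lemma bump_exists:
  fixes x0 :: "real^'n"
  assumes "0 < r" "r < R"
  shows "\<exists>\<beta> :: real^'n \<Rightarrow> real. smooth_on UNIV \<beta> \<and> (\<forall>x. 0 \<le> \<beta> x \<and> \<beta> x \<le> 1) \<and>
    (\<forall>x\<in>cball x0 r. \<beta> x = 1) \<and> (\<forall>x. x \<notin> ball x0 R \<longrightarrow> \<beta> x = 0)"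
proof -
  \<comment> \<open>Affine in the squared distance, with value 1 on the sphere of radius
    \<open>r\<close> and 0 on the sphere of radius \<open>R\<close>. Hence the quotient
    \<open>?b\<close> is 1 inside the former and 0 outside the latter; its denominator is positive
    because \<open>t\<close> and \<open>1 - t\<close> are never both nonpositive.\<close>
  let ?q = "\<lambda>x. (R\<^sup>2 - (x - x0) \<bullet> (x - x0)) / (R\<^sup>2 - r\<^sup>2)"
  let ?g = "flat_exp 0"
  let ?b = "\<lambda>x. ?g (?q x) / (?g (?q x) + ?g (1 - ?q x))"
  have pos: "R\<^sup>2 - r\<^sup>2 > 0" using assms by (simp add: power_strict_mono)
  have g0: "?g t \<ge> 0" for t by (simp add: flat_exp_def)
  have den: "?g t + ?g (1 - t) > 0" for t
    by (cases "t > 0") (auto simp: flat_exp_def add_pos_nonneg)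
  show ?thesis
  proof (intro exI[of _ ?b] conjI allI ballI impI)
    have q: "smooth_on UNIV ?q"
      by (intro smooth_on_divide smooth_on_diff smooth_on_inner smooth_on_id smooth_on_const open_UNIV)
        (use pos in auto)
    have g1: "smooth_on UNIV (\<lambda>x. ?g (?q x))" by (rule smooth_on_flat_exp[OF open_UNIV q])
    have g2: "smooth_on UNIV (\<lambda>x. ?g (1 - ?q x))"
      by (rule smooth_on_flat_exp[OF open_UNIV smooth_on_diff[OF open_UNIV smooth_on_const q]])
    show "smooth_on UNIV ?b"
      using den by (intro smooth_on_divide[OF open_UNIV g1 smooth_on_add[OF open_UNIV g1 g2]]) (metis less_irrefl)
    show "0 \<le> ?b x" "?b x \<le> 1" for x
      using g0[of "?q x"] g0[of "1 - ?q x"] den[of "?q x"] by (auto simp: divide_simps)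
    show "?b x = 1" if "x \<in> cball x0 r" for x
    proof -
      have "norm (x - x0) \<le> r" using that by (simp add: dist_norm norm_minus_commute)
      then have "(x - x0) \<bullet> (x - x0) \<le> r\<^sup>2"
        by (simp add: power2_norm_eq_inner[symmetric] power_mono)
      then have "?q x \<ge> 1" using pos by (simp add: field_simps)
      then have "?g (1 - ?q x) = 0" by (simp add: flat_exp_def)
      then show ?thesis using den[of "?q x"] by simp
    qed
    show "?b x = 0" if "x \<notin> ball x0 R" for x
    proof -
      have "norm (x - x0) \<ge> R" using that by (simp add: dist_norm norm_minus_commute)
      then have "(x - x0) \<bullet> (x - x0) \<ge> R\<^sup>2"
        using assms by (simp add: power2_norm_eq_inner[symmetric] power_mono)
      then have "?q x \<le> 0" using pos by (simp add: field_simps)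
      then show ?thesis by (simp add: flat_exp_def)
    qed
  qed
qed

section \<open>Gradients, the Hadamard lemma and the Poincare lemma\<close>

lemma frechet_derivative_eqI:
  "(f has_derivative D) (at x) \<Longrightarrow> frechet_derivative f (at x) v = D v"
  using frechet_derivative_at by metis

definition grad :: "(real^'n \<Rightarrow> real) \<Rightarrow> real^'n \<Rightarrow> real^'n" where
  "grad f x = (\<chi> i. frechet_derivative f (at x) (axis i 1))"

lemma frechet_derivative_grad:
  assumes "f differentiable (at x)"
  shows "frechet_derivative f (at x) v = grad f x \<bullet> v"
  using linear_axis_sum[OF linear_frechet_derivative[OF assms], of v]
  by (simp add: grad_def inner_vec_def mult.commute)

lemma has_derivative_grad:
  "smooth_on S f \<Longrightarrow> x \<in> S \<Longrightarrow> (f has_derivative (\<lambda>v. grad f x \<bullet> v)) (at x)"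
  using smooth_onD[of S f x] smooth_on_differentiable[of S f x] frechet_derivative_grad[of f x]
  by (metis (no_types, lifting) ext)

lemma smooth_on_grad: "open S \<Longrightarrow> smooth_on S f \<Longrightarrow> smooth_on S (grad f)"
  by (subst smooth_on_vec_iff) (simp_all add: grad_def smooth_on_frechet)

lemma segment_in_convex:
  fixes x0 :: "'a::real_vector"
  assumes "convex U" "x0 \<in> U" "x \<in> U" "t \<in> {0..1::real}"
  shows "x0 + t *\<^sub>R (x - x0) \<in> U"
proof -
  have "(1 - t) *\<^sub>R x0 + t *\<^sub>R x \<in> U"
    using assms by (intro convexD_alt) auto
  then show ?thesis by (simp add: algebra_simps)
qed

lemma continuous_on_radial:
  fixes h :: "real^'n \<Rightarrow> 'b::real_normed_vector"
  assumes "convex U" "x0 \<in> U" "continuous_on U h"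
  shows "continuous_on (U \<times> {0..1}) (\<lambda>(x, t). h (x0 + t *\<^sub>R (x - x0)))"
proof -
  have "continuous_on (U \<times> {0..1}) (\<lambda>p. h (x0 + snd p *\<^sub>R (fst p - x0)))"
    by (rule continuous_on_compose2[OF assms(3)])
      (use segment_in_convex[OF assms(1,2)] in \<open>auto intro!: continuous_intros\<close>)
  then show ?thesis by (simp add: case_prod_beta)
qed

lemma continuous_on_radial1:
  fixes h :: "real^'n \<Rightarrow> 'b::real_normed_vector"
  assumes "convex U" "x0 \<in> U" "continuous_on U h" "x \<in> U"
  shows "continuous_on {0..1} (\<lambda>t. h (x0 + t *\<^sub>R (x - x0)))"
  by (rule continuous_on_compose2[OF assms(3)])
    (use segment_in_convex[OF assms(1,2,4)] in \<open>auto intro!: continuous_intros\<close>)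

text \<open>Differentiation under the integral sign. The inner derivative of the radial path
  contributes a factor \<open>t\<close>, whence a weight \<open>t ^ m\<close> that grows to
  \<open>t ^ Suc m\<close>.\<close>

lemma radial_integral_has_derivative:
  fixes h :: "real^'n \<Rightarrow> real"
  assumes U: "open U" "convex U" "x0 \<in> U" and h: "smooth_on U h" and x: "x \<in> U"
  shows "((\<lambda>x. integral {0..1} (\<lambda>t. t ^ m * h (x0 + t *\<^sub>R (x - x0)))) has_derivative
     (\<lambda>v. integral {0..1} (\<lambda>t. t ^ Suc m * frechet_derivative h (at (x0 + t *\<^sub>R (x - x0))) v))) (at x)"
proof -
  let ?p = "\<lambda>x t. x0 + t *\<^sub>R (x - x0)"
  let ?f = "\<lambda>x t. t ^ m * h (?p x t)"
  \<comment> \<open>The Leibniz rule wants a continuous family of bounded linear maps, hence the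
    derivative as a \<open>blinfun\<close>.\<close>
  let ?fx = "\<lambda>x t. (t ^ Suc m) *\<^sub>R blinfun_inner_left (grad h (?p x t))"
  have g: "smooth_on U (grad h)" by (rule smooth_on_grad[OF U(1) h])
  have der: "((\<lambda>x. ?f x t) has_derivative blinfun_apply (?fx x t)) (at x within U)"
    if x: "x \<in> U" and t: "t \<in> cbox 0 (1::real)" for x t
  proof -
    have p: "?p x t \<in> U" using segment_in_convex[OF U(2,3) x] t by auto
    have "((\<lambda>x. ?p x t) has_derivative (\<lambda>v. t *\<^sub>R v)) (at x within U)"
      by (auto intro!: derivative_eq_intros)
    from has_derivative_compose[OF this has_derivative_grad[OF h p]]
    have "((\<lambda>x. h (?p x t)) has_derivative (\<lambda>v. grad h (?p x t) \<bullet> (t *\<^sub>R v))) (at x within U)" .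
    from has_derivative_mult_right[OF this, of "t ^ m"]
    show ?thesis
      by (rule has_derivative_eq_rhs) (simp add: fun_eq_iff blinfun.scaleR_left mult_ac inner_commute)
  qed
  have contf: "continuous_on {0..1} (?f x)" if "x \<in> U" for x
    by (intro continuous_intros continuous_on_radial1[OF U(2,3) smooth_on_continuous[OF h] that])
  have int: "?f x integrable_on cbox 0 1" if "x \<in> U" for x
    using integrable_continuous_real[OF contf[OF that]] by simp
  have cont: "continuous_on (U \<times> cbox 0 1) (\<lambda>(x, t). ?fx x t)"
    using continuous_on_radial[OF U(2,3) smooth_on_continuous[OF g]]
    by (auto intro!: continuous_intros bounded_linear.continuous_on[OF bounded_linear_blinfun_inner_left] simp: case_prod_beta)
  have 1: "((\<lambda>x. integral (cbox 0 1) (?f x)) has_derivative integral (cbox 0 1) (?fx x)) (at x within U)"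
    by (rule leibniz_rule[OF der int cont x U(2)])
  have contx: "continuous_on {0..1} (?fx x)"
    using continuous_on_radial1[OF U(2,3) smooth_on_continuous[OF g] x]
    by (intro continuous_intros bounded_linear.continuous_on[OF bounded_linear_blinfun_inner_left])
  have "blinfun_apply (integral (cbox 0 1) (?fx x)) v
      = integral {0..1} (\<lambda>t. t ^ Suc m * frechet_derivative h (at (?p x t)) v)" for v
  proof -
    have "blinfun_apply (integral {0..1} (?fx x)) v = integral {0..1} ((\<lambda>B. blinfun_apply B v) \<circ> ?fx x)"
      by (rule integral_linear[OF integrable_continuous_real[OF contx] blinfun.bounded_linear_left, symmetric])
    also have "\<dots> = integral {0..1} (\<lambda>t. t ^ Suc m * frechet_derivative h (at (?p x t)) v)"
      by (rule integral_cong)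
        (simp add: blinfun.scaleR_left frechet_derivative_grad inner_commute
          smooth_on_differentiable[OF h segment_in_convex[OF U(2,3) x]])
    finally show ?thesis by simp
  qed
  then have "blinfun_apply (integral (cbox 0 1) (?fx x)) =
      (\<lambda>v. integral {0..1} (\<lambda>t. t ^ Suc m * frechet_derivative h (at (?p x t)) v))" by (rule ext)
  with 1 show ?thesis using at_within_open[OF x U(1)] by simp
qed

text \<open>A directional derivative of such an integral is one again, with \<open>m\<close> raised
  and \<open>h\<close> replaced by its derivative; the induction over \<open>k\<close> therefore
  generalises both.\<close>

lemma smooth_on_radial_integral:
  fixes h :: "real^'n \<Rightarrow> real"
  assumes U: "open U" "convex U" "x0 \<in> U" and h: "smooth_on U h"
  shows "smooth_on U (\<lambda>x. integral {0..1} (\<lambda>t. t ^ m * h (x0 + t *\<^sub>R (x - x0))))"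
  unfolding smooth_on_def
proof
  fix k
  show "Ck_on k U (\<lambda>x. integral {0..1} (\<lambda>t. t ^ m * h (x0 + t *\<^sub>R (x - x0))))"
    using h
  proof (induction k arbitrary: h m)
    case 0
    show ?case
      using radial_integral_has_derivative[OF U 0] has_derivative_continuous
        continuous_at_imp_continuous_on by (metis (no_types, lifting) Ck_on.simps(1))
  next
    case (Suc k)
    show ?case
      by (rule Ck_on_SucI[OF U(1) radial_integral_has_derivative[OF U Suc.prems] Suc.IH[OF smooth_on_frechet[OF Suc.prems]]])
  qed
qed

lemma radial_has_vector_derivative:
  fixes h :: "real^'n \<Rightarrow> 'b::real_normed_vector"
  assumes "smooth_on U h" "x0 + t *\<^sub>R (x - x0) \<in> U"
  shows "((\<lambda>t. h (x0 + t *\<^sub>R (x - x0))) has_vector_derivative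
    frechet_derivative h (at (x0 + t *\<^sub>R (x - x0))) (x - x0)) (at t within T)"
proof -
  have "((\<lambda>t. x0 + t *\<^sub>R (x - x0)) has_derivative (\<lambda>s. s *\<^sub>R (x - x0))) (at t within T)"
    by (auto intro!: derivative_eq_intros)
  from has_derivative_compose[OF this smooth_onD[OF assms]]
  show ?thesis
    unfolding has_vector_derivative_def
    by (simp add: linear_cmul[OF smooth_on_linear_frechet[OF assms]])
qed

text \<open>The derivative of \<open>f\<close> along the segment from \<open>x0\<close> to
  \<open>x\<close> is integrated, and the coordinates of \<open>x - x0\<close> are pulled out of the
  integral.\<close>

lemma hadamard:
  fixes f :: "real^'n \<Rightarrow> real"
  assumes U: "open U" "convex U" "x0 \<in> U" and f: "smooth_on U f"
  obtains g :: "'n \<Rightarrow> real^'n \<Rightarrow> real" where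
    "\<And>i. smooth_on U (g i)" "\<And>x. x \<in> U \<Longrightarrow> f x = f x0 + (\<Sum>i\<in>UNIV. (x - x0) $ i * g i x)"
    "\<And>i. g i x0 = frechet_derivative f (at x0) (axis i 1)"
proof
  let ?d = "\<lambda>i y. frechet_derivative f (at y) (axis i 1)"
  \<comment> \<open>The trivial weight \<open>t ^ 0\<close> matches the shape of the radial
    integrals above.\<close>
  let ?g = "\<lambda>i x. integral {0..1} (\<lambda>t. t ^ 0 * ?d i (x0 + t *\<^sub>R (x - x0)))"
  show "smooth_on U (?g i)" for i
    by (rule smooth_on_radial_integral[OF U smooth_on_frechet[OF f]])
  show "?g i x0 = ?d i x0" for i by simp
  fix x assume x: "x \<in> U"
  note seg = segment_in_convex[OF U(2,3) x]
  have "((\<lambda>t. frechet_derivative f (at (x0 + t *\<^sub>R (x - x0))) (x - x0)) has_integral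
      f (x0 + 1 *\<^sub>R (x - x0)) - f (x0 + 0 *\<^sub>R (x - x0))) {0..1}"
    by (rule fundamental_theorem_of_calculus[OF zero_le_one radial_has_vector_derivative[OF f seg]])
  then have "f x - f x0 = integral {0..1} (\<lambda>t. frechet_derivative f (at (x0 + t *\<^sub>R (x - x0))) (x - x0))"
    by (simp add: integral_unique)
  also have "\<dots> = integral {0..1} (\<lambda>t. \<Sum>i\<in>UNIV. (x - x0) $ i * ?d i (x0 + t *\<^sub>R (x - x0)))"
    by (rule integral_cong) (subst linear_axis_sum[OF smooth_on_linear_frechet[OF f seg]], auto)
  also have "\<dots> = (\<Sum>i\<in>UNIV. integral {0..1} (\<lambda>t. (x - x0) $ i * ?d i (x0 + t *\<^sub>R (x - x0))))"
  proof (rule integral_sum)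
    fix i :: 'n
    show "(\<lambda>t. (x - x0) $ i * ?d i (x0 + t *\<^sub>R (x - x0))) integrable_on {0..1}"
      by (intro integrable_continuous_real continuous_intros
          continuous_on_radial1[OF U(2,3) smooth_on_continuous[OF smooth_on_frechet[OF f]] x])
  qed simp
  finally show "f x = f x0 + (\<Sum>i\<in>UNIV. (x - x0) $ i * ?g i x)" by simp
qed

text \<open>Near \<open>x0\<close> Hadamard's lemma writes \<open>f\<close> through products of the
  coordinates of \<open>x - x0\<close> with smooth \<open>g i\<close>. Differentiating twice at
  \<open>x0\<close> multiplies the second derivatives of the \<open>g i\<close> by 0 and leaves an
  expression visibly symmetric in \<open>u\<close> and \<open>v\<close>.\<close>

lemma symmetric_second_derivative:
  fixes f :: "real^'n \<Rightarrow> real"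
  assumes "open S" "smooth_on S f" "x0 \<in> S"
  shows "frechet_derivative (\<lambda>x. frechet_derivative f (at x) v) (at x0) u
       = frechet_derivative (\<lambda>x. frechet_derivative f (at x) u) (at x0) v"
proof -
  obtain e where e: "e > 0" "ball x0 e \<subseteq> S" using assms open_contains_ball by blast
  let ?U = "ball x0 e"
  have U: "open ?U" "convex ?U" "x0 \<in> ?U" using e by auto
  obtain g where g: "\<And>i. smooth_on ?U (g i)"
    and fg: "\<And>x. x \<in> ?U \<Longrightarrow> f x = f x0 + (\<Sum>i\<in>UNIV. (x - x0) $ i * g i x)"
    and "\<And>i. g i x0 = frechet_derivative f (at x0) (axis i 1)"
    by (rule hadamard[OF U smooth_on_subset[OF assms(2) e(2)]]) (rule that)
  let ?D = "\<lambda>i x v. frechet_derivative (g i) (at x) v"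
  have nth: "((\<lambda>x. (x - x0) $ i) has_derivative (\<lambda>v. v $ i)) (at x)" for i x
    by (auto intro!: derivative_eq_intros bounded_linear.has_derivative[OF bounded_linear_vec_nth])
  have d1: "frechet_derivative f (at x) v = (\<Sum>i\<in>UNIV. (x - x0) $ i * ?D i x v + v $ i * g i x)"
    if x: "x \<in> ?U" for x v
  proof -
    have "((\<lambda>x. f x0 + (\<Sum>i\<in>UNIV. (x - x0) $ i * g i x)) has_derivative
        (\<lambda>v. 0 + (\<Sum>i\<in>UNIV. (x - x0) $ i * ?D i x v + v $ i * g i x))) (at x)"
      by (rule has_derivative_add[OF has_derivative_const has_derivative_sum[OF has_derivative_mult[OF nth smooth_onD[OF g x]]]])
    then have "(f has_derivative (\<lambda>v. 0 + (\<Sum>i\<in>UNIV. (x - x0) $ i * ?D i x v + v $ i * g i x))) (at x)"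
      by (rule has_derivative_transform_within_open[OF _ U(1) x]) (use fg in auto)
    from frechet_derivative_eqI[OF this] show ?thesis by simp
  qed
  have d2: "frechet_derivative (\<lambda>x. frechet_derivative f (at x) v) (at x0) u
      = (\<Sum>i\<in>UNIV. u $ i * ?D i x0 v + v $ i * ?D i x0 u)" for u v
  proof -
    have "((\<lambda>x. \<Sum>i\<in>UNIV. (x - x0) $ i * ?D i x v + v $ i * g i x) has_derivative
        (\<lambda>u. \<Sum>i\<in>UNIV. ((x0 - x0) $ i * frechet_derivative (\<lambda>x. ?D i x v) (at x0) u + u $ i * ?D i x0 v)
          + v $ i * ?D i x0 u)) (at x0)"
      by (rule has_derivative_sum[OF has_derivative_add[OF
            has_derivative_mult[OF nth smooth_onD[OF smooth_on_frechet[OF g] U(3)]]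
            has_derivative_mult_right[OF smooth_onD[OF g U(3)]]]])
    then have "((\<lambda>x. frechet_derivative f (at x) v) has_derivative
        (\<lambda>u. \<Sum>i\<in>UNIV. ((x0 - x0) $ i * frechet_derivative (\<lambda>x. ?D i x v) (at x0) u + u $ i * ?D i x0 v)
          + v $ i * ?D i x0 u)) (at x0)"
      by (rule has_derivative_transform_within_open[OF _ U(1,3)]) (use d1 in auto)
    from frechet_derivative_eqI[OF this] show ?thesis by simp
  qed
  show ?thesis unfolding d2 by (simp add: add.commute)
qed

text \<open>The potential is the integral of \<open>b\<close> along radial segments. Its
  differential in direction \<open>v\<close> is the integral of the \<open>t\<close>-derivative of
  \<open>t * (b (x0 + t *\<^sub>R (x - x0)) \<bullet> v)\<close>, which evaluates to
  \<open>b x \<bullet> v\<close>.\<close>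

lemma poincare:
  fixes b :: "real^'n \<Rightarrow> real^'n"
  assumes U: "open U" "convex U" "x0 \<in> U" and b: "smooth_on U b"
    and sym: "\<And>x u v. x \<in> U \<Longrightarrow>
      frechet_derivative b (at x) u \<bullet> v = frechet_derivative b (at x) v \<bullet> u"
  obtains h :: "real^'n \<Rightarrow> real" where "smooth_on U h"
    "\<And>x. x \<in> U \<Longrightarrow> (h has_derivative (\<lambda>v. b x \<bullet> v)) (at x)"
proof -
  let ?p = "\<lambda>x t. x0 + t *\<^sub>R (x - x0)"
  let ?h = "\<lambda>x. \<Sum>i\<in>UNIV. (x - x0) $ i * integral {0..1} (\<lambda>t. t ^ 0 * (b (?p x t) $ i))"
  have bi: "smooth_on U (\<lambda>x. b x $ i)" for i by (rule smooth_on_nth[OF U(1) b])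
  have dbi: "frechet_derivative (\<lambda>x. b x $ i) (at x) v = frechet_derivative b (at x) v $ i"
    if "x \<in> U" for x v i
    using frechet_derivative_eqI[OF bounded_linear.has_derivative[OF bounded_linear_vec_nth smooth_onD[OF b that]]] .
  have der: "(?h has_derivative (\<lambda>v. b x \<bullet> v)) (at x)" if x: "x \<in> U" for x
  proof -
    note seg = segment_in_convex[OF U(2,3) x]
    have nth: "((\<lambda>x. (x - x0) $ i) has_derivative (\<lambda>v. v $ i)) (at x)" for i
      by (auto intro!: derivative_eq_intros bounded_linear.has_derivative[OF bounded_linear_vec_nth])
    let ?R = "\<lambda>v. \<Sum>i\<in>UNIV. (x - x0) $ i * integral {0..1} (\<lambda>t. t ^ Suc 0 * frechet_derivative (\<lambda>x. b x $ i) (at (?p x t)) v)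
        + v $ i * integral {0..1} (\<lambda>t. t ^ 0 * (b (?p x t) $ i))"
    have 1: "(?h has_derivative ?R) (at x)"
      by (rule has_derivative_sum[OF has_derivative_mult[OF nth radial_integral_has_derivative[OF U bi x]]])
    have "?R v = b x \<bullet> v" for v
    proof -
      have c1: "(\<lambda>t. frechet_derivative (\<lambda>x. b x $ i) (at (?p x t)) v) integrable_on {0..1}" 
        "continuous_on {0..1} (\<lambda>t. frechet_derivative (\<lambda>x. b x $ i) (at (?p x t)) v)"
        "continuous_on {0..1} (\<lambda>t. b (?p x t) $ i)" for i
        by (auto intro!: integrable_continuous_real
            continuous_on_radial1[OF U(2,3) smooth_on_continuous[OF smooth_on_frechet[OF bi]] x]
            continuous_on_radial1[OF U(2,3) smooth_on_continuous[OF bi] x])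
      have "?R v = (\<Sum>i\<in>UNIV. integral {0..1} (\<lambda>t. (x - x0) $ i * (t * frechet_derivative (\<lambda>x. b x $ i) (at (?p x t)) v)
          + v $ i * (b (?p x t) $ i)))"
        by (rule sum.cong[OF refl], subst integral_add)
          (auto intro!: integrable_continuous_real continuous_intros c1)
      also have "\<dots> = integral {0..1} (\<lambda>t. \<Sum>i\<in>UNIV. (x - x0) $ i * (t * frechet_derivative (\<lambda>x. b x $ i) (at (?p x t)) v)
          + v $ i * (b (?p x t) $ i))"
        by (rule integral_sum[symmetric]) (auto intro!: integrable_continuous_real continuous_intros c1)
      also have "\<dots> = integral {0..1} (\<lambda>t. t * (frechet_derivative b (at (?p x t)) (x - x0) \<bullet> v) + b (?p x t) \<bullet> v)"
      proof (rule integral_cong)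
        fix t :: real assume t: "t \<in> {0..1}"
        have "(\<Sum>i\<in>UNIV. (x - x0) $ i * (t * frechet_derivative (\<lambda>x. b x $ i) (at (?p x t)) v) + v $ i * (b (?p x t) $ i))
            = t * (frechet_derivative b (at (?p x t)) v \<bullet> (x - x0)) + b (?p x t) \<bullet> v"
          by (simp add: inner_vec_def sum.distrib sum_distrib_left dbi[OF seg[OF t]] mult_ac)
        \<comment> \<open>Closedness enters here: exchanging \<open>v\<close> and
          \<open>x - x0\<close> turns the integrand into a total derivative in
          \<open>t\<close>.\<close>
        then show "(\<Sum>i\<in>UNIV. (x - x0) $ i * (t * frechet_derivative (\<lambda>x. b x $ i) (at (?p x t)) v) + v $ i * (b (?p x t) $ i))
            = t * (frechet_derivative b (at (?p x t)) (x - x0) \<bullet> v) + b (?p x t) \<bullet> v"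
          using sym[OF seg[OF t], of v "x - x0"] by simp
      qed
      also have "\<dots> = b x \<bullet> v"
      proof (rule integral_unique)
        have "((\<lambda>t. t * (frechet_derivative b (at (?p x t)) (x - x0) \<bullet> v) + b (?p x t) \<bullet> v) has_integral
            1 * (b (?p x 1) \<bullet> v) - 0 * (b (?p x 0) \<bullet> v)) {0..1}"
        proof (rule fundamental_theorem_of_calculus)
          fix t :: real assume t: "t \<in> {0..1}"
          have "((\<lambda>t. b (?p x t) \<bullet> v) has_vector_derivative frechet_derivative b (at (?p x t)) (x - x0) \<bullet> v) (at t within {0..1})"
            using bounded_linear.has_vector_derivative[OF bounded_linear_inner_left radial_has_vector_derivative[OF b seg[OF t]]] .
          then have "((\<lambda>t. b (?p x t) \<bullet> v) has_real_derivative frechet_derivative b (at (?p x t)) (x - x0) \<bullet> v) (at t within {0..1})"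
            by (simp add: has_real_derivative_iff_has_vector_derivative)
          from DERIV_mult[OF DERIV_ident this]
          show "((\<lambda>t. t * (b (?p x t) \<bullet> v)) has_vector_derivative t * (frechet_derivative b (at (?p x t)) (x - x0) \<bullet> v) + b (?p x t) \<bullet> v) (at t within {0..1})"
            by (simp add: has_real_derivative_iff_has_vector_derivative add.commute mult.commute)
        qed simp
        then show "((\<lambda>t. t * (frechet_derivative b (at (?p x t)) (x - x0) \<bullet> v) + b (?p x t) \<bullet> v) has_integral b x \<bullet> v) {0..1}"
          by simp
      qed
      finally show ?thesis .
    qed
    with 1 show ?thesis by simp
  qed
  show ?thesis
  proof
    show "smooth_on U ?h"
      by (rule smooth_onI[OF U(1) der]) (auto intro: smooth_on_inner U b)
  qed (rule der)
qed

section \<open>Charts and smooth functions on the manifold\<close>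

locale smooth_manifold =
  fixes A :: "('a::{t2_space,second_countable_topology}, 'n::finite) chart set"
  assumes atlas: "smooth_atlas A"
begin

lemma ex_chart: obtains c where "c \<in> A" "p \<in> fst c"
proof -
  have "p \<in> (\<Union>c\<in>A. fst c)" using atlas by (simp add: smooth_atlas_def)
  then show ?thesis using that by blast
qed

context
  fixes c assumes c: "c \<in> A"
begin

lemma is_chart: "is_chart c" using atlas c by (auto simp: smooth_atlas_def)

lemma open_chart [intro]: "open (fst c)" and open_chart_image [intro]: "open (chart_image c)"
  using is_chart by (auto simp: is_chart_def)

lemma homeo: "homeomorphism (fst c) (chart_image c) (snd c) (chart_inv c)"
  using is_chart by (auto simp: is_chart_def)

lemma chart_inv_in: "x \<in> chart_image c \<Longrightarrow> chart_inv c x \<in> fst c"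
  and snd_chart_inv: "x \<in> chart_image c \<Longrightarrow> snd c (chart_inv c x) = x"
  and snd_in: "p \<in> fst c \<Longrightarrow> snd c p \<in> chart_image c"
  and chart_inv_snd: "p \<in> fst c \<Longrightarrow> chart_inv c (snd c p) = p"
  and cont_chart: "continuous_on (fst c) (snd c)"
  and cont_chart_inv: "continuous_on (chart_image c) (chart_inv c)"
  using homeo by (auto simp: homeomorphism_def)

lemma open_snd_image:
  assumes "open U" "U \<subseteq> fst c"
  shows "open (snd c ` U)"
proof -
  have "snd c ` U = chart_image c \<inter> chart_inv c -` U"
    using assms(2) chart_inv_snd snd_chart_inv snd_in by (auto simp: image_iff) (metis subsetD)+
  moreover have "open (chart_image c \<inter> chart_inv c -` U)"
    by (rule continuous_open_preimage[OF cont_chart_inv open_chart_image assms(1)])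
  ultimately show ?thesis by simp
qed

lemma open_preimage:
  assumes "open V"
  shows "open (fst c \<inter> snd c -` V)"
  by (rule continuous_open_preimage[OF cont_chart open_chart assms])

end

section \<open>Coordinate changes and their Jacobians\<close>

lemma open_overlap: "c \<in> A \<Longrightarrow> d \<in> A \<Longrightarrow> open (snd c ` (fst c \<inter> fst d))"
  by (intro open_snd_image open_Int open_chart) auto

lemma smooth_transition: "c \<in> A \<Longrightarrow> d \<in> A \<Longrightarrow> smooth_on (snd c ` (fst c \<inter> fst d)) (transition c d)"
  using atlas by (auto simp: smooth_atlas_def)

lemma transition_snd: "c \<in> A \<Longrightarrow> p \<in> fst c \<Longrightarrow> transition c d (snd c p) = snd d p"
  by (simp add: transition_def chart_inv_snd)

text \<open>Indexed by the point of the manifold rather than by its coordinates, so that cocycle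
  identities can be written at a single point \<open>p\<close>.\<close>

definition tmap :: "('a, 'n) chart \<Rightarrow> ('a, 'n) chart \<Rightarrow> 'a \<Rightarrow> real^'n \<Rightarrow> real^'n" where
  "tmap c d p = frechet_derivative (transition c d) (at (snd c p))"

lemma transition_has_derivative:
  "c \<in> A \<Longrightarrow> d \<in> A \<Longrightarrow> p \<in> fst c \<Longrightarrow> p \<in> fst d \<Longrightarrow>
    (transition c d has_derivative tmap c d p) (at (snd c p))"
  unfolding tmap_def by (rule smooth_onD[OF smooth_transition]) auto

lemma linear_tmap:
  "c \<in> A \<Longrightarrow> d \<in> A \<Longrightarrow> p \<in> fst c \<Longrightarrow> p \<in> fst d \<Longrightarrow> linear (tmap c d p)"
  using transition_has_derivative has_derivative_linear by blast

lemma tmap_compose: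
  assumes "c \<in> A" "d \<in> A" "e \<in> A" "p \<in> fst c" "p \<in> fst d" "p \<in> fst e"
  shows "tmap d e p (tmap c d p v) = tmap c e p v"
proof -
  let ?W = "snd c ` (fst c \<inter> fst d \<inter> fst e)"
  have W: "open ?W" using assms by (intro open_snd_image open_Int open_chart) auto
  have pW: "snd c p \<in> ?W" using assms by auto
  have "(transition d e has_derivative tmap d e p) (at (transition c d (snd c p)))"
    using transition_has_derivative[of d e p] assms by (simp add: transition_snd)
  from has_derivative_compose[OF transition_has_derivative[OF assms(1,2,4,5)] this]
  have "((\<lambda>x. transition d e (transition c d x)) has_derivative (\<lambda>v. tmap d e p (tmap c d p v))) (at (snd c p))" .
  then have "(transition c e has_derivative (\<lambda>v. tmap d e p (tmap c d p v))) (at (snd c p))"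
    by (rule has_derivative_transform_within_open[OF _ W pW]) (use assms in \<open>auto simp: transition_snd\<close>)
  then show ?thesis unfolding tmap_def[of c e] by (simp add: frechet_derivative_eqI)
qed

lemma tmap_self:
  assumes "c \<in> A" "p \<in> fst c"
  shows "tmap c c p v = v"
proof -
  have "(transition c c has_derivative (\<lambda>v. v)) (at (snd c p))"
    by (rule has_derivative_transform_within_open[OF has_derivative_ident open_chart_image[OF assms(1)] snd_in[OF assms]])
      (use assms in \<open>auto simp: transition_def snd_chart_inv\<close>)
  then show ?thesis unfolding tmap_def by (rule frechet_derivative_eqI)
qed

definition jac :: "('a, 'n) chart \<Rightarrow> ('a, 'n) chart \<Rightarrow> 'a \<Rightarrow> real" where
  "jac c d p = det (matrix (tmap c d p))"

lemma jac_compose: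
  assumes "c \<in> A" "d \<in> A" "e \<in> A" "p \<in> fst c" "p \<in> fst d" "p \<in> fst e"
  shows "jac c e p = jac c d p * jac d e p"
proof -
  have "tmap c e p = tmap d e p \<circ> tmap c d p" using tmap_compose[OF assms] by auto
  then show ?thesis
    using matrix_compose_gen[of "tmap c d p" "tmap d e p"] linear_tmap assms
    by (simp add: jac_def det_mul matrix_compose)
qed

lemma jac_self: "c \<in> A \<Longrightarrow> p \<in> fst c \<Longrightarrow> jac c c p = 1"
  using tmap_self[of c p] by (simp add: jac_def matrix_id_mat_1 flip: id_def) (metis det_I eq_id_iff matrix_id_mat_1)

lemma jac_inverse:
  assumes "c \<in> A" "d \<in> A" "p \<in> fst c" "p \<in> fst d"
  shows "jac c d p * jac d c p = 1"
  using jac_compose[of c d c p] jac_self[of c p] assms by simp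

lemma jac_nonzero:
  assumes "c \<in> A" "d \<in> A" "p \<in> fst c" "p \<in> fst d"
  shows "jac c d p \<noteq> 0"
  using jac_inverse[OF assms] by auto

text \<open>A pointwise predicate on total functions: objects that are meaningful only locally, such
  as components in a chart, can be treated without restricting domains.\<close>

definition smooth_at :: "'a \<Rightarrow> ('a \<Rightarrow> 'b::real_normed_vector) \<Rightarrow> bool" where
  "smooth_at p F \<longleftrightarrow> (\<exists>c\<in>A. p \<in> fst c \<and> (\<exists>V. open V \<and> snd c p \<in> V \<and> V \<subseteq> chart_image c \<and>
     smooth_on V (\<lambda>x. F (chart_inv c x))))"

text \<open>The transition map to the witnessing chart is smooth, so composing with it carries the
  smooth coordinate expression to the chart \<open>d\<close> on the overlap.\<close>

lemma smooth_at_iff: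
  assumes d: "d \<in> A" "p \<in> fst d"
  shows "smooth_at p F \<longleftrightarrow> (\<exists>V. open V \<and> snd d p \<in> V \<and> V \<subseteq> chart_image d \<and>
     smooth_on V (\<lambda>x. F (chart_inv d x)))" (is "_ \<longleftrightarrow> ?R")
proof
  assume "smooth_at p F"
  then obtain c V where c: "c \<in> A" "p \<in> fst c" and V: "open V" "snd c p \<in> V" "V \<subseteq> chart_image c"
    and F: "smooth_on V (\<lambda>x. F (chart_inv c x))" by (auto simp: smooth_at_def)
  let ?U = "fst d \<inter> (fst c \<inter> snd c -` V)"
  let ?W = "snd d ` ?U"
  have W: "open ?W"
    using c d V open_preimage[OF c(1) V(1)] by (intro open_snd_image[OF d(1)] open_Int[OF open_chart[OF d(1)]]) auto
  have "smooth_on ?W (\<lambda>x. F (chart_inv c (transition d c x)))"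
  proof (rule smooth_on_compose[OF W V(1) F])
    show "smooth_on ?W (transition d c)"
      by (rule smooth_on_subset[OF smooth_transition[OF d(1) c(1)]]) auto
    show "transition d c ` ?W \<subseteq> V" using d by (auto simp: transition_snd)
  qed
  then have "smooth_on ?W (\<lambda>x. F (chart_inv d x))"
    by (subst smooth_on_cong[OF W]) (use c d in \<open>auto simp: transition_snd chart_inv_snd\<close>)
  moreover have "snd d p \<in> ?W" "?W \<subseteq> chart_image d" using c d V by (auto simp: snd_in)
  ultimately show ?R using W by blast
qed (use d smooth_at_def in blast)

lemma smooth_on_chart_iff:
  assumes c: "c \<in> A"
  shows "smooth_on (chart_image c) (\<lambda>x. F (chart_inv c x)) \<longleftrightarrow> (\<forall>p\<in>fst c. smooth_at p F)"
proof
  assume "smooth_on (chart_image c) (\<lambda>x. F (chart_inv c x))"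
  then show "\<forall>p\<in>fst c. smooth_at p F"
    unfolding smooth_at_def using c snd_in[OF c] open_chart_image[OF c] by blast
next
  assume *: "\<forall>p\<in>fst c. smooth_at p F"
  show "smooth_on (chart_image c) (\<lambda>x. F (chart_inv c x))"
  proof (rule smooth_on_local)
    fix x assume x: "x \<in> chart_image c"
    then have "smooth_at (chart_inv c x) F" using * chart_inv_in[OF c] by auto
    then show "\<exists>T. open T \<and> x \<in> T \<and> smooth_on T (\<lambda>x. F (chart_inv c x))"
      using smooth_at_iff[OF c chart_inv_in[OF c x]] snd_chart_inv[OF c x] by auto
  qed
qed

lemma smooth_functions_iff: "f \<in> smooth_functions A \<longleftrightarrow> (\<forall>p. smooth_at p f)"
proof -
  have "f \<in> smooth_functions A \<longleftrightarrow> (\<forall>c\<in>A. \<forall>p\<in>fst c. smooth_at p f)"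
    using smooth_on_chart_iff by (auto simp: smooth_functions_def comp_def)
  then show ?thesis using ex_chart by metis
qed

lemma smooth_functionsD: "f \<in> smooth_functions A \<Longrightarrow> smooth_at p f"
  by (simp add: smooth_functions_iff)

text \<open>Smoothness depends on the germ only. This is how functions defined by case distinction,
  \<open>SOME\<close> or \<open>LEAST\<close> are shown to be smooth: near each point they agree
  with a plain formula.\<close>

lemma smooth_at_cong:
  assumes "open U" "p \<in> U" "\<And>q. q \<in> U \<Longrightarrow> F q = G q" "smooth_at p F"
  shows "smooth_at p G"
proof -
  obtain c where c: "c \<in> A" "p \<in> fst c" using ex_chart by blast
  obtain V where V: "open V" "snd c p \<in> V" "V \<subseteq> chart_image c" "smooth_on V (\<lambda>x. F (chart_inv c x))"
    using assms(4) smooth_at_iff[OF c] by auto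
  let ?W = "V \<inter> snd c ` (fst c \<inter> U)"
  have W: "open ?W" using V c assms(1) by (intro open_Int open_snd_image open_chart) auto
  have "smooth_on ?W (\<lambda>x. F (chart_inv c x))" using V(4) smooth_on_subset by blast
  then have "smooth_on ?W (\<lambda>x. G (chart_inv c x))"
    by (subst (asm) smooth_on_cong[OF W]) (use assms(3) in \<open>auto simp: chart_inv_snd[OF c(1)]\<close>)
  then show ?thesis
    unfolding smooth_at_iff[OF c] using W V c assms(2) by blast
qed

lemma smooth_at_bilinear:
  assumes "bounded_bilinear B" "smooth_at p F" "smooth_at p G"
  shows "smooth_at p (\<lambda>q. B (F q) (G q))"
proof -
  obtain c where c: "c \<in> A" "p \<in> fst c" using ex_chart by blast
  obtain V where V: "open V" "snd c p \<in> V" "V \<subseteq> chart_image c" "smooth_on V (\<lambda>x. F (chart_inv c x))"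
    using assms(2) smooth_at_iff[OF c] by auto
  obtain W where W: "open W" "snd c p \<in> W" "smooth_on W (\<lambda>x. G (chart_inv c x))"
    using assms(3) smooth_at_iff[OF c] by auto
  have "smooth_on (V \<inter> W) (\<lambda>x. B (F (chart_inv c x)) (G (chart_inv c x)))"
    using V W by (intro smooth_on_bilinear[OF assms(1)]) (auto intro: smooth_on_subset)
  then show ?thesis unfolding smooth_at_iff[OF c] using V W by (intro exI[of _ "V \<inter> W"]) auto
qed

lemma smooth_at_const [simp]: "smooth_at p (\<lambda>q. a)"
proof -
  obtain c where c: "c \<in> A" "p \<in> fst c" using ex_chart by blast
  show ?thesis
    unfolding smooth_at_iff[OF c] using snd_in[OF c] open_chart_image[OF c(1)]
    by (intro exI[of _ "chart_image c"]) simp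
qed

lemma smooth_at_scaleR: "smooth_at p f \<Longrightarrow> smooth_at p F \<Longrightarrow> smooth_at p (\<lambda>q. f q *\<^sub>R F q)"
  by (rule smooth_at_bilinear[OF bounded_bilinear_scaleR])

lemma smooth_at_inner: "smooth_at p f \<Longrightarrow> smooth_at p F \<Longrightarrow> smooth_at p (\<lambda>q. f q \<bullet> F q)"
  by (rule smooth_at_bilinear[OF bounded_bilinear_inner])

lemma smooth_at_mult:
  fixes f g :: "'a \<Rightarrow> real"
  shows "smooth_at p f \<Longrightarrow> smooth_at p g \<Longrightarrow> smooth_at p (\<lambda>q. f q * g q)"
  by (rule smooth_at_bilinear[OF bounded_bilinear_mult])

lemma smooth_at_add:
  assumes "smooth_at p F" "smooth_at p G"
  shows "smooth_at p (\<lambda>q. F q + G q)"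
proof -
  obtain c where c: "c \<in> A" "p \<in> fst c" using ex_chart by blast
  obtain V where V: "open V" "snd c p \<in> V" "V \<subseteq> chart_image c" "smooth_on V (\<lambda>x. F (chart_inv c x))"
    using assms(1) smooth_at_iff[OF c] by auto
  obtain W where W: "open W" "snd c p \<in> W" "smooth_on W (\<lambda>x. G (chart_inv c x))"
    using assms(2) smooth_at_iff[OF c] by auto
  have "smooth_on (V \<inter> W) (\<lambda>x. F (chart_inv c x) + G (chart_inv c x))"
    using V W by (intro smooth_on_add) (auto intro: smooth_on_subset)
  then show ?thesis unfolding smooth_at_iff[OF c] using V W by (intro exI[of _ "V \<inter> W"]) auto
qed

text \<open>Shrinking to the preimage of \<open>T\<close> keeps \<open>F\<close> away from the
  singularities of \<open>L\<close>, as \<open>ln \<bar>t\<bar>\<close> at 0 requires.\<close>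

lemma smooth_at_map:
  fixes F :: "'a \<Rightarrow> 'b::real_normed_vector" and L :: "'b \<Rightarrow> 'd::real_normed_vector"
  assumes F: "smooth_at p F" and Fp: "F p \<in> T" "open T"
    and L: "\<And>V (g :: real^'n \<Rightarrow> 'b). open V \<Longrightarrow> smooth_on V g \<Longrightarrow> g ` V \<subseteq> T \<Longrightarrow> smooth_on V (\<lambda>x. L (g x))"
  shows "smooth_at p (\<lambda>q. L (F q))"
proof -
  obtain c where c: "c \<in> A" "p \<in> fst c" using ex_chart by blast
  obtain V where V: "open V" "snd c p \<in> V" "V \<subseteq> chart_image c" "smooth_on V (\<lambda>x. F (chart_inv c x))"
    using F smooth_at_iff[OF c] by auto
  let ?W = "V \<inter> (\<lambda>x. F (chart_inv c x)) -` T"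
  have W: "open ?W" by (rule continuous_open_preimage[OF smooth_on_continuous[OF V(4)] V(1) Fp(2)])
  have "smooth_on ?W (\<lambda>x. L (F (chart_inv c x)))"
    by (rule L[OF W smooth_on_subset[OF V(4)]]) auto
  then show ?thesis
    unfolding smooth_at_iff[OF c] using V W Fp chart_inv_snd[OF c] by (intro exI[of _ ?W]) auto
qed

lemma smooth_at_bounded_linear:
  "bounded_linear L \<Longrightarrow> smooth_at p F \<Longrightarrow> smooth_at p (\<lambda>q. L (F q))"
  by (rule smooth_at_map[of p F UNIV L]) (auto intro: smooth_on_bounded_linear)

lemma smooth_at_minus: "smooth_at p F \<Longrightarrow> smooth_at p (\<lambda>q. - F q)"
  by (rule smooth_at_bounded_linear[OF bounded_linear_minus[OF bounded_linear_ident]])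

lemma smooth_at_diff: "smooth_at p F \<Longrightarrow> smooth_at p G \<Longrightarrow> smooth_at p (\<lambda>q. F q - G q)"
  using smooth_at_add[of p F "\<lambda>q. - G q"] smooth_at_minus[of p G] by simp

lemma smooth_at_nth: "smooth_at p F \<Longrightarrow> smooth_at p (\<lambda>q. F q $ i)"
  by (rule smooth_at_bounded_linear[OF bounded_linear_vec_nth])

lemma smooth_at_exp: "smooth_at p f \<Longrightarrow> smooth_at p (\<lambda>q. exp (f q :: real))"
  by (rule smooth_at_map[of p f UNIV exp]) (auto intro: smooth_on_exp)

lemma smooth_at_ln_abs:
  fixes g :: "'a \<Rightarrow> real"
  assumes "smooth_at p g" "g p \<noteq> 0"
  shows "smooth_at p (\<lambda>q. ln \<bar>g q\<bar>)"
  by (rule smooth_at_map[of p g "-{0}" "\<lambda>t. ln \<bar>t\<bar>"]) (use assms in \<open>auto intro!: smooth_on_ln_abs\<close>)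

lemma smooth_at_sum:
  "(\<And>i. i \<in> I \<Longrightarrow> smooth_at p (F i)) \<Longrightarrow> smooth_at p (\<lambda>q. \<Sum>i\<in>I. F i q)"
  by (induction I rule: infinite_finite_induct) (auto intro: smooth_at_add)

lemma smooth_at_prod:
  fixes F :: "'i \<Rightarrow> 'a \<Rightarrow> real"
  shows "(\<And>i. i \<in> I \<Longrightarrow> smooth_at p (F i)) \<Longrightarrow> smooth_at p (\<lambda>q. \<Prod>i\<in>I. F i q)"
  by (induction I rule: infinite_finite_induct) (auto intro: smooth_at_mult)

lemma smooth_at_det:
  fixes M :: "'a \<Rightarrow> real^'m^'m"
  assumes "\<And>i j. smooth_at p (\<lambda>q. M q $ i $ j)"
  shows "smooth_at p (\<lambda>q. det (M q))"
  unfolding det_def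
  by (intro smooth_at_sum smooth_at_mult smooth_at_prod assms smooth_at_const)

lemma smooth_at_vec:
  fixes F :: "'a \<Rightarrow> real^'m"
  assumes "\<And>i. smooth_at p (\<lambda>q. F q $ i)"
  shows "smooth_at p F"
proof -
  have "smooth_at p (\<lambda>q. \<Sum>i\<in>UNIV. (F q $ i) *\<^sub>R axis i (1::real))"
    by (intro smooth_at_sum smooth_at_scaleR assms smooth_at_const)
  moreover have "(\<lambda>q. \<Sum>i\<in>UNIV. (F q $ i) *\<^sub>R axis i (1::real)) = F"
    using basis_expansion[of "F _"] by (simp add: scalar_mult_eq_scaleR)
  ultimately show ?thesis by simp
qed

lemma smooth_at_coord:
  assumes c: "c \<in> A" "p \<in> fst c" and g: "open V" "snd c p \<in> V" "smooth_on V g"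
  shows "smooth_at p (\<lambda>q. g (snd c q))"
proof -
  let ?W = "V \<inter> chart_image c"
  have W: "open ?W" using g c open_chart_image by blast
  have "smooth_on ?W g" using g(3) smooth_on_subset by blast
  then have "smooth_on ?W (\<lambda>x. g (snd c (chart_inv c x)))"
    by (subst smooth_on_cong[OF W]) (use snd_chart_inv[OF c(1)] in auto)
  then show ?thesis unfolding smooth_at_iff[OF c] using W g(2) snd_in[OF c] by blast
qed

lemma smooth_at_snd: "c \<in> A \<Longrightarrow> p \<in> fst c \<Longrightarrow> smooth_at p (snd c)"
  using smooth_at_coord[of c p UNIV "\<lambda>x. x"] smooth_on_id by auto

text \<open>A coordinate derivative read as a function on the manifold again, so that it can be
  differentiated once more. Values may be vectors, since components of vector fields are
  differentiated too.\<close>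

definition chart_deriv :: "('a, 'n) chart \<Rightarrow> ('a \<Rightarrow> 'b::real_normed_vector) \<Rightarrow> 'a \<Rightarrow> real^'n \<Rightarrow> 'b" where
  "chart_deriv c F p v = frechet_derivative (\<lambda>x. F (chart_inv c x)) (at (snd c p)) v"

lemma chart_deriv_has_derivative:
  assumes "c \<in> A" "p \<in> fst c" "smooth_at p F"
  shows "((\<lambda>x. F (chart_inv c x)) has_derivative chart_deriv c F p) (at (snd c p))"
proof -
  obtain V where "snd c p \<in> V" "smooth_on V (\<lambda>x. F (chart_inv c x))"
    using assms(3) smooth_at_iff[OF assms(1,2)] by auto
  then show ?thesis unfolding chart_deriv_def by (rule smooth_onD[rotated])
qed

lemma chart_deriv_eqI: "((\<lambda>x. F (chart_inv c x)) has_derivative D) (at (snd c p)) \<Longrightarrow> chart_deriv c F p v = D v"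
  unfolding chart_deriv_def by (rule frechet_derivative_eqI)

lemma linear_chart_deriv: "c \<in> A \<Longrightarrow> p \<in> fst c \<Longrightarrow> smooth_at p F \<Longrightarrow> linear (chart_deriv c F p)"
  using chart_deriv_has_derivative has_derivative_linear by blast

lemma chart_deriv_cong:
  assumes "c \<in> A" "p \<in> fst c" "open U" "p \<in> U" "\<And>q. q \<in> U \<Longrightarrow> F q = G q"
  shows "chart_deriv c F p = chart_deriv c G p"
  unfolding chart_deriv_def
  by (rule ext, rule fun_cong[OF frechet_derivative_cong_open[of "snd c ` (fst c \<inter> U)"]])
    (use assms in \<open>auto simp: chart_inv_snd intro!: open_snd_image open_Int open_chart\<close>)

lemma chart_deriv_const: "chart_deriv c (\<lambda>q. a) p v = 0"
  by (simp add: chart_deriv_def frechet_derivative_const)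

lemma chart_deriv_bilinear:
  assumes "bounded_bilinear B" "c \<in> A" "p \<in> fst c" "smooth_at p F" "smooth_at p G"
  shows "chart_deriv c (\<lambda>q. B (F q) (G q)) p v = B (F p) (chart_deriv c G p v) + B (chart_deriv c F p v) (G p)"
  using chart_deriv_eqI[OF bounded_bilinear.FDERIV[OF assms(1) chart_deriv_has_derivative[OF assms(2,3,4)] chart_deriv_has_derivative[OF assms(2,3,5)]]]
  by (simp add: chart_inv_snd assms)

lemmas chart_deriv_mult = chart_deriv_bilinear[OF bounded_bilinear_mult]
  and chart_deriv_scaleR = chart_deriv_bilinear[OF bounded_bilinear_scaleR]
  and chart_deriv_inner = chart_deriv_bilinear[OF bounded_bilinear_inner]

lemma chart_deriv_add:
  assumes "c \<in> A" "p \<in> fst c" "smooth_at p F" "smooth_at p G"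
  shows "chart_deriv c (\<lambda>q. F q + G q) p v = chart_deriv c F p v + chart_deriv c G p v"
  by (rule chart_deriv_eqI[OF has_derivative_add[OF chart_deriv_has_derivative[OF assms(1,2,3)] chart_deriv_has_derivative[OF assms(1,2,4)]]])

lemma chart_deriv_diff:
  assumes "c \<in> A" "p \<in> fst c" "smooth_at p F" "smooth_at p G"
  shows "chart_deriv c (\<lambda>q. F q - G q) p v = chart_deriv c F p v - chart_deriv c G p v"
  by (rule chart_deriv_eqI[OF has_derivative_diff[OF chart_deriv_has_derivative[OF assms(1,2,3)] chart_deriv_has_derivative[OF assms(1,2,4)]]])

lemma chart_deriv_sum:
  assumes "c \<in> A" "p \<in> fst c" "\<And>i. i \<in> I \<Longrightarrow> smooth_at p (F i)"
  shows "chart_deriv c (\<lambda>q. \<Sum>i\<in>I. F i q) p v = (\<Sum>i\<in>I. chart_deriv c (F i) p v)"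
  by (rule chart_deriv_eqI[OF has_derivative_sum[OF chart_deriv_has_derivative[OF assms(1,2,3)]]])

lemma chart_deriv_bounded_linear:
  assumes "bounded_linear L" "c \<in> A" "p \<in> fst c" "smooth_at p F"
  shows "chart_deriv c (\<lambda>q. L (F q)) p v = L (chart_deriv c F p v)"
  by (rule chart_deriv_eqI[OF bounded_linear.has_derivative[OF assms(1) chart_deriv_has_derivative[OF assms(2,3,4)]]])

lemmas chart_deriv_nth = chart_deriv_bounded_linear[OF bounded_linear_vec_nth]

lemma chart_deriv_snd:
  assumes "c \<in> A" "p \<in> fst c"
  shows "chart_deriv c (snd c) p v = v"
proof (rule chart_deriv_eqI)
  show "((\<lambda>x. snd c (chart_inv c x)) has_derivative (\<lambda>v. v)) (at (snd c p))"
    by (rule has_derivative_transform_within_open[OF has_derivative_ident open_chart_image[OF assms(1)] snd_in[OF assms]])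
      (use snd_chart_inv[OF assms(1)] in auto)
qed

lemma chart_deriv_axis_sum:
  assumes "c \<in> A" "p \<in> fst c" "smooth_at p F"
  shows "chart_deriv c F p v = (\<Sum>i\<in>UNIV. (v $ i) *\<^sub>R chart_deriv c F p (axis i 1))"
  by (rule linear_axis_sum[OF linear_chart_deriv[OF assms]])

lemma chart_deriv_change:
  assumes c: "c \<in> A" "p \<in> fst c" and d: "d \<in> A" "p \<in> fst d" and F: "smooth_at p F"
  shows "chart_deriv c F p v = chart_deriv d F p (tmap c d p v)"
proof (rule chart_deriv_eqI)
  have "((\<lambda>x. F (chart_inv d x)) has_derivative chart_deriv d F p) (at (transition c d (snd c p)))"
    using chart_deriv_has_derivative[OF d F] transition_snd[OF c] by simp
  from has_derivative_compose[OF transition_has_derivative[OF c(1) d(1) c(2) d(2)] this]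
  show "((\<lambda>x. F (chart_inv c x)) has_derivative (\<lambda>v. chart_deriv d F p (tmap c d p v))) (at (snd c p))"
    by (rule has_derivative_transform_within_open[OF _ open_overlap[OF c(1) d(1)]])
      (use c d in \<open>auto simp: transition_snd chart_inv_snd\<close>)
qed

lemma smooth_at_open:
  assumes "smooth_at p F"
  obtains U where "open U" "p \<in> U" "\<And>q. q \<in> U \<Longrightarrow> smooth_at q F"
proof -
  obtain c where c: "c \<in> A" "p \<in> fst c" using ex_chart by blast
  obtain V where V: "open V" "snd c p \<in> V" "V \<subseteq> chart_image c" "smooth_on V (\<lambda>x. F (chart_inv c x))"
    using assms smooth_at_iff[OF c] by auto
  show ?thesis
  proof
    show "open (fst c \<inter> snd c -` V)" by (rule open_preimage[OF c(1) V(1)])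
    show "p \<in> fst c \<inter> snd c -` V" using c V by auto
    show "smooth_at q F" if "q \<in> fst c \<inter> snd c -` V" for q
      using that V c(1) by (auto simp: smooth_at_def)
  qed
qed

lemma smooth_at_chart_deriv:
  assumes c: "c \<in> A" "p \<in> fst c" and F: "smooth_at p F"
  shows "smooth_at p (\<lambda>q. chart_deriv c F q v)"
proof -
  obtain V where V: "open V" "snd c p \<in> V" "V \<subseteq> chart_image c" "smooth_on V (\<lambda>x. F (chart_inv c x))"
    using F smooth_at_iff[OF c] by auto
  have "smooth_on V (\<lambda>x. chart_deriv c F (chart_inv c x) v)"
    unfolding chart_deriv_def
    by (subst smooth_on_cong[OF V(1), where g="\<lambda>x. frechet_derivative (\<lambda>x. F (chart_inv c x)) (at x) v"])
      (use V snd_chart_inv[OF c(1)] smooth_on_frechet in auto)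
  then show ?thesis unfolding smooth_at_iff[OF c] using V by blast
qed

lemma smooth_at_chart_deriv_apply:
  assumes "c \<in> A" "p \<in> fst c" "smooth_at p F" "smooth_at p w"
  shows "smooth_at p (\<lambda>q. chart_deriv c F q (w q))"
proof -
  obtain U where U: "open U" "p \<in> U" "\<And>q. q \<in> U \<Longrightarrow> smooth_at q F" by (rule smooth_at_open[OF assms(3)]) (rule that)
  have "smooth_at p (\<lambda>q. \<Sum>i\<in>UNIV. (w q $ i) *\<^sub>R chart_deriv c F q (axis i 1))"
    by (intro smooth_at_sum smooth_at_scaleR smooth_at_nth smooth_at_chart_deriv assms)
  then show ?thesis
    by (rule smooth_at_cong[of "U \<inter> fst c", rotated 3])
      (use U assms in \<open>auto simp: chart_deriv_axis_sum[symmetric] intro!: open_Int open_chart\<close>)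
qed

lemma chart_deriv_chart_deriv_symmetric:
  fixes f :: "'a \<Rightarrow> real"
  assumes c: "c \<in> A" "p \<in> fst c" and F: "smooth_at p f"
  shows "chart_deriv c (\<lambda>q. chart_deriv c f q v) p u = chart_deriv c (\<lambda>q. chart_deriv c f q u) p v"
proof -
  obtain V where V: "open V" "snd c p \<in> V" "V \<subseteq> chart_image c" "smooth_on V (\<lambda>x. f (chart_inv c x))"
    using F smooth_at_iff[OF c] by auto
  have "chart_deriv c (\<lambda>q. chart_deriv c f q v) p u
      = frechet_derivative (\<lambda>x. frechet_derivative (\<lambda>x. f (chart_inv c x)) (at x) v) (at (snd c p)) u" for u v
    unfolding chart_deriv_def
    by (rule fun_cong[OF frechet_derivative_cong_open[OF V(1,2)]]) (use V snd_chart_inv[OF c(1)] in auto)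
  then show ?thesis using symmetric_second_derivative[OF V(1,4,2)] by simp
qed

text \<open>The product rule for a derivative in a moving direction. The first term freezes the
  direction at \<open>w p\<close> and is thus a genuine second derivative of \<open>F\<close>, to
  which symmetry applies.\<close>

lemma chart_deriv_apply:
  assumes c: "c \<in> A" "p \<in> fst c" and F: "smooth_at p F" and w: "smooth_at p w"
  shows "chart_deriv c (\<lambda>q. chart_deriv c F q (w q)) p u = chart_deriv c (\<lambda>q. chart_deriv c F q (w p)) p u + chart_deriv c F p (chart_deriv c w p u)"
proof -
  obtain U where U: "open U" "p \<in> U" "\<And>q. q \<in> U \<Longrightarrow> smooth_at q F" by (rule smooth_at_open[OF F]) (rule that)
  have eq: "chart_deriv c F q v = (\<Sum>i\<in>UNIV. (v $ i) *\<^sub>R chart_deriv c F q (axis i 1))" if "q \<in> U \<inter> fst c" for q v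
    using chart_deriv_axis_sum[of c q F v] c that U by auto
  have oU: "open (U \<inter> fst c)" "p \<in> U \<inter> fst c" using U c by (auto intro: open_Int open_chart)
  have "chart_deriv c (\<lambda>q. chart_deriv c F q (w q)) p u = chart_deriv c (\<lambda>q. \<Sum>i\<in>UNIV. (w q $ i) *\<^sub>R chart_deriv c F q (axis i 1)) p u"
    by (rule fun_cong[OF chart_deriv_cong[OF c oU]]) (rule eq)
  also have "\<dots> = (\<Sum>i\<in>UNIV. (w p $ i) *\<^sub>R chart_deriv c (\<lambda>q. chart_deriv c F q (axis i 1)) p u + (chart_deriv c w p u $ i) *\<^sub>R chart_deriv c F p (axis i 1))"
    using c F w by (simp add: chart_deriv_sum chart_deriv_scaleR chart_deriv_nth smooth_at_scaleR smooth_at_nth smooth_at_chart_deriv)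
  also have "\<dots> = (\<Sum>i\<in>UNIV. (w p $ i) *\<^sub>R chart_deriv c (\<lambda>q. chart_deriv c F q (axis i 1)) p u) + chart_deriv c F p (chart_deriv c w p u)"
    using oU(2) by (simp add: sum.distrib eq[of p])
  also have "(\<Sum>i\<in>UNIV. (w p $ i) *\<^sub>R chart_deriv c (\<lambda>q. chart_deriv c F q (axis i 1)) p u)
      = chart_deriv c (\<lambda>q. \<Sum>i\<in>UNIV. (w p $ i) *\<^sub>R chart_deriv c F q (axis i 1)) p u"
    using c F by (simp add: chart_deriv_sum chart_deriv_scaleR chart_deriv_const smooth_at_scaleR smooth_at_chart_deriv)
  also have "\<dots> = chart_deriv c (\<lambda>q. chart_deriv c F q (w p)) p u"
    by (rule fun_cong[OF chart_deriv_cong[OF c oU]]) (rule eq[symmetric])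
  finally show ?thesis .
qed

lemma smooth_at_tmap:
  assumes "c \<in> A" "d \<in> A" "p \<in> fst c" "p \<in> fst d"
  shows "smooth_at p (\<lambda>q. tmap c d q v)"
  unfolding tmap_def
  by (rule smooth_at_coord[OF assms(1,3) open_overlap[OF assms(1,2)] _ smooth_on_frechet[OF smooth_transition[OF assms(1,2)]]])
    (use assms in auto)

lemma smooth_at_tmap_apply:
  assumes "c \<in> A" "d \<in> A" "p \<in> fst c" "p \<in> fst d" "smooth_at p w"
  shows "smooth_at p (\<lambda>q. tmap c d q (w q))"
proof -
  have "smooth_at p (\<lambda>q. \<Sum>i\<in>UNIV. (w q $ i) *\<^sub>R tmap c d q (axis i 1))"
    by (intro smooth_at_sum smooth_at_scaleR smooth_at_nth smooth_at_tmap assms)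
  then show ?thesis
    by (rule smooth_at_cong[of "fst c \<inter> fst d", rotated 3])
      (use assms in \<open>auto simp: linear_axis_sum[OF linear_tmap, symmetric] intro!: open_Int open_chart\<close>)
qed

lemma smooth_at_jac:
  assumes "c \<in> A" "d \<in> A" "p \<in> fst c" "p \<in> fst d"
  shows "smooth_at p (jac c d)"
  unfolding jac_def
  by (rule smooth_at_det) (auto simp: matrix_def intro!: smooth_at_nth smooth_at_tmap assms)

text \<open>A Euclidean bump transported by a chart. Its extension by 0 is smooth because
  \<open>K\<close>, the image of a closed ball, is compact and hence closed in the whole Hausdorff
  space, not merely in the chart domain.\<close>

lemma manifold_bump:
  assumes "open U" "p \<in> U"
  obtains \<phi> N K where "\<phi> \<in> smooth_functions A" "open N" "p \<in> N" "N \<subseteq> U" "\<And>q. q \<in> N \<Longrightarrow> \<phi> q = 1"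
    "closed K" "K \<subseteq> U" "\<And>q. q \<notin> K \<Longrightarrow> \<phi> q = 0" "\<And>q. 0 \<le> \<phi> q \<and> \<phi> q \<le> (1::real)"
proof -
  obtain c where c: "c \<in> A" "p \<in> fst c" using ex_chart by blast
  have "open (snd c ` (fst c \<inter> U))" using assms c by (intro open_snd_image open_Int open_chart) auto
  moreover have "snd c p \<in> snd c ` (fst c \<inter> U)" using assms c by auto
  ultimately obtain R where R: "R > 0" "cball (snd c p) R \<subseteq> snd c ` (fst c \<inter> U)"
    using open_contains_cball by blast
  have sub: "cball (snd c p) R \<subseteq> chart_image c" using R(2) by (auto simp: chart_image_def)
  have R2: "0 < R / 2" "R / 2 < R" using R by auto
  obtain \<beta> :: "real^'n \<Rightarrow> real" where "smooth_on UNIV \<beta> \<and> (\<forall>x. 0 \<le> \<beta> x \<and> \<beta> x \<le> 1) \<and>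
      (\<forall>x\<in>cball (snd c p) (R/2). \<beta> x = 1) \<and> (\<forall>x. x \<notin> ball (snd c p) R \<longrightarrow> \<beta> x = 0)"
    using bump_exists[OF R2, of "snd c p"] by (elim exE)
  then have \<beta>: "smooth_on UNIV \<beta>" "\<And>x. 0 \<le> \<beta> x \<and> \<beta> x \<le> 1"
    "\<And>x. x \<in> cball (snd c p) (R/2) \<Longrightarrow> \<beta> x = 1" "\<And>x. x \<notin> ball (snd c p) R \<Longrightarrow> \<beta> x = 0"
    by auto
  let ?K = "chart_inv c ` cball (snd c p) R"
  let ?N = "fst c \<inter> snd c -` ball (snd c p) (R/2)"
  let ?\<phi> = "\<lambda>q. if q \<in> fst c then \<beta> (snd c q) else 0"
  have KU: "?K \<subseteq> U" "?K \<subseteq> fst c" using R(2) chart_inv_snd[OF c(1)] by fastforce+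
  have "compact ?K"
    by (rule compact_continuous_image[OF continuous_on_subset[OF cont_chart_inv[OF c(1)] sub] compact_cball])
  then have clK: "closed ?K" by (rule compact_imp_closed)
  have zero: "?\<phi> q = 0" if "q \<notin> ?K" for q
  proof (cases "q \<in> fst c")
    case True
    then have "snd c q \<notin> cball (snd c p) R" using that chart_inv_snd[OF c(1) True] by (metis imageI)
    then show ?thesis using \<beta>(4) by auto
  qed auto
  have sm: "smooth_at q ?\<phi>" for q
  proof (cases "q \<in> fst c")
    case True
    show ?thesis
      by (rule smooth_at_cong[OF open_chart[OF c(1)] True _ smooth_at_coord[OF c(1) True open_UNIV UNIV_I \<beta>(1)]]) auto
  next
    case False
    then have q: "q \<in> - ?K" using KU by auto
    have "open (- ?K)" using clK by auto
    then show ?thesis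
      by (rule smooth_at_cong[OF _ q _ smooth_at_const[of q 0]]) (rule zero[symmetric], simp)
  qed
  show ?thesis
  proof
    show "?\<phi> \<in> smooth_functions A" using sm smooth_functions_iff by blast
    show "open ?N" by (rule open_preimage[OF c(1) open_ball])
    show "p \<in> ?N" using c R by auto
    show "?N \<subseteq> U"
    proof
      fix q assume "q \<in> ?N"
      then have "q \<in> fst c" "snd c q \<in> cball (snd c p) R" using R(1) by auto
      then have "chart_inv c (snd c q) \<in> ?K" by blast
      then show "q \<in> U" using KU chart_inv_snd[OF c(1) \<open>q \<in> fst c\<close>] by auto
    qed
    show "?\<phi> q = 1" if "q \<in> ?N" for q using that \<beta>(3) by auto
    show "closed ?K" "?K \<subseteq> U" by fact+
    show "?\<phi> q = 0" if "q \<notin> ?K" for q using zero that .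
    show "0 \<le> ?\<phi> q \<and> ?\<phi> q \<le> 1" for q using \<beta>(2) by auto
  qed
qed

text \<open>A point outside \<open>U\<close> lies in the open complement of \<open>K\<close>, where
  the product is identically 0 whatever \<open>F\<close> does.\<close>

lemma smooth_extend:
  assumes "\<phi> \<in> smooth_functions A" "closed K" "K \<subseteq> U" "\<And>q. q \<notin> K \<Longrightarrow> \<phi> q = 0"
    and "\<And>q. q \<in> U \<Longrightarrow> smooth_at q F"
  shows "smooth_at p (\<lambda>q. \<phi> q *\<^sub>R F q)"
proof (cases "p \<in> U")
  case True
  then show ?thesis using assms by (intro smooth_at_scaleR smooth_functionsD) auto
next
  case False
  then have "p \<in> - K" "open (- K)" using assms by auto
  from smooth_at_cong[OF this(2,1) _ smooth_at_const[of p 0], of "\<lambda>q. \<phi> q *\<^sub>R F q"] assms(4)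
  show ?thesis by auto
qed

lemma smooth_functions_extend:
  assumes "\<phi> \<in> smooth_functions A" "closed K" "K \<subseteq> U" "\<And>q. q \<notin> K \<Longrightarrow> \<phi> q = 0"
    and "\<And>q. q \<in> U \<Longrightarrow> smooth_at q f"
  shows "(\<lambda>q. \<phi> q * f q) \<in> smooth_functions A"
  using smooth_extend[OF assms] by (simp add: smooth_functions_iff)

end

section \<open>Tangent vectors and vector fields\<close>

context smooth_manifold
begin

lemma smooth_functions_const [simp]: "(\<lambda>q. r) \<in> smooth_functions A"
  by (simp add: smooth_functions_iff)

lemma smooth_functions_mult:
  "f \<in> smooth_functions A \<Longrightarrow> g \<in> smooth_functions A \<Longrightarrow> (\<lambda>q. f q * g q) \<in> smooth_functions A"
  by (simp add: smooth_functions_iff smooth_at_mult)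

lemma smooth_functions_add:
  "f \<in> smooth_functions A \<Longrightarrow> g \<in> smooth_functions A \<Longrightarrow> (\<lambda>q. f q + g q) \<in> smooth_functions A"
  by (simp add: smooth_functions_iff smooth_at_add)

lemma smooth_functions_sum:
  "(\<And>i. i \<in> I \<Longrightarrow> F i \<in> smooth_functions A) \<Longrightarrow> (\<lambda>q. \<Sum>i\<in>I. F i q) \<in> smooth_functions A"
  by (simp add: smooth_functions_iff smooth_at_sum)

lemma tangent_nonsmooth: "v \<in> tangent_space A p \<Longrightarrow> f \<notin> smooth_functions A \<Longrightarrow> v f = 0"
  and tangent_add: "v \<in> tangent_space A p \<Longrightarrow> f \<in> smooth_functions A \<Longrightarrow> g \<in> smooth_functions A \<Longrightarrow>
    v (\<lambda>q. f q + g q) = v f + v g"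
  and tangent_mult: "v \<in> tangent_space A p \<Longrightarrow> f \<in> smooth_functions A \<Longrightarrow> g \<in> smooth_functions A \<Longrightarrow>
    v (\<lambda>q. f q * g q) = f p * v g + g p * v f"
  and tangent_scale: "v \<in> tangent_space A p \<Longrightarrow> f \<in> smooth_functions A \<Longrightarrow> v (\<lambda>q. r * f q) = r * v f"
  by (auto simp: tangent_space_def)

lemma tangent_const:
  assumes v: "v \<in> tangent_space A p"
  shows "v (\<lambda>q. r) = 0"
proof -
  \<comment> \<open>Leibniz at \<open>1 = 1 * 1\<close> gives twice the same value, which must
    therefore be 0.\<close>
  have "v (\<lambda>q. 1 * 1) = 1 * v (\<lambda>q. 1) + 1 * v (\<lambda>q. 1)"
    by (rule tangent_mult[OF v]) simp_all
  then have 1: "v (\<lambda>q. 1) = 0" by simp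
  have "v (\<lambda>q. r * 1) = r * v (\<lambda>q. 1)"
    by (rule tangent_scale[OF v]) simp
  with 1 show ?thesis by simp
qed

lemma tangent_sum:
  assumes v: "v \<in> tangent_space A p" and F: "\<And>i. i \<in> I \<Longrightarrow> F i \<in> smooth_functions A"
  shows "v (\<lambda>q. \<Sum>i\<in>I. F i q) = (\<Sum>i\<in>I. v (F i))"
  using F
proof (induction I rule: infinite_finite_induct)
  case (insert i I)
  have "v (\<lambda>q. F i q + (\<Sum>i\<in>I. F i q)) = v (F i) + v (\<lambda>q. \<Sum>i\<in>I. F i q)"
    by (rule tangent_add[OF v]) (auto intro!: insert.prems smooth_functions_sum)
  with insert show ?case by simp
qed (auto simp: tangent_const[OF v])

lemma coord_vector_apply: "f \<in> smooth_functions A \<Longrightarrow> coord_vector A c p \<xi> f = chart_deriv c f p \<xi>"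
  by (simp add: coord_vector_def chart_deriv_def comp_def)

lemma coord_vector_nonsmooth: "f \<notin> smooth_functions A \<Longrightarrow> coord_vector A c p \<xi> f = 0"
  by (simp add: coord_vector_def)

lemma coord_vector_change:
  assumes "c \<in> A" "p \<in> fst c" "d \<in> A" "p \<in> fst d"
  shows "coord_vector A c p \<xi> = coord_vector A d p (tmap c d p \<xi>)"
proof
  fix f show "coord_vector A c p \<xi> f = coord_vector A d p (tmap c d p \<xi>) f"
    using chart_deriv_change[OF assms smooth_functionsD]
    by (cases "f \<in> smooth_functions A") (auto simp: coord_vector_apply coord_vector_nonsmooth)
qed

lemma coord_vector_tangent:
  assumes c: "c \<in> A" "p \<in> fst c"
  shows "coord_vector A c p \<xi> \<in> tangent_space A p"
proof -
  have "coord_vector A c p \<xi> (\<lambda>q. f q * g q) = f p * coord_vector A c p \<xi> g + g p * coord_vector A c p \<xi> f"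
    if "f \<in> smooth_functions A" "g \<in> smooth_functions A" for f g
    using that c by (simp add: coord_vector_apply smooth_functions_mult chart_deriv_mult smooth_functionsD)
  moreover have "coord_vector A c p \<xi> (\<lambda>q. f q + g q) = coord_vector A c p \<xi> f + coord_vector A c p \<xi> g"
    if "f \<in> smooth_functions A" "g \<in> smooth_functions A" for f g
    using that c by (simp add: coord_vector_apply smooth_functions_add chart_deriv_add smooth_functionsD)
  moreover have "coord_vector A c p \<xi> (\<lambda>q. r * f q) = r * coord_vector A c p \<xi> f"
    if "f \<in> smooth_functions A" for f r
    using that c by (simp add: coord_vector_apply smooth_functions_mult chart_deriv_mult smooth_functionsD chart_deriv_const)
  ultimately show ?thesis
    by (simp add: tangent_space_def coord_vector_nonsmooth)
qed

lemma coord_vector_add: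
  assumes c: "c \<in> A" "p \<in> fst c"
  shows "coord_vector A c p (\<xi> + \<eta>) = (\<lambda>h. coord_vector A c p \<xi> h + coord_vector A c p \<eta> h)"
proof
  fix f show "coord_vector A c p (\<xi> + \<eta>) f = coord_vector A c p \<xi> f + coord_vector A c p \<eta> f"
    using linear_add[OF linear_chart_deriv[OF c smooth_functionsD]]
    by (cases "f \<in> smooth_functions A") (auto simp: coord_vector_apply coord_vector_nonsmooth)
qed

lemma coord_vector_scale:
  assumes c: "c \<in> A" "p \<in> fst c"
  shows "coord_vector A c p (r *\<^sub>R \<xi>) = (\<lambda>h. r * coord_vector A c p \<xi> h)"
proof
  fix f show "coord_vector A c p (r *\<^sub>R \<xi>) f = r * coord_vector A c p \<xi> f"
    using linear_cmul[OF linear_chart_deriv[OF c smooth_functionsD]]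
    by (cases "f \<in> smooth_functions A") (auto simp: coord_vector_apply coord_vector_nonsmooth)
qed

lemma coord_vector_zero:
  assumes c: "c \<in> A" "p \<in> fst c"
  shows "coord_vector A c p 0 = (\<lambda>h. 0)"
  using coord_vector_scale[OF c, of 0 0] by simp

lemma local_fun:
  fixes f :: "'a \<Rightarrow> real"
  assumes "open U" "p \<in> U" "\<And>q. q \<in> U \<Longrightarrow> smooth_at q f"
  shows "\<exists>g\<in>smooth_functions A. \<exists>N. open N \<and> p \<in> N \<and> N \<subseteq> U \<and> (\<forall>q\<in>N. g q = f q)"
proof -
  obtain \<phi> N K where *: "\<phi> \<in> smooth_functions A" "open N" "p \<in> N" "N \<subseteq> U" "\<And>q. q \<in> N \<Longrightarrow> \<phi> q = 1"
    "closed K" "K \<subseteq> U" "\<And>q. q \<notin> K \<Longrightarrow> \<phi> q = 0"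
    by (rule manifold_bump[OF assms(1,2)]) blast
  have "(\<lambda>q. \<phi> q * f q) \<in> smooth_functions A"
    by (rule smooth_functions_extend[OF *(1,6,7,8) assms(3)])
  with * show ?thesis by (intro bexI[of _ "\<lambda>q. \<phi> q * f q"] exI[of _ N]) auto
qed

text \<open>The coordinate functions recover the components; as tangent vectors accept only global
  smooth functions, they are first cut off near \<open>p\<close>.\<close>

lemma coord_vector_inj:
  assumes c: "c \<in> A" "p \<in> fst c" and eq: "coord_vector A c p \<xi> = coord_vector A c p \<eta>"
  shows "\<xi> = \<eta>"
proof -
  have "\<xi> $ i = \<eta> $ i" for i
  proof -
    have "\<exists>g\<in>smooth_functions A. \<exists>N. open N \<and> p \<in> N \<and> N \<subseteq> fst c \<and> (\<forall>q\<in>N. g q = snd c q $ i)"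
      by (rule local_fun[OF open_chart[OF c(1)] c(2)]) (rule smooth_at_nth[OF smooth_at_snd[OF c(1)]])
    then obtain g N where g: "g \<in> smooth_functions A" "open N" "p \<in> N" "\<And>q. q \<in> N \<Longrightarrow> g q = snd c q $ i" by blast
    have "chart_deriv c g p \<xi> = \<xi> $ i" for \<xi>
      using chart_deriv_cong[OF c g(2,3,4)] chart_deriv_nth[OF c smooth_at_snd[OF c]] chart_deriv_snd[OF c] by simp
    then show ?thesis using fun_cong[OF eq, of g] coord_vector_apply[OF g(1)] by metis
  qed
  then show ?thesis by (simp add: vec_eq_iff)
qed

text \<open>Hadamard's lemma writes \<open>\<phi>\<^sup>2 (f - f p)\<close> as a sum of products of smooth functions, the first
  factor of each vanishing at \<open>p\<close>.\<close>

lemma tangent_range: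
  assumes c: "c \<in> A" "p \<in> fst c" and v: "v \<in> tangent_space A p"
  shows "\<exists>\<xi>. v = coord_vector A c p \<xi>"
proof -
  let ?x0 = "snd c p"
  obtain e where e: "e > 0" "ball ?x0 e \<subseteq> chart_image c"
    using open_chart_image[OF c(1)] snd_in[OF c] open_contains_ball by blast
  let ?B = "ball ?x0 e"
  have B: "open ?B" "convex ?B" "?x0 \<in> ?B" using e by auto
  let ?U = "fst c \<inter> snd c -` ?B"
  have U: "open ?U" "p \<in> ?U" using open_preimage[OF c(1) B(1)] c e by auto
  obtain \<phi> N K where bump: "\<phi> \<in> smooth_functions A" "open N" "p \<in> N" "N \<subseteq> ?U" "\<And>q. q \<in> N \<Longrightarrow> \<phi> q = 1"
    "closed K" "K \<subseteq> ?U" "\<And>q. q \<notin> K \<Longrightarrow> \<phi> q = 0"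
    by (rule manifold_bump[OF U]) blast
  let ?y = "\<lambda>i q. \<phi> q * (snd c q - ?x0) $ i"
  have y: "?y i \<in> smooth_functions A" for i
    by (rule smooth_functions_extend[OF bump(1,6,7,8)])
      (use c(1) in \<open>auto intro!: smooth_at_nth smooth_at_diff smooth_at_snd\<close>)
  have "v f = chart_deriv c f p (\<chi> i. v (?y i))" if f: "f \<in> smooth_functions A" for f
  proof -
    have fs: "smooth_on ?B (\<lambda>x. f (chart_inv c x))"
      using f c(1) by (intro smooth_on_subset[OF _ e(2)]) (auto simp: smooth_functions_def comp_def)
    obtain g where g: "\<And>i. smooth_on ?B (g i)"
      and fg: "\<And>x. x \<in> ?B \<Longrightarrow> f (chart_inv c x) = f (chart_inv c ?x0) + (\<Sum>i\<in>UNIV. (x - ?x0) $ i * g i x)"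
      and g0: "\<And>i. g i ?x0 = frechet_derivative (\<lambda>x. f (chart_inv c x)) (at ?x0) (axis i 1)"
      by (rule hadamard[OF B fs]) (rule that)
    let ?g = "\<lambda>i q. \<phi> q * g i (snd c q)"
    have gs: "?g i \<in> smooth_functions A" for i
      by (rule smooth_functions_extend[OF bump(1,6,7,8)], assumption,
          rule smooth_at_coord[OF c(1) _ B(1) _ g], auto)
    have eq: "(\<lambda>q. (\<phi> q * \<phi> q) * (f q + (- f p))) = (\<lambda>q. \<Sum>i\<in>UNIV. ?y i q * ?g i q)"
    proof
      fix q show "(\<phi> q * \<phi> q) * (f q + (- f p)) = (\<Sum>i\<in>UNIV. ?y i q * ?g i q)"
      proof (cases "q \<in> ?U")
        case True
        then have "f q + (- f p) = (\<Sum>i\<in>UNIV. (snd c q - ?x0) $ i * g i (snd c q))"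
          using fg[of "snd c q"] chart_inv_snd[OF c(1)] c(2) by simp
        then show ?thesis by (simp add: sum_distrib_left algebra_simps)
      next
        case False
        then have "\<phi> q = 0" using bump by blast
        then show ?thesis by simp
      qed
    qed
    have p1: "\<phi> p = 1" using bump by simp
    \<comment> \<open>In the Leibniz rule the second factor vanishes at \<open>p\<close> and the
      first has value 1 there, so the cut-off drops out.\<close>
    have "v (\<lambda>q. (\<phi> q * \<phi> q) * (f q + (- f p))) = v (\<lambda>q. f q + (- f p))"
      using tangent_mult[OF v smooth_functions_mult[OF bump(1) bump(1)] smooth_functions_add[OF f smooth_functions_const[of "- f p"]]] p1
      by simp
    also have "\<dots> = v f"
      using tangent_add[OF v f smooth_functions_const[of "- f p"]] tangent_const[OF v] by simp
    finally have "v f = v (\<lambda>q. \<Sum>i\<in>UNIV. ?y i q * ?g i q)" using eq by simp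
    also have "\<dots> = (\<Sum>i\<in>UNIV. v (\<lambda>q. ?y i q * ?g i q))"
      by (rule tangent_sum[OF v]) (rule smooth_functions_mult[OF y gs])
    also have "\<dots> = (\<Sum>i\<in>UNIV. g i ?x0 * v (?y i))"
      using tangent_mult[OF v y gs] p1 by simp
    also have "\<dots> = (\<Sum>i\<in>UNIV. v (?y i) *\<^sub>R chart_deriv c f p (axis i 1))"
      by (simp add: g0 chart_deriv_def mult.commute)
    also have "\<dots> = chart_deriv c f p (\<chi> i. v (?y i))"
      using chart_deriv_axis_sum[OF c smooth_functionsD[OF f], of "\<chi> i. v (?y i)"] by simp
    finally show ?thesis .
  qed
  then have "v = coord_vector A c p (\<chi> i. v (?y i))"
    using tangent_nonsmooth[OF v] by (auto simp: fun_eq_iff coord_vector_def chart_deriv_def comp_def)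
  then show ?thesis by blast
qed

text \<open>Unique by \<open>coord_vector_inj\<close>, and existing for tangent vectors by
  \<open>tangent_range\<close>; other arguments give an unspecified value.\<close>

definition pcomp :: "('a, 'n) chart \<Rightarrow> 'a \<Rightarrow> 'a tangent_vector \<Rightarrow> real^'n" where
  "pcomp c p v = (THE \<xi>. v = coord_vector A c p \<xi>)"

lemma pcomp_coord [simp]:
  assumes "c \<in> A" "p \<in> fst c"
  shows "pcomp c p (coord_vector A c p \<xi>) = \<xi>"
  unfolding pcomp_def using coord_vector_inj[OF assms] by blast

lemma coord_pcomp:
  assumes "c \<in> A" "p \<in> fst c" "v \<in> tangent_space A p"
  shows "coord_vector A c p (pcomp c p v) = v"
  using tangent_range[OF assms] pcomp_coord[OF assms(1,2)] by metis

lemma tangent_apply: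
  assumes "c \<in> A" "p \<in> fst c" "v \<in> tangent_space A p" "f \<in> smooth_functions A"
  shows "v f = chart_deriv c f p (pcomp c p v)"
  using coord_pcomp[OF assms(1-3)] coord_vector_apply[OF assms(4)] by metis

lemma pcomp_eqI:
  assumes "c \<in> A" "p \<in> fst c" "v = coord_vector A c p \<xi>"
  shows "pcomp c p v = \<xi>"
  using assms by simp

lemma pcomp_change:
  assumes "c \<in> A" "p \<in> fst c" "d \<in> A" "p \<in> fst d" "v \<in> tangent_space A p"
  shows "pcomp d p v = tmap c d p (pcomp c p v)"
  using coord_vector_change[OF assms(1-4), of "pcomp c p v"] coord_pcomp[OF assms(1,2,5)] assms
  by (intro pcomp_eqI) auto

lemma tangent_space_add:
  assumes "u \<in> tangent_space A p" "v \<in> tangent_space A p"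
  shows "(\<lambda>h. u h + v h) \<in> tangent_space A p"
proof -
  obtain c where c: "c \<in> A" "p \<in> fst c" using ex_chart by blast
  show ?thesis
    using coord_vector_tangent[OF c, of "pcomp c p u + pcomp c p v"] coord_pcomp[OF c assms(1)] coord_pcomp[OF c assms(2)]
    by (simp add: coord_vector_add[OF c])
qed

lemma tangent_space_scale:
  assumes "u \<in> tangent_space A p"
  shows "(\<lambda>h. r * u h) \<in> tangent_space A p"
proof -
  obtain c where c: "c \<in> A" "p \<in> fst c" using ex_chart by blast
  show ?thesis
    using coord_vector_tangent[OF c, of "r *\<^sub>R pcomp c p u"] coord_pcomp[OF c assms]
    by (simp add: coord_vector_scale[OF c])
qed

lemma pcomp_add:
  assumes c: "c \<in> A" "p \<in> fst c" and uv: "u \<in> tangent_space A p" "v \<in> tangent_space A p"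
  shows "pcomp c p (\<lambda>h. u h + v h) = pcomp c p u + pcomp c p v"
  by (rule pcomp_eqI[OF c]) (simp add: coord_vector_add[OF c] coord_pcomp[OF c] uv)

lemma pcomp_scale:
  assumes c: "c \<in> A" "p \<in> fst c" and u: "u \<in> tangent_space A p"
  shows "pcomp c p (\<lambda>h. r * u h) = r *\<^sub>R pcomp c p u"
  by (rule pcomp_eqI[OF c]) (simp add: coord_vector_scale[OF c] coord_pcomp[OF c] u)

definition vcomp :: "('a, 'n) chart \<Rightarrow> 'a vector_field \<Rightarrow> 'a \<Rightarrow> real^'n" where
  "vcomp c X p = pcomp c p (X p)"

text \<open>Smooth components in one chart around each point are enough: in any other chart the
  components arise by applying \<open>tmap\<close>, which depends smoothly on the point.\<close>

lemma vector_fieldsI: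
  assumes "\<And>p. \<exists>c\<in>A. p \<in> fst c \<and> (\<exists>\<xi> U. open U \<and> p \<in> U \<and> smooth_at p \<xi> \<and>
      (\<forall>q\<in>U \<inter> fst c. X q = coord_vector A c q (\<xi> q)))"
  shows "X \<in> vector_fields A"
proof -
  have tan: "X p \<in> tangent_space A p" for p
    using assms[of p] coord_vector_tangent by (metis IntI)
  have "\<exists>\<xi>. smooth_on (chart_image d) \<xi> \<and> (\<forall>p\<in>fst d. X p = coord_vector A d p (\<xi> (snd d p)))" if d: "d \<in> A" for d
  proof -
    let ?\<xi> = "\<lambda>x. vcomp d X (chart_inv d x)"
    have "smooth_at p (vcomp d X)" if p: "p \<in> fst d" for p
    proof -
      obtain c \<xi> U where c: "c \<in> A" "p \<in> fst c" and U: "open U" "p \<in> U" and \<xi>: "smooth_at p \<xi>"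
        and X: "\<And>q. q \<in> U \<inter> fst c \<Longrightarrow> X q = coord_vector A c q (\<xi> q)" using assms[of p] by blast
      have op: "open (U \<inter> fst c \<inter> fst d)" "p \<in> U \<inter> fst c \<inter> fst d"
        using U c p d by (auto intro!: open_Int open_chart)
      show ?thesis
      proof (rule smooth_at_cong[OF op _ smooth_at_tmap_apply[OF c(1) d c(2) p \<xi>]])
        fix q assume q: "q \<in> U \<inter> fst c \<inter> fst d"
        show "tmap c d q (\<xi> q) = vcomp d X q"
          unfolding vcomp_def
          by (rule sym, rule pcomp_eqI) (use q X[of q] coord_vector_change[of c q d] c d in auto)
      qed
    qed
    then have "smooth_on (chart_image d) ?\<xi>" using smooth_on_chart_iff[OF d] by blast
    moreover have "X p = coord_vector A d p (?\<xi> (snd d p))" if "p \<in> fst d" for p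
      using coord_pcomp[OF d that tan] chart_inv_snd[OF d that] by (simp add: vcomp_def)
    ultimately show ?thesis by blast
  qed
  with tan show ?thesis by (simp add: vector_fields_def)
qed

lemma vf_tangent: "X \<in> vector_fields A \<Longrightarrow> X p \<in> tangent_space A p"
  by (simp add: vector_fields_def)

lemma vf_coord: "X \<in> vector_fields A \<Longrightarrow> c \<in> A \<Longrightarrow> p \<in> fst c \<Longrightarrow> X p = coord_vector A c p (vcomp c X p)"
  by (simp add: vcomp_def coord_pcomp vf_tangent)

lemma smooth_at_vcomp:
  assumes X: "X \<in> vector_fields A" and c: "c \<in> A" "p \<in> fst c"
  shows "smooth_at p (vcomp c X)"
proof -
  obtain \<xi> :: "real^'n \<Rightarrow> real^'n" where \<xi>: "smooth_on (chart_image c) \<xi>"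
    and Xc: "\<And>p. p \<in> fst c \<Longrightarrow> X p = coord_vector A c p (\<xi> (snd c p))"
    using X c(1) by (auto simp: vector_fields_def)
  have "smooth_at p (\<lambda>q. \<xi> (snd c q))"
    by (rule smooth_at_coord[OF c open_chart_image[OF c(1)] snd_in[OF c] \<xi>])
  then show ?thesis
    by (rule smooth_at_cong[OF open_chart[OF c(1)] c(2), rotated]) (simp add: vcomp_def Xc pcomp_coord[OF c(1)])
qed

lemma vf_apply_chart_deriv:
  assumes "X \<in> vector_fields A" "f \<in> smooth_functions A" "c \<in> A" "p \<in> fst c"
  shows "vf_apply X f p = chart_deriv c f p (vcomp c X p)"
  unfolding vf_apply_def vcomp_def by (rule tangent_apply[OF assms(3,4) vf_tangent[OF assms(1)] assms(2)])

lemma vf_apply_smooth: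
  assumes X: "X \<in> vector_fields A" and f: "f \<in> smooth_functions A"
  shows "vf_apply X f \<in> smooth_functions A"
  unfolding smooth_functions_iff
proof
  fix p
  obtain c where c: "c \<in> A" "p \<in> fst c" using ex_chart by blast
  have "smooth_at p (\<lambda>q. chart_deriv c f q (vcomp c X q))"
    by (intro smooth_at_chart_deriv_apply c smooth_functionsD f smooth_at_vcomp X)
  then show "smooth_at p (vf_apply X f)"
    by (rule smooth_at_cong[OF open_chart[OF c(1)] c(2), rotated]) (simp add: vf_apply_chart_deriv[OF X f c(1)])
qed

lemma vf_add_in:
  assumes X: "X \<in> vector_fields A" and Y: "Y \<in> vector_fields A"
  shows "vf_add X Y \<in> vector_fields A"
    and "\<lbrakk>c \<in> A; p \<in> fst c\<rbrakk> \<Longrightarrow> vcomp c (vf_add X Y) p = vcomp c X p + vcomp c Y p"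
proof -
  have eq: "vf_add X Y q = coord_vector A c q (vcomp c X q + vcomp c Y q)" if "c \<in> A" "q \<in> fst c" for c q
    using vf_coord[OF X that] vf_coord[OF Y that] coord_vector_add[OF that] by (simp add: vf_add_def)
  then show "\<lbrakk>c \<in> A; p \<in> fst c\<rbrakk> \<Longrightarrow> vcomp c (vf_add X Y) p = vcomp c X p + vcomp c Y p"
    by (simp add: vcomp_def)
  show "vf_add X Y \<in> vector_fields A"
  proof (rule vector_fieldsI)
    fix p
    obtain c where c: "c \<in> A" "p \<in> fst c" using ex_chart by blast
    have "smooth_at p (\<lambda>q. vcomp c X q + vcomp c Y q)"
      by (intro smooth_at_add smooth_at_vcomp X Y c)
    then show "\<exists>c\<in>A. p \<in> fst c \<and> (\<exists>\<xi> U. open U \<and> p \<in> U \<and> smooth_at p \<xi> \<and>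
      (\<forall>q\<in>U \<inter> fst c. vf_add X Y q = coord_vector A c q (\<xi> q)))"
      using c eq[OF c(1)] open_UNIV by blast
  qed
qed

lemma vf_scale_in:
  assumes f: "f \<in> smooth_functions A" and X: "X \<in> vector_fields A"
  shows "vf_scale f X \<in> vector_fields A"
    and "\<lbrakk>c \<in> A; p \<in> fst c\<rbrakk> \<Longrightarrow> vcomp c (vf_scale f X) p = f p *\<^sub>R vcomp c X p"
proof -
  have eq: "vf_scale f X q = coord_vector A c q (f q *\<^sub>R vcomp c X q)" if "c \<in> A" "q \<in> fst c" for c q
    using vf_coord[OF X that] coord_vector_scale[OF that] by (simp add: vf_scale_def)
  then show "\<lbrakk>c \<in> A; p \<in> fst c\<rbrakk> \<Longrightarrow> vcomp c (vf_scale f X) p = f p *\<^sub>R vcomp c X p"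
    by (simp add: vcomp_def)
  show "vf_scale f X \<in> vector_fields A"
  proof (rule vector_fieldsI)
    fix p
    obtain c where c: "c \<in> A" "p \<in> fst c" using ex_chart by blast
    have "smooth_at p (\<lambda>q. f q *\<^sub>R vcomp c X q)"
      by (intro smooth_at_scaleR smooth_functionsD f smooth_at_vcomp X c)
    then show "\<exists>c\<in>A. p \<in> fst c \<and> (\<exists>\<xi> U. open U \<and> p \<in> U \<and> smooth_at p \<xi> \<and>
      (\<forall>q\<in>U \<inter> fst c. vf_scale f X q = coord_vector A c q (\<xi> q)))"
      using c eq[OF c(1)] open_UNIV by blast
  qed
qed

lemma lie_bracket_coord:
  assumes X: "X \<in> vector_fields A" and Y: "Y \<in> vector_fields A" and c: "c \<in> A" "p \<in> fst c"
  shows "lie_bracket X Y p = coord_vector A c p (chart_deriv c (vcomp c Y) p (vcomp c X p) - chart_deriv c (vcomp c X) p (vcomp c Y p))"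
proof
  fix h
  show "lie_bracket X Y p h = coord_vector A c p (chart_deriv c (vcomp c Y) p (vcomp c X p) - chart_deriv c (vcomp c X) p (vcomp c Y p)) h"
  proof (cases "h \<in> smooth_functions A")
    case True
    note h = smooth_functionsD[OF True]
    have XY: "X p (vf_apply Y h) = chart_deriv c (\<lambda>q. chart_deriv c h q (vcomp c Y p)) p (vcomp c X p) + chart_deriv c h p (chart_deriv c (vcomp c Y) p (vcomp c X p))"
      if X: "X \<in> vector_fields A" and Y: "Y \<in> vector_fields A" for X Y
    proof -
      have "X p (vf_apply Y h) = chart_deriv c (vf_apply Y h) p (vcomp c X p)"
        using vf_apply_chart_deriv[OF X vf_apply_smooth[OF Y True] c] by (simp add: vf_apply_def)
      also have "\<dots> = chart_deriv c (\<lambda>q. chart_deriv c h q (vcomp c Y q)) p (vcomp c X p)"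
        by (rule fun_cong[OF chart_deriv_cong[OF c open_chart[OF c(1)] c(2)]]) (rule vf_apply_chart_deriv[OF Y True c(1)])
      finally show ?thesis using chart_deriv_apply[OF c h smooth_at_vcomp[OF Y c]] by simp
    qed
    show ?thesis
      unfolding lie_bracket_def XY[OF X Y] XY[OF Y X] coord_vector_apply[OF True]
        linear_diff[OF linear_chart_deriv[OF c h]] chart_deriv_chart_deriv_symmetric[OF c h, of "vcomp c Y p" "vcomp c X p"]
      by simp
  next
    case False
    \<comment> \<open>Tangent vectors are 0 on a non-smooth \<open>h\<close>, so the inner field
      produces the zero function, which the outer derivation kills.\<close>
    have "vf_apply Z h = (\<lambda>q. 0)" if "Z \<in> vector_fields A" for Z
      using tangent_nonsmooth[OF vf_tangent[OF that] False] by (simp add: vf_apply_def)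
    then show ?thesis
      using X Y tangent_const[OF vf_tangent[OF X], of p 0] tangent_const[OF vf_tangent[OF Y], of p 0]
      by (simp add: lie_bracket_def coord_vector_nonsmooth[OF False])
  qed
qed

lemma lie_bracket_in:
  assumes X: "X \<in> vector_fields A" and Y: "Y \<in> vector_fields A"
  shows "lie_bracket X Y \<in> vector_fields A"
proof (rule vector_fieldsI)
  fix p
  obtain c where c: "c \<in> A" "p \<in> fst c" using ex_chart by blast
  have "smooth_at p (\<lambda>q. chart_deriv c (vcomp c Y) q (vcomp c X q) - chart_deriv c (vcomp c X) q (vcomp c Y q))"
    by (intro smooth_at_diff smooth_at_chart_deriv_apply smooth_at_vcomp X Y c)
  then show "\<exists>c\<in>A. p \<in> fst c \<and> (\<exists>\<xi> U. open U \<and> p \<in> U \<and> smooth_at p \<xi> \<and>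
    (\<forall>q\<in>U \<inter> fst c. lie_bracket X Y q = coord_vector A c q (\<xi> q)))"
    using c lie_bracket_coord[OF X Y c(1)] open_UNIV by blast
qed

lemma vcomp_bracket:
  assumes "X \<in> vector_fields A" "Y \<in> vector_fields A" "c \<in> A" "p \<in> fst c"
  shows "vcomp c (lie_bracket X Y) p = chart_deriv c (vcomp c Y) p (vcomp c X p) - chart_deriv c (vcomp c X) p (vcomp c Y p)"
  unfolding vcomp_def[of c "lie_bracket X Y"] by (rule pcomp_eqI[OF assms(3,4) lie_bracket_coord[OF assms]])

text \<open>Since vector fields are global, prescribed local components are realised by a cut-off
  field, and only on a smaller neighbourhood \<open>N\<close>.\<close>

lemma local_vf:
  assumes c: "c \<in> A" and U: "open U" "p \<in> U" "U \<subseteq> fst c" and \<xi>: "\<And>q. q \<in> U \<Longrightarrow> smooth_at q \<xi>"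
  shows "\<exists>X\<in>vector_fields A. \<exists>N. open N \<and> p \<in> N \<and> N \<subseteq> U \<and> (\<forall>q\<in>N. vcomp c X q = \<xi> q)"
proof -
  obtain \<phi> N K where *: "\<phi> \<in> smooth_functions A" "open N" "p \<in> N" "N \<subseteq> U" "\<And>q. q \<in> N \<Longrightarrow> \<phi> q = 1"
    "closed K" "K \<subseteq> U" "\<And>q. q \<notin> K \<Longrightarrow> \<phi> q = 0"
    by (rule manifold_bump[OF U(1,2)]) blast
  define X where "X q = (if q \<in> U then coord_vector A c q (\<phi> q *\<^sub>R \<xi> q) else (\<lambda>h. 0))" for q
  have "X \<in> vector_fields A"
  proof (rule vector_fieldsI)
    fix q
    show "\<exists>c\<in>A. q \<in> fst c \<and> (\<exists>\<xi> V. open V \<and> q \<in> V \<and> smooth_at q \<xi> \<and>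
      (\<forall>q\<in>V \<inter> fst c. X q = coord_vector A c q (\<xi> q)))"
    proof (cases "q \<in> U")
      case True
      have "smooth_at q (\<lambda>q. \<phi> q *\<^sub>R \<xi> q)"
        by (intro smooth_at_scaleR smooth_functionsD *(1) \<xi> True)
      then show ?thesis using c U True by (intro bexI[of _ c] conjI exI[of _ "\<lambda>q. \<phi> q *\<^sub>R \<xi> q"] exI[of _ U]) (auto simp: X_def)
    next
      case False
      obtain d where d: "d \<in> A" "q \<in> fst d" using ex_chart by blast
      have "X r = coord_vector A d r 0" if "r \<in> - K \<inter> fst d" for r
        using that *(8)[of r] coord_vector_zero[OF d(1), of r] coord_vector_zero[OF c, of r] U by (auto simp: X_def)
      moreover have "open (-K)" "q \<in> - K" using * False by auto
      ultimately show ?thesis using d by (intro bexI[of _ d] conjI exI[of _ "\<lambda>q. 0"] exI[of _ "-K"]) auto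
    qed
  qed
  moreover have "vcomp c X q = \<xi> q" if "q \<in> N" for q
    using that * U c pcomp_coord[OF c, of q] by (auto simp: vcomp_def X_def subset_iff)
  ultimately show ?thesis using * by blast
qed

end

section \<open>Top forms and their divergence\<close>

text \<open>The difference \<open>G\<close> of the two sides is again multilinear and alternating
  and vanishes on the standard basis; what remains is that such a \<open>G\<close> is zero
  everywhere.\<close>

lemma alternating_det:
  fixes F :: "('n::finite \<Rightarrow> real^'n) \<Rightarrow> real"
  assumes add: "\<And>\<eta> i u w. F (\<eta>(i := u + w)) = F (\<eta>(i := u)) + F (\<eta>(i := w))"
    and scale: "\<And>\<eta> i u r. F (\<eta>(i := r *\<^sub>R u)) = r * F (\<eta>(i := u))"
    and alt: "\<And>\<eta> i j. i \<noteq> j \<Longrightarrow> \<eta> i = \<eta> j \<Longrightarrow> F \<eta> = 0"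
  shows "F \<eta> = det (\<chi> k. \<eta> k) * F (\<lambda>k. axis k 1)"
proof -
  define G where "G \<eta> = F \<eta> - det (\<chi> k. \<eta> k) * F (\<lambda>k. axis k 1)" for \<eta>
  have upd: "(\<chi> k. (\<eta>(i := u)) k) = (\<chi> k. if k = i then u else \<eta> k)" for \<eta> i and u :: "real^'n"
    by (simp add: vec_eq_iff)
  have Gadd: "G (\<eta>(i := u + w)) = G (\<eta>(i := u)) + G (\<eta>(i := w))" for \<eta> i u w
    unfolding G_def upd det_row_add add by (simp add: algebra_simps)
  have Gscale: "G (\<eta>(i := r *\<^sub>R u)) = r * G (\<eta>(i := u))" for \<eta> i u r
    unfolding G_def upd scale using det_row_mul[of i r "\<lambda>_. u" \<eta>, unfolded scalar_mult_eq_scaleR]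
    by (simp add: algebra_simps)
  have Galt: "G \<eta> = 0" if "i \<noteq> j" "\<eta> i = \<eta> j" for \<eta> i j
  proof -
    have "det (\<chi> k. \<eta> k) = 0"
      by (rule det_identical_rows[OF that(1)]) (use that in \<open>simp add: row_def\<close>)
    then show ?thesis by (simp add: G_def alt[OF that])
  qed
  have G1: "G (\<lambda>k. axis k 1) = 0"
  proof -
    have "(\<chi> k. axis k 1) = (mat 1 :: real^'n^'n)" by (simp add: vec_eq_iff mat_def axis_def)
    then show ?thesis by (simp add: G_def)
  qed
  have Gswap: "G (\<eta>(i := b, j := a)) = - G (\<eta>(i := a, j := b))" if "i \<noteq> j" for \<eta> i j a b
  proof -
    have "0 = G (\<eta>(i := a + b, j := a + b))" using Galt[OF that] that by simp
    also have "\<dots> = G (\<eta>(i := a + b, j := a)) + G (\<eta>(i := a + b, j := b))" by (rule Gadd)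
    also have "\<dots> = G (\<eta>(j := a, i := a + b)) + G (\<eta>(j := b, i := a + b))"
      using that by (simp add: fun_upd_twist)
    also have "\<dots> = G (\<eta>(j := a, i := a)) + G (\<eta>(j := a, i := b)) + (G (\<eta>(j := b, i := a)) + G (\<eta>(j := b, i := b)))"
      by (simp only: Gadd)
    also have "\<dots> = G (\<eta>(i := b, j := a)) + G (\<eta>(i := a, j := b))"
      using Galt[OF that, of "\<eta>(j := a, i := a)"] Galt[OF that, of "\<eta>(j := b, i := b)"] that
      by (simp add: fun_upd_twist)
    finally show ?thesis by simp
  qed
  \<comment> \<open>Swapping two arguments changes the sign, so vanishing on the basis spreads to
    all its permutations through transpositions.\<close>
  have Gperm: "G (\<lambda>k. axis (\<sigma> k) 1) = 0" if "\<sigma> permutes (UNIV :: 'n set)" for \<sigma>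
    using finite_class.finite_UNIV that
  proof (induction rule: permutes_rev_induct)
    case id
    then show ?case using G1 by simp
  next
    case (swap a b p)
    have "G (\<lambda>k. axis ((p \<circ> Transposition.transpose a b) k) 1) = - G (\<lambda>k. axis (p k) 1)" if "a \<noteq> b"
    proof -
      have "(\<lambda>k. axis (p k) (1::real)) = (\<lambda>k. axis (p k) 1)(a := axis (p a) 1, b := axis (p b) 1)" by auto
      moreover have "(\<lambda>k. axis ((p \<circ> Transposition.transpose a b) k) (1::real)) = (\<lambda>k. axis (p k) 1)(a := axis (p b) 1, b := axis (p a) 1)"
        using that by (auto simp: Transposition.transpose_def)
      ultimately show ?thesis using Gswap[OF that] by metis
    qed
    then show ?case using swap by (cases "a = b") auto
  qed
  have Gbasis: "G (\<lambda>k. axis (\<sigma> k) 1) = 0" for \<sigma> :: "'n \<Rightarrow> 'n"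
  proof (cases "inj \<sigma>")
    case True
    then have "bij \<sigma>" using finite_UNIV_inj_surj[of \<sigma>] by (simp add: bij_def)
    then have "\<sigma> permutes UNIV" by (intro bij_imp_permutes) auto
    then show ?thesis by (rule Gperm)
  next
    case False
    then obtain i j where "i \<noteq> j" "\<sigma> i = \<sigma> j" by (auto simp: inj_def)
    then show ?thesis using Galt[of i j "\<lambda>k. axis (\<sigma> k) 1"] by simp
  qed
  \<comment> \<open>\<open>S\<close> is the set of slots that may still hold arbitrary vectors; each
    step of the induction expands one of them in the basis.\<close>
  have "G \<eta> = 0" if "finite S" "\<And>k. k \<notin> S \<Longrightarrow> \<exists>j. \<eta> k = axis j 1" for S \<eta>
    using that
  proof (induction S arbitrary: \<eta> rule: finite_induct)
    case empty
    then obtain \<sigma> where "\<And>k. \<eta> k = axis (\<sigma> k) 1" by (metis empty_iff)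
    then have "\<eta> = (\<lambda>k. axis (\<sigma> k) 1)" by auto
    then show ?case using Gbasis by simp
  next
    case (insert i S)
    have "linear (\<lambda>u. G (\<eta>(i := u)))" by (rule linearI) (simp_all add: Gadd Gscale)
    from linear_axis_sum[OF this, of "\<eta> i"]
    have "G \<eta> = (\<Sum>j\<in>UNIV. (\<eta> i $ j) *\<^sub>R G (\<eta>(i := axis j 1)))" by simp
    also have "\<dots> = 0"
      by (rule sum.neutral) (use insert in \<open>auto intro!: insert.IH\<close>)
    finally show ?case .
  qed
  from this[of UNIV \<eta>] show ?thesis by (simp add: G_def)
qed

lemma det_rows_map:
  fixes T :: "real^'n \<Rightarrow> real^'n"
  assumes "linear T"
  shows "det (\<chi> k. T (\<eta> k)) = det (matrix T) * det (\<chi> k. \<eta> k)"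
proof -
  have "(\<chi> k. T (\<eta> k)) = (\<chi> k. \<eta> k) ** transpose (matrix T)"
    by (simp add: vec_eq_iff matrix_matrix_mult_def transpose_def matrix_def) (subst linear_axis_sum[OF assms], simp)
  then show ?thesis by (simp add: det_mul)
qed

section \<open>Differentiating determinants row by row\<close>

lemma has_derivative_det_rows:
  fixes \<eta> :: "'n::finite \<Rightarrow> 'b::real_normed_vector \<Rightarrow> real^'n"
  assumes "\<And>k. (\<eta> k has_derivative D k) (at x)"
  shows "((\<lambda>x. det (\<chi> k. \<eta> k x)) has_derivative
    (\<lambda>v. \<Sum>k\<in>UNIV. det (\<chi> l. if l = k then D k v else \<eta> l x))) (at x)"
proof -
  let ?P = "{p. p permutes (UNIV :: 'n set)}"
  have nth: "((\<lambda>x. \<eta> k x $ j) has_derivative (\<lambda>v. D k v $ j)) (at x)" for k j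
    by (rule bounded_linear.has_derivative[OF bounded_linear_vec_nth assms])
  have 1: "((\<lambda>x. \<Sum>p\<in>?P. of_int (sign p) * (\<Prod>i\<in>UNIV. \<eta> i x $ p i)) has_derivative
      (\<lambda>v. \<Sum>p\<in>?P. of_int (sign p) * (\<Sum>k\<in>UNIV. D k v $ p k * (\<Prod>j\<in>UNIV - {k}. \<eta> j x $ p j)))) (at x)"
    by (rule has_derivative_sum[OF has_derivative_mult_right[OF has_derivative_prod[OF nth]]])
  have "(\<Sum>p\<in>?P. of_int (sign p) * (\<Sum>k\<in>UNIV. D k v $ p k * (\<Prod>j\<in>UNIV - {k}. \<eta> j x $ p j)))
      = (\<Sum>k\<in>UNIV. det (\<chi> l. if l = k then D k v else \<eta> l x))" for v
  proof -
    have prod: "(\<Prod>i\<in>UNIV. (if i = k then D k v else \<eta> i x) $ p i) = D k v $ p k * (\<Prod>j\<in>UNIV - {k}. \<eta> j x $ p j)"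
      for k and p :: "'n \<Rightarrow> 'n"
      by (subst prod.remove[of UNIV k]) (auto intro!: prod.cong)
    have "(\<Sum>k\<in>UNIV. det (\<chi> l. if l = k then D k v else \<eta> l x))
        = (\<Sum>k\<in>UNIV. \<Sum>p\<in>?P. of_int (sign p) * (D k v $ p k * (\<Prod>j\<in>UNIV - {k}. \<eta> j x $ p j)))"
      by (simp add: det_def prod)
    also have "\<dots> = (\<Sum>p\<in>?P. \<Sum>k\<in>UNIV. of_int (sign p) * (D k v $ p k * (\<Prod>j\<in>UNIV - {k}. \<eta> j x $ p j)))"
      by (rule sum.swap)
    finally show ?thesis by (simp add: sum_distrib_left)
  qed
  with 1 show ?thesis by (simp add: det_def)
qed

text \<open>Differentiating \<open>det ((1 + t B) \<eta>) = det (1 + t B) det \<eta>\<close> at \<open>t = 0\<close>.\<close>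

lemma sum_det_replace_row:
  fixes B :: "real^'n \<Rightarrow> real^'n"
  assumes B: "linear B"
  shows "(\<Sum>k\<in>UNIV. det (\<chi> l. if l = k then B (\<eta> k) else \<eta> l)) = (\<Sum>k\<in>UNIV. B (axis k 1) $ k) * det (\<chi> k. \<eta> k)"
proof -
  let ?S = "\<lambda>\<eta>. \<Sum>k\<in>UNIV. det (\<chi> l. if l = k then B (\<eta> k) else \<eta> l)"
  have der: "((\<lambda>t::real. det (\<chi> k. \<eta> k + t *\<^sub>R B (\<eta> k))) has_derivative (\<lambda>t. t * ?S \<eta>)) (at 0)" for \<eta>
  proof -
    have "((\<lambda>t::real. \<eta> k + t *\<^sub>R B (\<eta> k)) has_derivative (\<lambda>t. t *\<^sub>R B (\<eta> k))) (at 0)" for k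
      by (auto intro!: derivative_eq_intros)
    from has_derivative_det_rows[where \<eta>="\<lambda>k t. \<eta> k + t *\<^sub>R B (\<eta> k)" and D="\<lambda>k t. t *\<^sub>R B (\<eta> k)", OF this]
    have "((\<lambda>t::real. det (\<chi> k. \<eta> k + t *\<^sub>R B (\<eta> k))) has_derivative
      (\<lambda>t. \<Sum>k\<in>UNIV. det (\<chi> l. if l = k then t *\<^sub>R B (\<eta> k) else \<eta> l))) (at 0)" by (simp cong: if_cong)
    moreover have "det (\<chi> l. if l = k then t *\<^sub>R B (\<eta> k) else \<eta> l) = t * det (\<chi> l. if l = k then B (\<eta> k) else \<eta> l)" for t k
      using det_row_mul[of k t "\<lambda>_. B (\<eta> k)" \<eta>, unfolded scalar_mult_eq_scaleR] by simp
    ultimately show ?thesis by (simp add: sum_distrib_left)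
  qed
  let ?e = "\<lambda>k::'n. axis k (1::real)"
  have I: "(\<chi> k. ?e k) = (mat 1 :: real^'n^'n)" by (simp add: vec_eq_iff mat_def axis_def)
  have eq: "det (\<chi> k. \<eta> k + t *\<^sub>R B (\<eta> k)) = det (\<chi> k. ?e k + t *\<^sub>R B (?e k)) * det (\<chi> k. \<eta> k)" for t
  proof -
    have T: "linear (\<lambda>v. v + t *\<^sub>R B v)"
      by (rule linearI) (simp_all add: linear_add[OF B] linear_cmul[OF B] algebra_simps)
    have "det (\<chi> k. ?e k + t *\<^sub>R B (?e k)) = det (matrix (\<lambda>v. v + t *\<^sub>R B v))"
      using det_rows_map[OF T, of ?e] by (simp add: I)
    then show ?thesis using det_rows_map[OF T, of \<eta>] by simp
  qed
  have "((\<lambda>t. det (\<chi> k. \<eta> k + t *\<^sub>R B (\<eta> k))) has_derivative (\<lambda>t. t * ?S ?e * det (\<chi> k. \<eta> k))) (at 0)"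
    unfolding eq using has_derivative_mult_left[OF der[of ?e]] .
  from has_derivative_unique[OF der[of \<eta>] this]
  have "?S \<eta> = ?S ?e * det (\<chi> k. \<eta> k)" by (auto dest!: fun_cong[of _ _ 1])
  \<comment> \<open>One row of the unit matrix is replaced by \<open>B (?e k)\<close>. Cramer's rule
    reads off the diagonal entry, so the sum over \<open>k\<close> is the trace of
    \<open>B\<close>.\<close>
  moreover have "det (\<chi> l. if l = k then B (?e k) else ?e l) = B (?e k) $ k" for k
  proof -
    have row: "row i (mat 1 :: real^'n^'n) = ?e i" for i by (simp add: row_def vec_eq_iff mat_def axis_def)
    have "det (\<chi> i. if i = k then sum (\<lambda>i. B (?e k) $ i *s row i (mat 1 :: real^'n^'n)) UNIV else row i (mat 1 :: real^'n^'n))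
        = B (?e k) $ k * det (mat 1 :: real^'n^'n)"
      by (rule cramer_lemma_transpose)
    then show ?thesis by (simp add: row basis_expansion cong: if_cong)
  qed
  ultimately show ?thesis by simp
qed

lemma alternating_formD:
  assumes "alternating_form A p \<omega>"
  shows "v i \<notin> tangent_space A p \<Longrightarrow> \<omega> v = 0"
    and "\<lbrakk>\<forall>j. v j \<in> tangent_space A p; u \<in> tangent_space A p; w \<in> tangent_space A p\<rbrakk> \<Longrightarrow>
        \<omega> (v(i := (\<lambda>h. u h + w h))) = \<omega> (v(i := u)) + \<omega> (v(i := w))"
    and "\<lbrakk>\<forall>j. v j \<in> tangent_space A p; u \<in> tangent_space A p\<rbrakk> \<Longrightarrow>
        \<omega> (v(i := (\<lambda>h. r * u h))) = r * \<omega> (v(i := u))"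
    and "\<lbrakk>\<forall>k. v k \<in> tangent_space A p; i \<noteq> j; v i = v j\<rbrakk> \<Longrightarrow> \<omega> v = 0"
proof -
  show "v i \<notin> tangent_space A p \<Longrightarrow> \<omega> v = 0"
    using assms[unfolded alternating_form_def, THEN conjunct1] by blast
qed (use assms in \<open>unfold alternating_form_def, simp_all\<close>)

context smooth_manifold
begin

lemma chart_deriv_det:
  fixes \<eta> :: "'k::finite \<Rightarrow> 'a \<Rightarrow> real^'k"
  assumes c: "c \<in> A" "p \<in> fst c" and "\<And>k. smooth_at p (\<eta> k)"
  shows "chart_deriv c (\<lambda>q. det (\<chi> k. \<eta> k q)) p v = (\<Sum>k\<in>UNIV. det (\<chi> l. if l = k then chart_deriv c (\<eta> k) p v else \<eta> l p))"
  using chart_deriv_eqI[OF has_derivative_det_rows[where \<eta>="\<lambda>k x. \<eta> k (chart_inv c x)" and D="\<lambda>k. chart_deriv c (\<eta> k) p",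
      OF chart_deriv_has_derivative[OF c assms(3)]]] chart_inv_snd[OF c] by (simp cong: if_cong)

lemma chart_deriv_ln_abs:
  fixes f :: "'a \<Rightarrow> real"
  assumes "c \<in> A" "p \<in> fst c" "smooth_at p f" "f p \<noteq> 0"
  shows "chart_deriv c (\<lambda>q. ln \<bar>f q\<bar>) p v = chart_deriv c f p v / f p"
proof -
  have "((\<lambda>t::real. ln \<bar>t\<bar>) has_derivative (\<lambda>h. inverse (f p) * h)) (at (f (chart_inv c (snd c p))))"
    using DERIV_ln_abs[OF assms(4)] by (simp add: has_field_derivative_def chart_inv_snd assms)
  from chart_deriv_eqI[OF has_derivative_compose[OF chart_deriv_has_derivative[OF assms(1-3)] this]]
  show ?thesis by (simp add: divide_inverse mult.commute)
qed

definition density :: "('a \<Rightarrow> ('n \<Rightarrow> 'a tangent_vector) \<Rightarrow> real) \<Rightarrow> ('a, 'n) chart \<Rightarrow> 'a \<Rightarrow> real" where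
  "density \<Omega> c p = \<Omega> p (\<lambda>k. coord_vector A c p (axis k 1))"

text \<open>In the coordinates of \<open>c\<close> the form at \<open>p\<close> becomes an
  alternating multilinear function of vectors, to which \<open>alternating_det\<close>
  applies.\<close>

lemma alternating_form_density:
  assumes c: "c \<in> A" "p \<in> fst c" and alt: "alternating_form A p (\<Omega> p)"
    and v: "\<And>k. v k \<in> tangent_space A p"
  shows "\<Omega> p v = det (\<chi> k. pcomp c p (v k)) * density \<Omega> c p"
proof -
  define F where "F \<eta> = \<Omega> p (\<lambda>k. coord_vector A c p (\<eta> k))" for \<eta> :: "'n \<Rightarrow> real^'n"
  note tan = coord_vector_tangent[OF c]
  have upd: "(\<lambda>k. coord_vector A c p ((\<eta>(i := u)) k)) = (\<lambda>k. coord_vector A c p (\<eta> k))(i := coord_vector A c p u)"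
    for \<eta> :: "'n \<Rightarrow> real^'n" and i u by auto
  have "F (\<lambda>k. pcomp c p (v k)) = det (\<chi> k. pcomp c p (v k)) * F (\<lambda>k. axis k 1)"
  proof (rule alternating_det)
    fix \<eta> :: "'n \<Rightarrow> real^'n" and i u w
    show "F (\<eta>(i := u + w)) = F (\<eta>(i := u)) + F (\<eta>(i := w))"
      unfolding F_def upd coord_vector_add[OF c] by (rule alternating_formD(2)[OF alt]) (simp_all add: tan)
  next
    fix \<eta> :: "'n \<Rightarrow> real^'n" and i u r
    show "F (\<eta>(i := r *\<^sub>R u)) = r * F (\<eta>(i := u))"
      unfolding F_def upd coord_vector_scale[OF c] by (rule alternating_formD(3)[OF alt]) (simp_all add: tan)
  next
    fix \<eta> :: "'n \<Rightarrow> real^'n" and i j :: 'n assume "i \<noteq> j" "\<eta> i = \<eta> j"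
    then show "F \<eta> = 0"
      unfolding F_def by (intro alternating_formD(4)[OF alt, of _ i j]) (simp_all add: tan)
  qed
  then show ?thesis by (simp add: F_def density_def coord_pcomp[OF c v])
qed

lemma form_density:
  assumes "\<Omega> \<in> differential_forms A" "c \<in> A" "p \<in> fst c" "\<And>k. v k \<in> tangent_space A p"
  shows "\<Omega> p v = det (\<chi> k. pcomp c p (v k)) * density \<Omega> c p"
  using assms(1) by (intro alternating_form_density assms) (simp add: differential_forms_def)

text \<open>The coordinate frame of \<open>c\<close>, expressed in \<open>d\<close>, consists of the
  images of the axes under \<open>tmap c d p\<close>, and their determinant is the Jacobian.\<close>

lemma density_change:
  assumes "\<Omega> \<in> differential_forms A" and c: "c \<in> A" "p \<in> fst c" and d: "d \<in> A" "p \<in> fst d"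
  shows "density \<Omega> c p = jac c d p * density \<Omega> d p"
proof -
  have I: "(\<chi> k. axis k 1) = (mat 1 :: real^'n^'n)" by (simp add: vec_eq_iff mat_def axis_def)
  have "density \<Omega> c p = det (\<chi> k. pcomp d p (coord_vector A c p (axis k 1))) * density \<Omega> d p"
    unfolding density_def[of \<Omega> c] by (rule form_density[OF assms(1) d coord_vector_tangent[OF c]])
  then show ?thesis
    using det_rows_map[OF linear_tmap[OF c(1) d(1) c(2) d(2)], of "\<lambda>k. axis k 1"] I
    by (simp add: coord_vector_change[OF c d] pcomp_coord[OF d] jac_def)
qed

lemma smooth_at_density:
  assumes \<Omega>: "\<Omega> \<in> differential_forms A" and c: "c \<in> A" "p \<in> fst c"
  shows "smooth_at p (density \<Omega> c)"
proof -
  have "\<forall>\<iota> :: 'n \<Rightarrow> 'n. smooth_on (chart_image c)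
        (\<lambda>x. \<Omega> (chart_inv c x) (\<lambda>k. coord_vector A c (chart_inv c x) (axis (\<iota> k) 1)))"
    using \<Omega> c(1) unfolding differential_forms_def by blast
  from spec[OF this, of id] have "smooth_on (chart_image c) (\<lambda>x. density \<Omega> c (chart_inv c x))"
    by (simp add: density_def)
  then show ?thesis using smooth_on_chart_iff[OF c(1)] c(2) by blast
qed

text \<open>The choice of the chart is immaterial if \<open>\<rho>\<close> has the transformation law of the components of a
  top form.\<close>

definition form_of :: "(('a, 'n) chart \<Rightarrow> 'a \<Rightarrow> real) \<Rightarrow> 'a \<Rightarrow> ('n \<Rightarrow> 'a tangent_vector) \<Rightarrow> real" where
  "form_of \<rho> p v = (let c = (SOME c. c \<in> A \<and> p \<in> fst c) in
     if \<forall>k. v k \<in> tangent_space A p then det (\<chi> k. pcomp c p (v k)) * \<rho> c p else 0)"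

lemma form_of:
  assumes compat: "\<And>c d p. c \<in> A \<Longrightarrow> d \<in> A \<Longrightarrow> p \<in> fst c \<Longrightarrow> p \<in> fst d \<Longrightarrow> \<rho> c p = jac c d p * \<rho> d p"
    and smooth: "\<And>c p. c \<in> A \<Longrightarrow> p \<in> fst c \<Longrightarrow> smooth_at p (\<rho> c)"
  shows "form_of \<rho> \<in> differential_forms A"
    and "\<lbrakk>c \<in> A; p \<in> fst c\<rbrakk> \<Longrightarrow> density (form_of \<rho>) c p = \<rho> c p"
proof -
  \<comment> \<open>The chart behind \<open>SOME\<close> is harmless: passing from \<open>c\<close>
    to it multiplies the determinant by \<open>jac c d p\<close>, while the compatibility law
    divides \<open>\<rho>\<close> by the same factor.\<close>
  have val: "form_of \<rho> p v = (if \<forall>k. v k \<in> tangent_space A p then det (\<chi> k. pcomp c p (v k)) * \<rho> c p else 0)"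
    if c: "c \<in> A" "p \<in> fst c" for c p v
  proof -
    define d where "d = (SOME c. c \<in> A \<and> p \<in> fst c)"
    have d: "d \<in> A" "p \<in> fst d" using someI[of "\<lambda>c. c \<in> A \<and> p \<in> fst c" c] c by (auto simp: d_def)
    have "det (\<chi> k. pcomp d p (v k)) = jac c d p * det (\<chi> k. pcomp c p (v k))" if "\<forall>k. v k \<in> tangent_space A p"
      using det_rows_map[OF linear_tmap[OF c(1) d(1) c(2) d(2)], of "\<lambda>k. pcomp c p (v k)"] that
      by (simp add: pcomp_change[OF c d] jac_def)
    then show ?thesis
      using compat[OF c(1) d(1) c(2) d(2)] by (simp add: form_of_def d_def[symmetric])
  qed
  have I: "(\<chi> k. axis k 1) = (mat 1 :: real^'n^'n)" by (simp add: vec_eq_iff mat_def axis_def)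
  show density: "density (form_of \<rho>) c p = \<rho> c p" if "c \<in> A" "p \<in> fst c" for c p
    using that by (simp add: density_def val[OF that] coord_vector_tangent I)
  have alt: "alternating_form A p (form_of \<rho> p)" for p
  proof -
    obtain c where c: "c \<in> A" "p \<in> fst c" using ex_chart by blast
    have upd: "(\<chi> k. pcomp c p ((v(i := u)) k)) = (\<chi> k. if k = i then pcomp c p u else pcomp c p (v k))" for v i u
      by (simp add: vec_eq_iff)
    have 1: "form_of \<rho> p (v(i := (\<lambda>h. u h + w h))) = form_of \<rho> p (v(i := u)) + form_of \<rho> p (v(i := w))"
      if "\<forall>j. v j \<in> tangent_space A p" "u \<in> tangent_space A p" "w \<in> tangent_space A p" for v i u w
      unfolding val[OF c] upd pcomp_add[OF c that(2,3)] det_row_add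
      using that tangent_space_add[OF that(2,3)] by (simp add: algebra_simps)
    have 2: "form_of \<rho> p (v(i := (\<lambda>h. r * u h))) = r * form_of \<rho> p (v(i := u))"
      if "\<forall>j. v j \<in> tangent_space A p" "u \<in> tangent_space A p" for v i u r
      unfolding val[OF c] upd pcomp_scale[OF c that(2)]
      using det_row_mul[of i r "\<lambda>_. pcomp c p u" "\<lambda>k. pcomp c p (v k)", unfolded scalar_mult_eq_scaleR]
        that tangent_space_scale[OF that(2)] by simp
    have 3: "form_of \<rho> p v = 0" if "i \<noteq> j" "v i = v j" for v i j
    proof -
      have "det (\<chi> k. pcomp c p (v k)) = 0"
        by (rule det_identical_rows[OF that(1)]) (use that in \<open>simp add: row_def\<close>)
      then show ?thesis by (simp add: val[OF c])
    qed
    have 4: "form_of \<rho> p v = 0" if "v i \<notin> tangent_space A p" for v i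
      unfolding val[OF c] using that by auto
    show ?thesis
      unfolding alternating_form_def
    proof (intro conjI allI impI)
      show "form_of \<rho> p v = 0" if "\<exists>i. v i \<notin> tangent_space A p" for v using that 4 by auto
    qed (simp_all add: 1 2 3)
  qed
  show "form_of \<rho> \<in> differential_forms A"
    unfolding differential_forms_def
  proof (intro CollectI conjI allI ballI)
    fix c and \<iota> :: "'n \<Rightarrow> 'n" assume c: "c \<in> A"
    have "\<forall>p\<in>fst c. smooth_at p (\<lambda>p. form_of \<rho> p (\<lambda>k. coord_vector A c p (axis (\<iota> k) 1)))"
    proof
      fix p assume p: "p \<in> fst c"
      have "smooth_at p (\<lambda>q. det (\<chi> k. (axis (\<iota> k) 1 :: real^'n)) * \<rho> c q)"
        by (intro smooth_at_mult smooth_at_const smooth[OF c p])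
      then show "smooth_at p (\<lambda>p. form_of \<rho> p (\<lambda>k. coord_vector A c p (axis (\<iota> k) 1)))"
        by (rule smooth_at_cong[OF open_chart[OF c] p, rotated]) (simp add: val[OF c] c coord_vector_tangent)
    qed
    then show "smooth_on (chart_image c) (\<lambda>x. form_of \<rho> (chart_inv c x) (\<lambda>k. coord_vector A c (chart_inv c x) (axis (\<iota> k) 1)))"
      using smooth_on_chart_iff[OF c, of "\<lambda>p. form_of \<rho> p (\<lambda>k. coord_vector A c p (axis (\<iota> k) 1))"] by simp
  qed (rule alt)
qed

text \<open>The divergence with respect to the coordinate volume of the chart. It depends on the
  chart; the derivative of the logarithm of a density compensates for this.\<close>

definition coord_div :: "('a, 'n) chart \<Rightarrow> 'a vector_field \<Rightarrow> 'a \<Rightarrow> real" where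
  "coord_div c X p = (\<Sum>k\<in>UNIV. chart_deriv c (vcomp c X) p (axis k 1) $ k)"

lemma smooth_at_coord_div:
  "X \<in> vector_fields A \<Longrightarrow> c \<in> A \<Longrightarrow> p \<in> fst c \<Longrightarrow> smooth_at p (coord_div c X)"
  unfolding coord_div_def by (intro smooth_at_sum smooth_at_nth smooth_at_chart_deriv smooth_at_vcomp)

lemma form_eval_density:
  assumes "\<Omega> \<in> differential_forms A" "c \<in> A" "p \<in> fst c" "\<And>k. Xs k \<in> vector_fields A"
  shows "form_eval \<Omega> Xs p = det (\<chi> k. vcomp c (Xs k) p) * density \<Omega> c p"
  unfolding form_eval_def vcomp_def by (rule form_density[OF assms(1-3) vf_tangent[OF assms(4)]])

lemma form_eval_smooth:
  assumes \<Omega>: "\<Omega> \<in> differential_forms A" and Xs: "\<And>k. Xs k \<in> vector_fields A"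
  shows "form_eval \<Omega> (Xs :: 'n \<Rightarrow> _) \<in> smooth_functions A"
  unfolding smooth_functions_iff
proof
  fix p
  obtain c where c: "c \<in> A" "p \<in> fst c" using ex_chart by blast
  have "smooth_at p (\<lambda>q. det (\<chi> k. vcomp c (Xs k) q) * density \<Omega> c q)"
    by (intro smooth_at_mult smooth_at_det smooth_at_density \<Omega> c) (simp add: smooth_at_nth smooth_at_vcomp Xs c)
  then show "smooth_at p (form_eval \<Omega> Xs)"
    by (rule smooth_at_cong[OF open_chart[OF c(1)] c(2), rotated])
      (simp add: form_eval_density[OF \<Omega> c(1) _ Xs])
qed

text \<open>Differentiating determinant times density along \<open>X\<close> replaces one row at a
  time by the derivative of the components of \<open>Xs k\<close>. The brackets cancel exactly these
  terms and leave rows transformed by the derivative of the components of \<open>X\<close>, which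
  sum to the trace times the determinant.\<close>

lemma lie_derivative_density:
  assumes \<Omega>: "\<Omega> \<in> differential_forms A" and X: "X \<in> vector_fields A"
    and Xs: "\<And>k. Xs k \<in> vector_fields A" and c: "c \<in> A" "p \<in> fst c"
  shows "lie_derivative X \<Omega> (Xs :: 'n \<Rightarrow> _) p
    = (coord_div c X p * density \<Omega> c p + chart_deriv c (density \<Omega> c) p (vcomp c X p)) * det (\<chi> k. vcomp c (Xs k) p)"
proof -
  let ?\<xi> = "vcomp c X p" and ?\<rho> = "density \<Omega> c p" and ?\<eta> = "\<lambda>k. vcomp c (Xs k) p"
  let ?d = "\<lambda>k. chart_deriv c (vcomp c (Xs k)) p ?\<xi>" and ?B = "chart_deriv c (vcomp c X) p"
  have B: "linear ?B" by (rule linear_chart_deriv[OF c smooth_at_vcomp[OF X c]])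
  have sdet: "smooth_at p (\<lambda>q. det (\<chi> k. vcomp c (Xs k) q))"
    by (rule smooth_at_det) (simp add: smooth_at_nth smooth_at_vcomp Xs c)
  have "vf_apply X (form_eval \<Omega> Xs) p = chart_deriv c (form_eval \<Omega> Xs) p ?\<xi>"
    by (rule vf_apply_chart_deriv[OF X form_eval_smooth[OF \<Omega> Xs] c])
  also have "\<dots> = chart_deriv c (\<lambda>q. det (\<chi> k. vcomp c (Xs k) q) * density \<Omega> c q) p ?\<xi>"
    by (rule fun_cong[OF chart_deriv_cong[OF c open_chart[OF c(1)] c(2)]]) (rule form_eval_density[OF \<Omega> c(1) _ Xs])
  also have "\<dots> = det (\<chi> k. ?\<eta> k) * chart_deriv c (density \<Omega> c) p ?\<xi>
      + (\<Sum>k\<in>UNIV. det (\<chi> l. if l = k then ?d k else ?\<eta> l)) * ?\<rho>"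
    by (subst chart_deriv_mult[OF c]) (simp_all add: sdet smooth_at_density[OF \<Omega> c] chart_deriv_det[OF c] smooth_at_vcomp[OF Xs c])
  finally have 1: "vf_apply X (form_eval \<Omega> Xs) p = \<dots>" .
  have "form_eval \<Omega> (Xs(k := lie_bracket X (Xs k))) p
      = (det (\<chi> l. if l = k then ?d k else ?\<eta> l) - det (\<chi> l. if l = k then ?B (?\<eta> k) else ?\<eta> l)) * ?\<rho>" for k
  proof -
    have "form_eval \<Omega> (Xs(k := lie_bracket X (Xs k))) p
        = det (\<chi> l. vcomp c ((Xs(k := lie_bracket X (Xs k))) l) p) * ?\<rho>"
      by (rule form_eval_density[OF \<Omega> c]) (simp add: Xs lie_bracket_in[OF X Xs])
    also have "(\<chi> l. vcomp c ((Xs(k := lie_bracket X (Xs k))) l) p) = (\<chi> l. if l = k then ?d k - ?B (?\<eta> k) else ?\<eta> l)"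
      by (simp add: vec_eq_iff vcomp_bracket[OF X Xs c])
    also have "det \<dots> = det (\<chi> l. if l = k then ?d k else ?\<eta> l) - det (\<chi> l. if l = k then ?B (?\<eta> k) else ?\<eta> l)"
      using det_row_add[of k "\<lambda>_. ?d k - ?B (?\<eta> k)" "\<lambda>_. ?B (?\<eta> k)" ?\<eta>, unfolded diff_add_cancel] by simp
    finally show ?thesis .
  qed
  then have "(\<Sum>k\<in>UNIV. form_eval \<Omega> (Xs(k := lie_bracket X (Xs k))) p)
      = (\<Sum>k\<in>UNIV. det (\<chi> l. if l = k then ?d k else ?\<eta> l)) * ?\<rho>
        - (\<Sum>k\<in>UNIV. det (\<chi> l. if l = k then ?B (?\<eta> k) else ?\<eta> l)) * ?\<rho>"
    by (simp only: sum_subtractf sum_distrib_right left_diff_distrib)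
  then have "lie_derivative X \<Omega> Xs p = det (\<chi> k. ?\<eta> k) * chart_deriv c (density \<Omega> c) p ?\<xi>
      + (\<Sum>k\<in>UNIV. det (\<chi> l. if l = k then ?B (?\<eta> k) else ?\<eta> l)) * ?\<rho>"
    unfolding lie_derivative_def 1
    by simp
  also have "(\<Sum>k\<in>UNIV. det (\<chi> l. if l = k then ?B (?\<eta> k) else ?\<eta> l)) = coord_div c X p * det (\<chi> k. ?\<eta> k)"
    unfolding coord_div_def by (rule sum_det_replace_row[OF B])
  finally show ?thesis by (simp add: algebra_simps)
qed

lemma coord_frame:
  assumes c: "c \<in> A" "p \<in> fst c"
  obtains Xs :: "'n \<Rightarrow> 'a vector_field" where "\<And>k. Xs k \<in> vector_fields A" "det (\<chi> k. vcomp c (Xs k) p) = 1"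
proof -
  have "\<exists>X\<in>vector_fields A. vcomp c X p = axis k 1" for k
    using local_vf[OF c(1) open_chart[OF c(1)] c(2), of "\<lambda>_. axis k 1"] by auto
  then obtain Xs where Xs: "\<And>k. Xs k \<in> vector_fields A \<and> vcomp c (Xs k) p = axis k 1" by metis
  have "(\<chi> k. axis k 1) = (mat 1 :: real^'n^'n)" by (simp add: vec_eq_iff mat_def axis_def)
  then have "det (\<chi> k. vcomp c (Xs k) p) = 1" using Xs by simp
  with Xs that show ?thesis by blast
qed

lemma lie_derivative_density_nonzero:
  assumes \<Omega>: "\<Omega> \<in> differential_forms A" and X: "X \<in> vector_fields A"
    and Xs: "\<And>k. Xs k \<in> vector_fields A" and c: "c \<in> A" "p \<in> fst c" and nz: "density \<Omega> c p \<noteq> 0"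
  shows "lie_derivative X \<Omega> (Xs :: 'n \<Rightarrow> _) p
    = (coord_div c X p + chart_deriv c (\<lambda>q. ln \<bar>density \<Omega> c q\<bar>) p (vcomp c X p)) * form_eval \<Omega> Xs p"
  unfolding lie_derivative_density[OF \<Omega> X Xs c] form_eval_density[OF \<Omega> c Xs] chart_deriv_ln_abs[OF c smooth_at_density[OF \<Omega> c] nz]
  using nz by (simp add: field_simps)

text \<open>Both sides are the factor \<open>g\<close> in \<open>L_X \<Omega> = g \<Omega>\<close>
  at \<open>p\<close>, tested on a frame. Nonvanishing is asked at \<open>p\<close> alone, so that
  the statement applies to cut-off forms.\<close>

lemma local_divergence_unique:
  assumes \<Omega>: "\<Omega> \<in> differential_forms A" and X: "X \<in> vector_fields A"
    and c: "c \<in> A" "p \<in> fst c" and d: "d \<in> A" "p \<in> fst d" and nz: "density \<Omega> c p \<noteq> 0"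
  shows "coord_div c X p + chart_deriv c (\<lambda>q. ln \<bar>density \<Omega> c q\<bar>) p (vcomp c X p)
    = coord_div d X p + chart_deriv d (\<lambda>q. ln \<bar>density \<Omega> d q\<bar>) p (vcomp d X p)"
proof -
  obtain Xs :: "'n \<Rightarrow> 'a vector_field" where Xs: "\<And>k. Xs k \<in> vector_fields A" "det (\<chi> k. vcomp c (Xs k) p) = 1"
    by (rule coord_frame[OF c]) (rule that)
  have "form_eval \<Omega> Xs p \<noteq> 0" using form_eval_density[OF \<Omega> c Xs(1)] Xs(2) nz by simp
  moreover have "density \<Omega> d p \<noteq> 0" using density_change[OF \<Omega> c d] nz by auto
  ultimately show ?thesis
    using lie_derivative_density_nonzero[where Xs=Xs, OF \<Omega> X Xs(1) c nz] lie_derivative_density_nonzero[where Xs=Xs, OF \<Omega> X Xs(1) d]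
    by simp
qed

lemma volume_form_iff:
  "volume_form A \<Omega> \<longleftrightarrow> \<Omega> \<in> differential_forms A \<and> (\<forall>c\<in>A. \<forall>p\<in>fst c. density \<Omega> c p \<noteq> 0)"
proof
  assume v: "volume_form A \<Omega>"
  then have \<Omega>: "\<Omega> \<in> differential_forms A" by (simp add: volume_form_def)
  have "density \<Omega> c p \<noteq> 0" if c: "c \<in> A" "p \<in> fst c" for c p
  proof
    assume 0: "density \<Omega> c p = 0"
    have "\<Omega> p v = 0" for v
    proof (cases "\<forall>k. v k \<in> tangent_space A p")
      case True
      then show ?thesis using form_density[OF \<Omega> c] 0 by simp
    next
      case False
      then obtain k where "v k \<notin> tangent_space A p" by blast
      moreover have "alternating_form A p (\<Omega> p)" using \<Omega> by (simp add: differential_forms_def)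
      ultimately show ?thesis by (rule alternating_formD(1)[rotated])
    qed
    then have "\<Omega> p = (\<lambda>v. 0)" by (rule ext)
    then show False using v by (simp add: volume_form_def)
  qed
  with \<Omega> show "\<Omega> \<in> differential_forms A \<and> (\<forall>c\<in>A. \<forall>p\<in>fst c. density \<Omega> c p \<noteq> 0)" by blast
next
  assume *: "\<Omega> \<in> differential_forms A \<and> (\<forall>c\<in>A. \<forall>p\<in>fst c. density \<Omega> c p \<noteq> 0)"
  have "\<Omega> p \<noteq> (\<lambda>v. 0)" for p
  proof -
    obtain c where "c \<in> A" "p \<in> fst c" using ex_chart by blast
    then have "density \<Omega> c p \<noteq> 0" using * by blast
    then show ?thesis by (auto simp: density_def)
  qed
  then show "volume_form A \<Omega>" using * by (simp add: volume_form_def)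
qed

text \<open>The local formula, taken in a chosen chart at each point, defines one function by
  \<open>local_divergence_unique\<close>. Evaluation on a frame at each point shows that no other
  function satisfies the condition under \<open>THE\<close>.\<close>

lemma divergence_density:
  assumes v: "volume_form A \<Omega>" and X: "X \<in> vector_fields A"
  shows "divergence A \<Omega> X \<in> smooth_functions A"
    and "\<lbrakk>c \<in> A; p \<in> fst c\<rbrakk> \<Longrightarrow> divergence A \<Omega> X p = coord_div c X p + chart_deriv c (\<lambda>q. ln \<bar>density \<Omega> c q\<bar>) p (vcomp c X p)"
proof -
  have \<Omega>: "\<Omega> \<in> differential_forms A" and nz: "\<And>c p. c \<in> A \<Longrightarrow> p \<in> fst c \<Longrightarrow> density \<Omega> c p \<noteq> 0"
    using v volume_form_iff by auto
  define g where "g p = (let c = (SOME c. c \<in> A \<and> p \<in> fst c) in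
      coord_div c X p + chart_deriv c (\<lambda>q. ln \<bar>density \<Omega> c q\<bar>) p (vcomp c X p))" for p
  have g: "g p = coord_div c X p + chart_deriv c (\<lambda>q. ln \<bar>density \<Omega> c q\<bar>) p (vcomp c X p)" if c: "c \<in> A" "p \<in> fst c" for c p
  proof -
    define d where "d = (SOME c. c \<in> A \<and> p \<in> fst c)"
    have d: "d \<in> A" "p \<in> fst d" using someI[of "\<lambda>c. c \<in> A \<and> p \<in> fst c" c] c by (auto simp: d_def)
    show ?thesis using local_divergence_unique[OF \<Omega> X d c nz[OF d]] by (simp add: g_def d_def[symmetric])
  qed
  have gs: "g \<in> smooth_functions A"
    unfolding smooth_functions_iff
  proof
    fix p
    obtain c where c: "c \<in> A" "p \<in> fst c" using ex_chart by blast
    have "smooth_at p (\<lambda>q. coord_div c X q + chart_deriv c (\<lambda>q. ln \<bar>density \<Omega> c q\<bar>) q (vcomp c X q))"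
      by (intro smooth_at_add smooth_at_coord_div smooth_at_chart_deriv_apply smooth_at_ln_abs smooth_at_density smooth_at_vcomp X c \<Omega> nz)
    then show "smooth_at p g"
      by (rule smooth_at_cong[OF open_chart[OF c(1)] c(2), rotated]) (simp add: g[OF c(1)])
  qed
  let ?P = "\<lambda>g. g \<in> smooth_functions A \<and> (\<forall>Xs. (\<forall>i. Xs i \<in> vector_fields A) \<longrightarrow>
        lie_derivative X \<Omega> Xs = (\<lambda>p. g p * form_eval \<Omega> Xs p))"
  have Pg: "?P g"
  proof (intro conjI allI impI ext gs)
    fix Xs :: "'n \<Rightarrow> 'a vector_field" and p assume Xs: "\<forall>i. Xs i \<in> vector_fields A"
    obtain c where c: "c \<in> A" "p \<in> fst c" using ex_chart by blast
    show "lie_derivative X \<Omega> Xs p = g p * form_eval \<Omega> Xs p"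
      using lie_derivative_density_nonzero[OF \<Omega> X _ c nz[OF c]] Xs g[OF c] by simp
  qed
  have "divergence A \<Omega> X = g"
    unfolding divergence_def
  proof (rule the_equality[of ?P, OF Pg])
    fix g' assume g': "?P g'"
    show "g' = g"
    proof
      fix p
      obtain c where c: "c \<in> A" "p \<in> fst c" using ex_chart by blast
      obtain Xs :: "'n \<Rightarrow> 'a vector_field" where Xs: "\<And>k. Xs k \<in> vector_fields A" "det (\<chi> k. vcomp c (Xs k) p) = 1"
        by (rule coord_frame[OF c]) (rule that)
      have "form_eval \<Omega> Xs p \<noteq> 0" using form_eval_density[OF \<Omega> c Xs(1)] Xs(2) nz[OF c] by simp
      moreover have "lie_derivative X \<Omega> Xs = (\<lambda>p. g p * form_eval \<Omega> Xs p)"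
        "lie_derivative X \<Omega> Xs = (\<lambda>p. g' p * form_eval \<Omega> Xs p)"
        using g' Pg Xs(1) by blast+
      then have "g' p * form_eval \<Omega> Xs p = g p * form_eval \<Omega> Xs p" by (auto dest: fun_cong[of _ _ p])
      ultimately show "g' p = g p" by simp
    qed
  qed
  with g gs show "divergence A \<Omega> X \<in> smooth_functions A"
    "\<lbrakk>c \<in> A; p \<in> fst c\<rbrakk> \<Longrightarrow> divergence A \<Omega> X p = coord_div c X p + chart_deriv c (\<lambda>q. ln \<bar>density \<Omega> c q\<bar>) p (vcomp c X p)"
    by auto
qed

end

section \<open>Operators satisfying the two rules\<close>

context smooth_manifold
begin

lemma chart_deriv_chart_deriv_symmetric_vec:
  fixes F :: "'a \<Rightarrow> real^'m"
  assumes c: "c \<in> A" "p \<in> fst c" and F: "smooth_at p F"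
  shows "chart_deriv c (\<lambda>q. chart_deriv c F q v) p u = chart_deriv c (\<lambda>q. chart_deriv c F q u) p v"
proof -
  obtain U where U: "open U" "p \<in> U" "\<And>q. q \<in> U \<Longrightarrow> smooth_at q F" by (rule smooth_at_open[OF F]) (rule that)
  have oU: "open (U \<inter> fst c)" "p \<in> U \<inter> fst c" using U c by (auto intro: open_Int open_chart)
  have nth: "chart_deriv c (\<lambda>q. chart_deriv c F q v) p u $ i = chart_deriv c (\<lambda>q. chart_deriv c (\<lambda>q. F q $ i) q v) p u" for i u v
  proof -
    have "chart_deriv c (\<lambda>q. chart_deriv c F q v) p u $ i = chart_deriv c (\<lambda>q. chart_deriv c F q v $ i) p u"
      using chart_deriv_nth[OF c smooth_at_chart_deriv[OF c F]] by simp
    also have "\<dots> = chart_deriv c (\<lambda>q. chart_deriv c (\<lambda>q. F q $ i) q v) p u"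
      by (rule fun_cong[OF chart_deriv_cong[OF c oU]]) (use chart_deriv_nth[OF c(1) _ U(3)] in auto)
    finally show ?thesis .
  qed
  show ?thesis
    unfolding vec_eq_iff nth using chart_deriv_chart_deriv_symmetric[OF c smooth_at_nth[OF F]] by blast
qed

text \<open>The extra term is the trace of the rank-one map that sends \<open>v\<close> to the
  derivative of \<open>f\<close> along \<open>v\<close> times the components of \<open>X\<close>;
  this trace is \<open>X f\<close>.\<close>

lemma coord_div_scale:
  assumes f: "f \<in> smooth_functions A" and X: "X \<in> vector_fields A" and c: "c \<in> A" "p \<in> fst c"
  shows "coord_div c (vf_scale f X) p = f p * coord_div c X p + vf_apply X f p"
proof -
  have "chart_deriv c (vcomp c (vf_scale f X)) p v = f p *\<^sub>R chart_deriv c (vcomp c X) p v + chart_deriv c f p v *\<^sub>R vcomp c X p" for v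
  proof -
    have "chart_deriv c (vcomp c (vf_scale f X)) p v = chart_deriv c (\<lambda>q. f q *\<^sub>R vcomp c X q) p v"
      by (rule fun_cong[OF chart_deriv_cong[OF c open_chart[OF c(1)] c(2)]]) (rule vf_scale_in(2)[OF f X c(1)])
    then show ?thesis using chart_deriv_scaleR[OF c smooth_functionsD[OF f] smooth_at_vcomp[OF X c]] by simp
  qed
  then show ?thesis
    using chart_deriv_axis_sum[OF c smooth_functionsD[OF f], of "vcomp c X p"]
    by (simp add: coord_div_def vf_apply_chart_deriv[OF X f c] sum.distrib sum_distrib_left mult.commute)
qed

text \<open>Symmetry turns the second derivatives of the components into derivatives of the two
  divergences. The remaining terms are traces of the products of the two Jacobian matrices in either
  order, which are equal.\<close>

lemma coord_div_bracket:
  assumes X: "X \<in> vector_fields A" and Y: "Y \<in> vector_fields A" and c: "c \<in> A" "p \<in> fst c"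
  shows "coord_div c (lie_bracket X Y) p = chart_deriv c (coord_div c Y) p (vcomp c X p) - chart_deriv c (coord_div c X) p (vcomp c Y p)"
proof -
  let ?x = "vcomp c X" and ?y = "vcomp c Y"
  note sx = smooth_at_vcomp[OF X c] and sy = smooth_at_vcomp[OF Y c]
  have "chart_deriv c (vcomp c (lie_bracket X Y)) p v
      = chart_deriv c (\<lambda>q. chart_deriv c ?y q (?x q)) p v - chart_deriv c (\<lambda>q. chart_deriv c ?x q (?y q)) p v" for v
  proof -
    have "chart_deriv c (vcomp c (lie_bracket X Y)) p v = chart_deriv c (\<lambda>q. chart_deriv c ?y q (?x q) - chart_deriv c ?x q (?y q)) p v"
      by (rule fun_cong[OF chart_deriv_cong[OF c open_chart[OF c(1)] c(2)]]) (rule vcomp_bracket[OF X Y c(1)])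
    also have "\<dots> = chart_deriv c (\<lambda>q. chart_deriv c ?y q (?x q)) p v - chart_deriv c (\<lambda>q. chart_deriv c ?x q (?y q)) p v"
      by (rule chart_deriv_diff[OF c]) (intro smooth_at_chart_deriv_apply c sx sy)+
    finally show ?thesis .
  qed
  then have 1: "coord_div c (lie_bracket X Y) p =
      (\<Sum>k\<in>UNIV. chart_deriv c (\<lambda>q. chart_deriv c ?y q (?x p)) p (axis k 1) $ k) + (\<Sum>k\<in>UNIV. chart_deriv c ?y p (chart_deriv c ?x p (axis k 1)) $ k)
      - ((\<Sum>k\<in>UNIV. chart_deriv c (\<lambda>q. chart_deriv c ?x q (?y p)) p (axis k 1) $ k) + (\<Sum>k\<in>UNIV. chart_deriv c ?x p (chart_deriv c ?y p (axis k 1)) $ k))"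
    by (simp add: coord_div_def chart_deriv_apply[OF c sy sx] chart_deriv_apply[OF c sx sy] sum.distrib sum_subtractf)
  have 2: "(\<Sum>k\<in>UNIV. chart_deriv c (\<lambda>q. chart_deriv c (vcomp c Z) q v) p (axis k 1) $ k) = chart_deriv c (coord_div c Z) p v"
    if Z: "Z \<in> vector_fields A" for Z v
    unfolding chart_deriv_chart_deriv_symmetric_vec[OF c smooth_at_vcomp[OF Z c], of v] coord_div_def
    using chart_deriv_nth[OF c smooth_at_chart_deriv[OF c smooth_at_vcomp[OF Z c]]]
    by (subst chart_deriv_sum[OF c]) (simp_all add: smooth_at_nth smooth_at_chart_deriv[OF c] smooth_at_vcomp[OF Z c])
  have trace: "(\<Sum>k\<in>UNIV. chart_deriv c F p (chart_deriv c G p (axis k 1)) $ k)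
      = (\<Sum>k\<in>UNIV. \<Sum>j\<in>UNIV. chart_deriv c G p (axis k 1) $ j * chart_deriv c F p (axis j 1) $ k)"
    if "smooth_at p F" for F :: "'a \<Rightarrow> real^'n" and G :: "'a \<Rightarrow> real^'n"
    using chart_deriv_axis_sum[OF c that, of "chart_deriv c G p _"] by simp
  have 3: "(\<Sum>k\<in>UNIV. chart_deriv c ?y p (chart_deriv c ?x p (axis k 1)) $ k) = (\<Sum>k\<in>UNIV. chart_deriv c ?x p (chart_deriv c ?y p (axis k 1)) $ k)"
    unfolding trace[OF sx] trace[OF sy] by (subst sum.swap) (simp add: mult.commute)
  show ?thesis unfolding 1 2[OF X] 2[OF Y] 3 by simp
qed

definition has_coeff :: "('a vector_field \<Rightarrow> 'a \<Rightarrow> real) \<Rightarrow> ('a, 'n) chart \<Rightarrow> ('a \<Rightarrow> real^'n) \<Rightarrow> bool" where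
  "has_coeff D c b \<longleftrightarrow> (\<forall>p\<in>fst c. smooth_at p b) \<and>
     (\<forall>p\<in>fst c. \<forall>u v. chart_deriv c b p u \<bullet> v = chart_deriv c b p v \<bullet> u) \<and>
     (\<forall>X\<in>vector_fields A. \<forall>p\<in>fst c. D X p = coord_div c X p + b p \<bullet> vcomp c X p)"

text \<open>\<open>coord_div\<close> satisfies both rules by itself. In the bracket rule the term
  with \<open>b\<close> leaves only the antisymmetric part of the derivative of \<open>b\<close>,
  which is 0 because \<open>b\<close> is closed.\<close>

lemma rules_from_coeff:
  assumes D: "\<And>X. X \<in> vector_fields A \<Longrightarrow> D X \<in> smooth_functions A"
    and coeff: "\<And>c. c \<in> A \<Longrightarrow> \<exists>b. has_coeff D c b"
  shows "bracket_rule A D" "product_rule A D"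
proof -
  show "product_rule A D"
    unfolding product_rule_def
  proof (intro ballI ext)
    fix f X p assume f: "f \<in> smooth_functions A" and X: "X \<in> vector_fields A"
    obtain c where c: "c \<in> A" "p \<in> fst c" using ex_chart by blast
    obtain b where b: "has_coeff D c b" using coeff c by blast
    then have "D Y p = coord_div c Y p + b p \<bullet> vcomp c Y p" if "Y \<in> vector_fields A" for Y
      using that c by (simp add: has_coeff_def)
    from this[OF X] this[OF vf_scale_in(1)[OF f X]]
    show "D (vf_scale f X) p = f p * D X p + vf_apply X f p"
      by (simp add: coord_div_scale[OF f X c] vf_scale_in(2)[OF f X c] algebra_simps)
  qed
  show "bracket_rule A D"
    unfolding bracket_rule_def
  proof (intro ballI ext)
    fix X Y p assume X: "X \<in> vector_fields A" and Y: "Y \<in> vector_fields A"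
    obtain c where c: "c \<in> A" "p \<in> fst c" using ex_chart by blast
    obtain b where b: "has_coeff D c b" using coeff c by blast
    have sb: "smooth_at p b" and sym: "\<And>u v. chart_deriv c b p u \<bullet> v = chart_deriv c b p v \<bullet> u"
      using b c unfolding has_coeff_def by blast+
    have Dq: "D Y q = coord_div c Y q + b q \<bullet> vcomp c Y q" if "Y \<in> vector_fields A" "q \<in> fst c" for Y q
      using that b by (simp add: has_coeff_def)
    have XY: "vf_apply X (D Y) p = chart_deriv c (coord_div c Y) p (vcomp c X p)
        + (b p \<bullet> chart_deriv c (vcomp c Y) p (vcomp c X p) + chart_deriv c b p (vcomp c X p) \<bullet> vcomp c Y p)"
      if X: "X \<in> vector_fields A" and Y: "Y \<in> vector_fields A" for X Y
    proof -
      have "vf_apply X (D Y) p = chart_deriv c (D Y) p (vcomp c X p)"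
        by (rule vf_apply_chart_deriv[OF X D[OF Y] c])
      also have "\<dots> = chart_deriv c (\<lambda>q. coord_div c Y q + b q \<bullet> vcomp c Y q) p (vcomp c X p)"
        by (rule fun_cong[OF chart_deriv_cong[OF c open_chart[OF c(1)] c(2)]]) (rule Dq[OF Y])
      finally show ?thesis
        using smooth_at_coord_div[OF Y c] smooth_at_vcomp[OF Y c] sb
        by (simp add: chart_deriv_add[OF c] chart_deriv_inner[OF c] smooth_at_inner)
    qed
    show "D (lie_bracket X Y) p = vf_apply X (D Y) p - vf_apply Y (D X) p"
      unfolding Dq[OF lie_bracket_in[OF X Y] c(2)] coord_div_bracket[OF X Y c] vcomp_bracket[OF X Y c] XY[OF X Y] XY[OF Y X]
      using sym[of "vcomp c X p" "vcomp c Y p"] by (simp add: inner_diff_right)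
  qed
qed

definition cgrad :: "('a, 'n) chart \<Rightarrow> ('a \<Rightarrow> real) \<Rightarrow> 'a \<Rightarrow> real^'n" where
  "cgrad c f p = (\<chi> i. chart_deriv c f p (axis i 1))"

lemma cgrad_inner: "c \<in> A \<Longrightarrow> p \<in> fst c \<Longrightarrow> smooth_at p f \<Longrightarrow> cgrad c f p \<bullet> v = chart_deriv c f p v"
  by (subst chart_deriv_axis_sum) (auto simp: cgrad_def inner_vec_def mult.commute)

lemma smooth_at_cgrad: "c \<in> A \<Longrightarrow> p \<in> fst c \<Longrightarrow> smooth_at p f \<Longrightarrow> smooth_at p (cgrad c f)"
  by (rule smooth_at_vec) (simp add: cgrad_def smooth_at_chart_deriv)

lemma cgrad_closed:
  assumes c: "c \<in> A" "p \<in> fst c" and f: "smooth_at p f"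
  shows "chart_deriv c (cgrad c f) p u \<bullet> v = chart_deriv c (cgrad c f) p v \<bullet> u"
proof -
  obtain U where U: "open U" "p \<in> U" "\<And>q. q \<in> U \<Longrightarrow> smooth_at q f" by (rule smooth_at_open[OF f]) (rule that)
  have oU: "open (U \<inter> fst c)" "p \<in> U \<inter> fst c" using U c by (auto intro: open_Int open_chart)
  have "chart_deriv c (cgrad c f) p u \<bullet> v = chart_deriv c (\<lambda>q. chart_deriv c f q v) p u" for u v
  proof -
    have "chart_deriv c (cgrad c f) p u \<bullet> v = chart_deriv c (\<lambda>q. cgrad c f q \<bullet> v) p u"
      using chart_deriv_inner[OF c smooth_at_cgrad[OF c f] smooth_at_const[of p v]] by (simp add: chart_deriv_const)
    also have "\<dots> = chart_deriv c (\<lambda>q. chart_deriv c f q v) p u"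
      by (rule fun_cong[OF chart_deriv_cong[OF c oU]]) (use cgrad_inner[OF c(1) _ U(3)] in auto)
    finally show ?thesis .
  qed
  then show ?thesis using chart_deriv_chart_deriv_symmetric[OF c f] by simp
qed

lemma has_coeff_cgrad:
  assumes c: "c \<in> A" and f: "\<And>p. p \<in> fst c \<Longrightarrow> smooth_at p f"
    and D: "\<And>X p. X \<in> vector_fields A \<Longrightarrow> p \<in> fst c \<Longrightarrow> D X p = coord_div c X p + chart_deriv c f p (vcomp c X p)"
  shows "has_coeff D c (cgrad c f)"
  using assms by (auto simp: has_coeff_def smooth_at_cgrad cgrad_closed cgrad_inner)

lemma divergence_coeff:
  assumes v: "volume_form A \<Omega>" and c: "c \<in> A"
  shows "has_coeff (divergence A \<Omega>) c (cgrad c (\<lambda>q. ln \<bar>density \<Omega> c q\<bar>))"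
  using v c by (intro has_coeff_cgrad smooth_at_ln_abs smooth_at_density) (auto simp: volume_form_iff divergence_density)

lemma divergence_rules:
  assumes v: "volume_form A \<Omega>" and D: "\<And>X. X \<in> vector_fields A \<Longrightarrow> D X = divergence A \<Omega> X"
  shows "bracket_rule A D \<and> product_rule A D"
proof -
  have "\<exists>b. has_coeff D c b" if "c \<in> A" for c
    using divergence_coeff[OF v that] D by (auto simp: has_coeff_def)
  then show ?thesis using rules_from_coeff[of D] D divergence_density(1)[OF v] by auto
qed

end

section \<open>Coefficients of an operator in a chart\<close>

locale divergence_operator = smooth_manifold A for A :: "('a::{t2_space,second_countable_topology}, 'n::finite) chart set" +
  fixes D :: "'a vector_field \<Rightarrow> 'a \<Rightarrow> real"
  assumes lin: "linear_operator A D" and br: "bracket_rule A D" and pr: "product_rule A D"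
begin

lemma D_smooth: "X \<in> vector_fields A \<Longrightarrow> D X \<in> smooth_functions A"
  using lin by (simp add: linear_operator_def)

lemma D_scale: "f \<in> smooth_functions A \<Longrightarrow> X \<in> vector_fields A \<Longrightarrow>
    D (vf_scale f X) p = f p * D X p + vf_apply X f p"
  using pr by (simp add: product_rule_def)

lemma D_bracket: "X \<in> vector_fields A \<Longrightarrow> Y \<in> vector_fields A \<Longrightarrow>
    D (lie_bracket X Y) p = vf_apply X (D Y) p - vf_apply Y (D X) p"
  using br by (simp add: bracket_rule_def)

text \<open>Linearity is given for binary sums; the empty sum is reached as the zero multiple of the
  zero field.\<close>

lemma D_sum:
  assumes "\<And>i. i \<in> I \<Longrightarrow> Z i \<in> vector_fields A" "finite I"
  shows "(\<lambda>p h. \<Sum>i\<in>I. Z i p h) \<in> vector_fields A \<and> D (\<lambda>p h. \<Sum>i\<in>I. Z i p h) = (\<lambda>p. \<Sum>i\<in>I. D (Z i) p)"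
  using assms(2,1)
proof (induction rule: finite_induct)
  case empty
  have 0: "(\<lambda>p h. 0) \<in> vector_fields A"
  proof (rule vector_fieldsI)
    fix p
    obtain c where c: "c \<in> A" "p \<in> fst c" using ex_chart by blast
    then show "\<exists>c\<in>A. p \<in> fst c \<and> (\<exists>\<xi> U. open U \<and> p \<in> U \<and> smooth_at p \<xi> \<and>
      (\<forall>q\<in>U \<inter> fst c. (\<lambda>h. 0) = coord_vector A c q (\<xi> q)))"
      by (intro bexI[of _ c] conjI exI[of _ "\<lambda>_. 0"] exI[of _ UNIV]) (auto simp: coord_vector_zero)
  qed
  moreover have "D (vf_scale (\<lambda>_. 0) (\<lambda>p h. 0)) = (\<lambda>p. 0 * D (\<lambda>p h. 0) p)"
    using lin 0 unfolding linear_operator_def by blast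
  ultimately show ?case by (simp add: vf_scale_def)
next
  case (insert i I)
  have "D (vf_add (Z i) (\<lambda>p h. \<Sum>i\<in>I. Z i p h)) = (\<lambda>p. D (Z i) p + D (\<lambda>p h. \<Sum>i\<in>I. Z i p h) p)"
    using lin insert unfolding linear_operator_def by auto
  moreover have "vf_add (Z i) (\<lambda>p h. \<Sum>i\<in>I. Z i p h) \<in> vector_fields A"
    using insert by (intro vf_add_in) auto
  ultimately show ?case using insert by (simp add: vf_add_def)
qed

text \<open>Locality of \<open>D\<close> and its expansion in a local frame at once:
  \<open>\<phi> X\<close> is globally the combination of the \<open>Y i\<close> whose coefficients
  are \<open>\<phi>\<close> times the components of \<open>X\<close>, and the product rule is
  applied to both sides at \<open>q\<close>. The derivatives of the coefficients sum to
  \<open>coord_div\<close>.\<close>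

lemma local_formula:
  assumes c: "c \<in> A" and N: "open N" "N \<subseteq> fst c" and q: "q \<in> N"
    and Y: "\<And>i. Y i \<in> vector_fields A" "\<And>i q. q \<in> N \<Longrightarrow> vcomp c (Y i) q = axis i 1"
    and X: "X \<in> vector_fields A"
  shows "D X q = coord_div c X q + (\<Sum>i\<in>UNIV. vcomp c X q $ i * D (Y i) q)"
proof -
  have cq: "q \<in> fst c" using N q by auto
  obtain \<phi> M K where *: "\<phi> \<in> smooth_functions A" "open M" "q \<in> M" "M \<subseteq> N" "\<And>q. q \<in> M \<Longrightarrow> \<phi> q = 1"
    "closed K" "K \<subseteq> N" "\<And>q. q \<notin> K \<Longrightarrow> \<phi> q = 0"
    by (rule manifold_bump[OF N(1) q]) blast
  let ?f = "\<lambda>i q. \<phi> q * vcomp c X q $ i"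
  have f: "?f i \<in> smooth_functions A" for i
    by (rule smooth_functions_extend[OF *(1,6,7,8)], assumption)
      (use N c X in \<open>auto intro!: smooth_at_nth smooth_at_vcomp\<close>)
  have eq: "vf_scale \<phi> X = (\<lambda>p h. \<Sum>i\<in>UNIV. vf_scale (?f i) (Y i) p h)"
  proof (intro ext)
    fix r h
    show "vf_scale \<phi> X r h = (\<Sum>i\<in>UNIV. vf_scale (?f i) (Y i) r h)"
    proof (cases "r \<in> N")
      case True
      then have cr: "r \<in> fst c" using N by auto
      have "X r h = (\<Sum>i\<in>UNIV. vcomp c X r $ i * Y i r h)"
      proof (cases "h \<in> smooth_functions A")
        case h: True
        have "X r h = chart_deriv c h r (vcomp c X r)" using vf_apply_chart_deriv[OF X h c cr] by (simp add: vf_apply_def)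
        moreover have "Y i r h = chart_deriv c h r (axis i 1)" for i
          using vf_apply_chart_deriv[OF Y(1) h c cr] Y(2)[OF True] by (simp add: vf_apply_def)
        ultimately show ?thesis using chart_deriv_axis_sum[OF c cr smooth_functionsD[OF h], of "vcomp c X r"] by simp
      next
        case False
        then show ?thesis using tangent_nonsmooth[OF vf_tangent[OF X]] tangent_nonsmooth[OF vf_tangent[OF Y(1)]] by simp
      qed
      then show ?thesis by (simp add: vf_scale_def sum_distrib_left mult.assoc)
    next
      case False
      then have "\<phi> r = 0" using * by blast
      then show ?thesis by (simp add: vf_scale_def)
    qed
  qed
  have near: "chart_deriv c F q v = chart_deriv c G q v" if "\<And>r. r \<in> M \<Longrightarrow> F r = G r" for F G :: "'a \<Rightarrow> real" and v
    by (rule fun_cong[OF chart_deriv_cong[OF c cq *(2,3)]]) (rule that)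
  \<comment> \<open>\<open>\<phi>\<close> is constantly 1 near \<open>q\<close>, so the product rule
    has no extra term there and the cut-off does not change the value at \<open>q\<close>.\<close>
  have "vf_apply X \<phi> q = chart_deriv c (\<lambda>_. 1) q (vcomp c X q)"
    unfolding vf_apply_chart_deriv[OF X *(1) c cq] by (rule near) (use * in auto)
  then have "D (vf_scale \<phi> X) q = D X q"
    using D_scale[OF *(1) X] * by (simp add: chart_deriv_const)
  moreover have "D (vf_scale (?f i) (Y i)) q = vcomp c X q $ i * D (Y i) q + chart_deriv c (vcomp c X) q (axis i 1) $ i" for i
  proof -
    have "vf_apply (Y i) (?f i) q = chart_deriv c (\<lambda>q. vcomp c X q $ i) q (axis i 1)"
      unfolding vf_apply_chart_deriv[OF Y(1) f c cq] Y(2)[OF q] by (rule near) (use * in auto)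
    then show ?thesis
      using D_scale[OF f Y(1)] * chart_deriv_nth[OF c cq smooth_at_vcomp[OF X c cq]] by simp
  qed
  moreover have "D (\<lambda>p h. \<Sum>i\<in>UNIV. vf_scale (?f i) (Y i) p h) q = (\<Sum>i\<in>UNIV. D (vf_scale (?f i) (Y i)) q)"
    using D_sum[of UNIV "\<lambda>i. vf_scale (?f i) (Y i)"] vf_scale_in(1)[OF f Y(1)] by simp
  ultimately show ?thesis unfolding eq by (simp add: sum.distrib coord_div_def)
qed

text \<open>The \<open>i\<close>-th coefficient is the value of \<open>D\<close> on the
  \<open>i\<close>-th coordinate field. As that field becomes global only after a cut-off, a
  separate frame \<open>E p\<close> is chosen for every \<open>p\<close>.\<close>

lemma ex_coeff:
  assumes c: "c \<in> A"
  shows "\<exists>b. has_coeff D c b"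
proof -
  define E where "E p = (SOME Y. \<exists>N. open N \<and> p \<in> N \<and> N \<subseteq> fst c \<and> (\<forall>i. Y i \<in> vector_fields A \<and> (\<forall>q\<in>N. vcomp c (Y i) q = axis i 1)))" for p
  have E: "\<exists>N. open N \<and> p \<in> N \<and> N \<subseteq> fst c \<and> (\<forall>i. E p i \<in> vector_fields A \<and> (\<forall>q\<in>N. vcomp c (E p i) q = axis i 1))"
    if p: "p \<in> fst c" for p
  proof -
    have "\<forall>i. \<exists>X N. X\<in>vector_fields A \<and> open N \<and> p \<in> N \<and> N \<subseteq> fst c \<and> (\<forall>q\<in>N. vcomp c X q = axis i 1)"
      using local_vf[OF c open_chart[OF c] p subset_refl smooth_at_const] by blast
    then obtain Y N where YN: "\<And>i. Y i \<in> vector_fields A \<and> open (N i) \<and> p \<in> N i \<and> N i \<subseteq> fst c \<and> (\<forall>q\<in>N i. vcomp c (Y i) q = axis i 1)"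
      by metis
    have "open (\<Inter>i. N i) \<and> p \<in> (\<Inter>i. N i) \<and> (\<Inter>i. N i) \<subseteq> fst c \<and>
        (\<forall>i. Y i \<in> vector_fields A \<and> (\<forall>q\<in>\<Inter>i. N i. vcomp c (Y i) q = axis i 1))"
      using YN by (intro conjI open_INT finite_class.finite_UNIV) blast+
    then have "\<exists>Y N. open N \<and> p \<in> N \<and> N \<subseteq> fst c \<and> (\<forall>i. Y i \<in> vector_fields A \<and> (\<forall>q\<in>N. vcomp c (Y i) q = axis i 1))"
      by blast
    from someI_ex[OF this] show ?thesis by (simp add: E_def)
  qed
  define b where "b p = (\<chi> i. D (E p i) p)" for p
  have main: "smooth_at p b \<and> (\<forall>u v. chart_deriv c b p u \<bullet> v = chart_deriv c b p v \<bullet> u) \<and>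
      (\<forall>X\<in>vector_fields A. D X p = coord_div c X p + b p \<bullet> vcomp c X p)" if p: "p \<in> fst c" for p
  proof -
    obtain N where N: "open N" "p \<in> N" "N \<subseteq> fst c" and Y: "\<And>i. E p i \<in> vector_fields A"
      and Y1: "\<And>i q. q \<in> N \<Longrightarrow> vcomp c (E p i) q = axis i 1" using E[OF p] by blast
    have near: "chart_deriv c (vcomp c X) q v = 0" if "open M" "q \<in> M" "q \<in> fst c" "\<And>r. r \<in> M \<Longrightarrow> vcomp c X r = a" for X M q v a
      using fun_cong[OF chart_deriv_cong[OF c that(3,1,2), of "vcomp c X" "\<lambda>_. a"], of v] that(4) by (simp add: chart_deriv_const)
    \<comment> \<open>Frames chosen at different points give the same values of \<open>D\<close>
      where both are coordinate fields. Near \<open>p\<close> the coefficients thus come from the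
      single frame \<open>E p\<close>, which makes them smooth.\<close>
    have b: "b q = (\<chi> i. D (E p i) q)" if q: "q \<in> N" for q
    proof -
      have cq: "q \<in> fst c" using q N by auto
      obtain M where M: "open M" "q \<in> M" and Z: "\<And>i. E q i \<in> vector_fields A"
        and Z1: "\<And>i r. r \<in> M \<Longrightarrow> vcomp c (E q i) r = axis i 1" using E[OF cq] by blast
      have "D (E q i) q = D (E p i) q" for i
      proof -
        have "coord_div c (E q i) q = 0" using near[OF M cq Z1] by (simp add: coord_div_def)
        moreover have "(\<Sum>j\<in>UNIV. axis i (1::real) $ j * D (E p j) q) = D (E p i) q"
          by (simp add: axis_def if_distrib[of "\<lambda>x. x * _"] cong: if_cong)
        ultimately show ?thesis
          using local_formula[OF c N(1,3) q Y Y1 Z] Z1[OF M(2)] by simp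
      qed
      then show ?thesis by (simp add: b_def)
    qed
    have sN: "smooth_at p (\<lambda>q. \<chi> i. D (E p i) q)"
      by (rule smooth_at_vec) (simp add: smooth_functionsD D_smooth Y)
    have sb: "smooth_at p b"
      by (rule smooth_at_cong[OF N(1,2) _ sN]) (simp add: b)
    have M: "chart_deriv c b p (axis i 1) $ j = vf_apply (E p i) (D (E p j)) p" for i j
    proof -
      have "chart_deriv c b p (axis i 1) $ j = chart_deriv c (\<lambda>q. b q $ j) p (axis i 1)"
        using chart_deriv_nth[OF c p sb] by simp
      also have "\<dots> = chart_deriv c (D (E p j)) p (axis i 1)"
        by (rule fun_cong[OF chart_deriv_cong[OF c p N(1,2)]]) (simp add: b)
      also have "\<dots> = vf_apply (E p i) (D (E p j)) p"
        using vf_apply_chart_deriv[OF Y D_smooth[OF Y] c p] Y1[OF N(2)] by simp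
      finally show ?thesis .
    qed
    \<comment> \<open>The coordinate fields commute near \<open>p\<close>, so \<open>D\<close>
      vanishes at \<open>p\<close> on their bracket, and the bracket rule becomes the symmetry of
      the derivative of \<open>b\<close>.\<close>
    have Msym: "chart_deriv c b p (axis i 1) $ j = chart_deriv c b p (axis j 1) $ i" for i j
    proof -
      let ?Z = "lie_bracket (E p i) (E p j)"
      have Z: "?Z \<in> vector_fields A" by (rule lie_bracket_in[OF Y Y])
      have Z0: "vcomp c ?Z q = 0" if q: "q \<in> N" for q
        using near[OF N(1) q _ Y1] q N(3) vcomp_bracket[OF Y Y c, of q i j] by (simp add: subset_iff)
      have "D ?Z p = 0"
        using local_formula[OF c N(1,3,2) Y Y1 Z] near[OF N(1,2) p Z0] Z0[OF N(2)] by (simp add: coord_div_def)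
      then show ?thesis using D_bracket[OF Y Y, of i j p] by (simp add: M)
    qed
    have bil: "chart_deriv c b p u \<bullet> v = (\<Sum>j\<in>UNIV. \<Sum>i\<in>UNIV. u $ i * v $ j * chart_deriv c b p (axis i 1) $ j)" for u v
      using chart_deriv_axis_sum[OF c p sb, of u] by (simp add: inner_vec_def sum_distrib_left mult_ac)
    have "chart_deriv c b p u \<bullet> v = chart_deriv c b p v \<bullet> u" for u v
      unfolding bil by (subst sum.swap) (simp add: Msym mult_ac)
    moreover have "D X p = coord_div c X p + b p \<bullet> vcomp c X p" if "X \<in> vector_fields A" for X
      using local_formula[OF c N(1,3,2) Y Y1 that] by (simp add: b[OF N(2)] inner_vec_def mult.commute)
    ultimately show ?thesis using sb by blast
  qed
  then have "has_coeff D c b" by (auto simp: has_coeff_def)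
  then show ?thesis by blast
qed

definition dcoeff :: "('a, 'n) chart \<Rightarrow> 'a \<Rightarrow> real^'n" where
  "dcoeff c = (SOME b. has_coeff D c b)"

lemma has_coeff_dcoeff: "c \<in> A \<Longrightarrow> has_coeff D c (dcoeff c)"
  unfolding dcoeff_def using someI_ex[OF ex_coeff] .

lemma D_coeff: "c \<in> A \<Longrightarrow> X \<in> vector_fields A \<Longrightarrow> p \<in> fst c \<Longrightarrow> D X p = coord_div c X p + dcoeff c p \<bullet> vcomp c X p"
  using has_coeff_dcoeff unfolding has_coeff_def by blast

text \<open>The coefficients are closed, so the Poincare lemma applies to them on a ball in the
  chart image, where convexity is available.\<close>

lemma local_potential:
  assumes c: "c \<in> A" "p \<in> fst c"
  shows "\<exists>e>0. ball (snd c p) e \<subseteq> chart_image c \<and> (\<exists>L. \<forall>q\<in>fst c \<inter> snd c -` ball (snd c p) e.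
    smooth_at q L \<and> (\<forall>v. chart_deriv c L q v = dcoeff c q \<bullet> v))"
proof -
  let ?b = "\<lambda>x. dcoeff c (chart_inv c x)"
  obtain e where e: "e > 0" "ball (snd c p) e \<subseteq> chart_image c"
    using open_chart_image[OF c(1)] snd_in[OF c] open_contains_ball by blast
  let ?B = "ball (snd c p) e"
  have B: "open ?B" "convex ?B" "snd c p \<in> ?B" using e by auto
  have hc: "\<forall>p\<in>fst c. smooth_at p (dcoeff c)" "\<And>p u v. p \<in> fst c \<Longrightarrow> chart_deriv c (dcoeff c) p u \<bullet> v = chart_deriv c (dcoeff c) p v \<bullet> u"
    using has_coeff_dcoeff[OF c(1)] unfolding has_coeff_def by blast+
  have "smooth_on (chart_image c) ?b" using smooth_on_chart_iff[OF c(1), of "dcoeff c"] hc(1) by blast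
  then have sb: "smooth_on ?B ?b" by (rule smooth_on_subset[OF _ e(2)])
  have sym: "frechet_derivative ?b (at x) u \<bullet> v = frechet_derivative ?b (at x) v \<bullet> u" if "x \<in> ?B" for x u v
  proof -
    have x: "x \<in> chart_image c" using that e by blast
    show ?thesis using hc(2)[OF chart_inv_in[OF c(1) x], of u v] by (simp add: chart_deriv_def snd_chart_inv[OF c(1) x])
  qed
  obtain h where h: "smooth_on ?B h" "\<And>x. x \<in> ?B \<Longrightarrow> (h has_derivative (\<lambda>v. ?b x \<bullet> v)) (at x)"
    by (rule poincare[OF B sb sym]) (assumption, rule that)
  let ?L = "\<lambda>q. h (snd c q)"
  have "smooth_at q ?L \<and> (\<forall>v. chart_deriv c ?L q v = dcoeff c q \<bullet> v)" if q: "q \<in> fst c \<inter> snd c -` ?B" for q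
  proof
    show "smooth_at q ?L" using q by (intro smooth_at_coord[OF c(1) _ B(1) _ h(1)]) auto
    have "((\<lambda>x. h (snd c (chart_inv c x))) has_derivative (\<lambda>v. dcoeff c q \<bullet> v)) (at (snd c q))"
    proof (rule has_derivative_transform_within_open[OF _ B(1)])
      show "(h has_derivative (\<lambda>v. dcoeff c q \<bullet> v)) (at (snd c q))"
        using h(2)[of "snd c q"] q chart_inv_snd[OF c(1), of q] by simp
      show "h x = h (snd c (chart_inv c x))" if "x \<in> ?B" for x using that e snd_chart_inv[OF c(1), of x] by auto
    qed (use q in auto)
    then show "\<forall>v. chart_deriv c ?L q v = dcoeff c q \<bullet> v" by (intro allI chart_deriv_eqI)
  qed
  then show ?thesis using e by blast
qed

text \<open>The transformation law of the coefficients follows by comparing, in the two charts, the local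
  formula for the divergence of the top form that is \<open>exp L dx\<close> near \<open>p\<close> in the chart \<open>d\<close>.\<close>

lemma potential_change:
  assumes d: "d \<in> A" and U: "open U" "U \<subseteq> fst d"
    and L: "\<And>q. q \<in> U \<Longrightarrow> smooth_at q L" "\<And>q v. q \<in> U \<Longrightarrow> chart_deriv d L q v = dcoeff d q \<bullet> v"
    and c: "c \<in> A" and p: "p \<in> U" "p \<in> fst c"
  shows "chart_deriv c (\<lambda>q. L q + ln \<bar>jac c d q\<bar>) p v = dcoeff c p \<bullet> v"
proof -
  obtain \<phi> N K where *: "\<phi> \<in> smooth_functions A" "open N" "p \<in> N" "N \<subseteq> U" "\<And>q. q \<in> N \<Longrightarrow> \<phi> q = 1"
    "closed K" "K \<subseteq> U" "\<And>q. q \<notin> K \<Longrightarrow> \<phi> q = 0"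
    by (rule manifold_bump[OF U(1) p(1)]) blast
  \<comment> \<open>The component in the chart \<open>e\<close> of the form that is
    \<open>\<phi> exp L dx\<close> in \<open>d\<close>. The cut-off makes it global; near
    \<open>p\<close>, where \<open>\<phi>\<close> is 1, it is nonzero.\<close>
  define \<rho> where "\<rho> e q = (if q \<in> U then \<phi> q * exp (L q) * jac e d q else 0)" for e q
  have compat: "\<rho> c q = jac c e q * \<rho> e q" if "c \<in> A" "e \<in> A" "q \<in> fst c" "q \<in> fst e" for c e q
    using that U jac_compose[of c e d q] d by (auto simp: \<rho>_def)
  have smooth: "smooth_at q (\<rho> e)" if e: "e \<in> A" "q \<in> fst e" for e q
  proof (cases "q \<in> U")
    case True
    have "smooth_at q (\<lambda>q. \<phi> q * exp (L q) * jac e d q)"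
      using True U by (intro smooth_at_mult smooth_at_exp smooth_functionsD[OF *(1)] L(1) smooth_at_jac e d) auto
    then show ?thesis
      by (rule smooth_at_cong[OF U(1) True, rotated]) (simp add: \<rho>_def)
  next
    case False
    then have q: "q \<in> - K" "open (- K)" using * by auto
    show ?thesis
      by (rule smooth_at_cong[OF q(2,1) _ smooth_at_const[of q 0]]) (simp add: \<rho>_def *(8))
  qed
  note form = form_of[of \<rho>, OF compat smooth]
  let ?\<Omega> = "form_of \<rho>"
  have dN: "density ?\<Omega> e q = exp (L q) * jac e d q" if "e \<in> A" "q \<in> fst e" "q \<in> N" for e q
    using that * form(2)[OF _ _ _ _ _ _ that(1,2)] by (auto simp: \<rho>_def)
  have pd: "p \<in> fst d" using p U by auto
  have loc: "chart_deriv e (\<lambda>q. ln \<bar>density ?\<Omega> e q\<bar>) p w = chart_deriv e (\<lambda>q. L q + ln \<bar>jac e d q\<bar>) p w" if e: "e \<in> A" "p \<in> fst e" for e w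
  proof (rule fun_cong[OF chart_deriv_cong[OF e]])
    show "open (N \<inter> fst e)" "p \<in> N \<inter> fst e" using * e by (auto intro: open_Int open_chart)
    fix q assume q: "q \<in> N \<inter> fst e"
    then have "jac e d q \<noteq> 0" using * U e d by (intro jac_nonzero) auto
    then show "ln \<bar>density ?\<Omega> e q\<bar> = L q + ln \<bar>jac e d q\<bar>" using q dN[OF e(1)] by (simp add: abs_mult ln_mult)
  qed
  \<comment> \<open>In \<open>d\<close> itself the Jacobian is 1, so the logarithmic derivative at
    \<open>p\<close> is that of \<open>L\<close>, the coefficient of \<open>D\<close>: the
    divergence of the form at \<open>p\<close> is \<open>D X p\<close>.\<close>
  have dd: "chart_deriv d (\<lambda>q. L q + ln \<bar>jac d d q\<bar>) p w = dcoeff d p \<bullet> w" for w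
  proof -
    have "chart_deriv d (\<lambda>q. L q + ln \<bar>jac d d q\<bar>) p w = chart_deriv d L p w"
      by (rule fun_cong[OF chart_deriv_cong[OF d pd open_chart[OF d] pd]]) (simp add: jac_self[OF d])
    then show ?thesis using L(2)[OF p(1)] by simp
  qed
  obtain X where X: "X \<in> vector_fields A" "vcomp c X p = v"
    using local_vf[OF c open_chart[OF c] p(2) subset_refl smooth_at_const[of _ v]] by blast
  have nz: "density ?\<Omega> c p \<noteq> 0" using dN[OF c p(2) *(3)] jac_nonzero[OF c d p(2) pd] by simp
  have "?\<Omega> \<in> differential_forms A" by (rule form(1))
  from local_divergence_unique[OF this X(1) c p(2) d pd nz]
  have "coord_div c X p + chart_deriv c (\<lambda>q. L q + ln \<bar>jac c d q\<bar>) p v = D X p"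
    by (simp add: loc c p d pd dd X(2) D_coeff[OF d X(1) pd])
  then show ?thesis using D_coeff[OF c X(1) p(2)] X(2) by simp
qed

text \<open>The common end of both existence proofs: components whose logarithmic derivatives are
  the coefficients of \<open>D\<close> assemble to a form with the same local formula as
  \<open>D\<close>.\<close>

lemma volume_form_from_densities:
  assumes compat: "\<And>c d p. c \<in> A \<Longrightarrow> d \<in> A \<Longrightarrow> p \<in> fst c \<Longrightarrow> p \<in> fst d \<Longrightarrow> \<rho> c p = jac c d p * \<rho> d p"
    and smooth: "\<And>c p. c \<in> A \<Longrightarrow> p \<in> fst c \<Longrightarrow> smooth_at p (\<rho> c)"
    and nz: "\<And>c p. c \<in> A \<Longrightarrow> p \<in> fst c \<Longrightarrow> \<rho> c p \<noteq> 0"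
    and pot: "\<And>c p v. c \<in> A \<Longrightarrow> p \<in> fst c \<Longrightarrow> chart_deriv c (\<lambda>q. ln \<bar>\<rho> c q\<bar>) p v = dcoeff c p \<bullet> v"
  shows "\<exists>\<Omega>. volume_form A \<Omega> \<and> (\<forall>X\<in>vector_fields A. D X = divergence A \<Omega> X)"
proof (intro exI conjI ballI ext)
  note form = form_of[of \<rho>, OF compat smooth]
  show v: "volume_form A (form_of \<rho>)" unfolding volume_form_iff using form nz by simp
  fix X p assume X: "X \<in> vector_fields A"
  obtain c where c: "c \<in> A" "p \<in> fst c" using ex_chart by blast
  have "chart_deriv c (\<lambda>q. ln \<bar>density (form_of \<rho>) c q\<bar>) p w = chart_deriv c (\<lambda>q. ln \<bar>\<rho> c q\<bar>) p w" for w
    by (rule fun_cong[OF chart_deriv_cong[OF c open_chart[OF c(1)] c(2)]]) (use form(2) c(1) in simp)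
  then show "D X p = divergence A (form_of \<rho>) X p"
    using divergence_density(2)[OF v X c] D_coeff[OF c(1) X c(2)] pot[OF c] by simp
qed

end

section \<open>Local systems on simply connected spaces\<close>

text \<open>A local system of rank one: the nonzero functions \<open>\<omega> i\<close> trivialise it over the members of
  an open cover, with locally constant transition functions.\<close>

locale local_system =
  fixes I :: "'i set" and W :: "'i \<Rightarrow> 'a::topological_space set" and \<omega> :: "'i \<Rightarrow> 'a \<Rightarrow> real"
  assumes open_W: "i \<in> I \<Longrightarrow> open (W i)"
    and cover: "\<exists>i\<in>I. x \<in> W i"
    and nz: "i \<in> I \<Longrightarrow> x \<in> W i \<Longrightarrow> \<omega> i x \<noteq> 0"
    and trans: "i \<in> I \<Longrightarrow> j \<in> I \<Longrightarrow> x \<in> W i \<Longrightarrow> x \<in> W j \<Longrightarrow>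
      \<exists>V c. open V \<and> x \<in> V \<and> (\<forall>y\<in>V. \<omega> i y = c * \<omega> j y)"
begin

text \<open>\<open>u\<close> is a flat section of the pullback of the local system along \<open>F\<close>.\<close>

definition flat :: "'k::topological_space set \<Rightarrow> ('k \<Rightarrow> 'a) \<Rightarrow> ('k \<Rightarrow> real) \<Rightarrow> bool" where
  "flat K F u \<longleftrightarrow> (\<forall>k\<in>K. u k \<noteq> 0 \<and> (\<exists>i\<in>I. F k \<in> W i \<and>
     (\<exists>N c. open N \<and> k \<in> N \<and> (\<forall>l\<in>N \<inter> K. u l = c * \<omega> i (F l)))))"

lemma flat_nonzero: "flat K F u \<Longrightarrow> k \<in> K \<Longrightarrow> u k \<noteq> 0"
  by (simp add: flat_def)

text \<open>The definition provides one index at each point; locally constant transition functions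
  allow any other index \<open>j\<close> there.\<close>

lemma flat_local:
  assumes F: "continuous_on K F" and u: "flat K F u" and k: "k \<in> K" and j: "j \<in> I" "F k \<in> W j"
  shows "\<exists>N c. open N \<and> k \<in> N \<and> (\<forall>l\<in>N \<inter> K. F l \<in> W j \<and> u l = c * \<omega> j (F l))"
proof -
  obtain i N c where i: "i \<in> I" "F k \<in> W i" and N: "open N" "k \<in> N" "\<forall>l\<in>N \<inter> K. u l = c * \<omega> i (F l)"
    using u k unfolding flat_def by meson
  obtain V e where V: "open V" "F k \<in> V" "\<forall>y\<in>V. \<omega> i y = e * \<omega> j y" using trans[OF i(1) j(1) i(2) j(2)] by blast
  have "open (V \<inter> W j)" "F k \<in> V \<inter> W j" using V j open_W by auto
  then obtain M where M: "open M" "k \<in> M" "\<forall>l\<in>K. l \<in> M \<longrightarrow> F l \<in> V \<inter> W j"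
    using F k unfolding continuous_on_topological by meson
  show ?thesis
    by (rule exI[of _ "N \<inter> M"], rule exI[of _ "c * e"]) (use N M V in auto)
qed

lemma flat_cong:
  assumes "\<And>k. k \<in> K \<Longrightarrow> F k = G k" "flat K F u"
  shows "flat K G u"
  using assms unfolding flat_def by (metis IntD2)

lemma flat_cmult:
  assumes "flat K F u" "c \<noteq> 0"
  shows "flat K F (\<lambda>k. c * u k)"
  unfolding flat_def
proof (intro ballI conjI)
  fix k assume k: "k \<in> K"
  show "c * u k \<noteq> 0" using assms k flat_nonzero by auto
  obtain i N d where i: "i \<in> I" "F k \<in> W i" and N: "open N" "k \<in> N" "\<forall>l\<in>N \<inter> K. u l = d * \<omega> i (F l)"
    using assms(1) k unfolding flat_def by meson
  then have "\<forall>l\<in>N \<inter> K. c * u l = (c * d) * \<omega> i (F l)" by auto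
  then show "\<exists>i\<in>I. F k \<in> W i \<and> (\<exists>N d. open N \<and> k \<in> N \<and> (\<forall>l\<in>N \<inter> K. c * u l = d * \<omega> i (F l)))"
    using i N(1,2) by blast
qed

lemma flat_pullback:
  assumes "flat K F u" "continuous_on L \<phi>" "\<phi> ` L \<subseteq> K"
  shows "flat L (\<lambda>l. F (\<phi> l)) (\<lambda>l. u (\<phi> l))"
  unfolding flat_def
proof (intro ballI conjI)
  fix l assume l: "l \<in> L"
  then have k: "\<phi> l \<in> K" using assms by auto
  show "u (\<phi> l) \<noteq> 0" by (rule flat_nonzero[OF assms(1) k])
  obtain i N d where i: "i \<in> I" "F (\<phi> l) \<in> W i" and N: "open N" "\<phi> l \<in> N" "\<forall>l\<in>N \<inter> K. u l = d * \<omega> i (F l)"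
    using assms(1) k unfolding flat_def by meson
  obtain M where M: "open M" "l \<in> M" "\<forall>m\<in>L. m \<in> M \<longrightarrow> \<phi> m \<in> N"
    using assms(2) l N unfolding continuous_on_topological by meson
  have "\<forall>m\<in>M \<inter> L. u (\<phi> m) = d * \<omega> i (F (\<phi> m))" using M N assms(3) by auto
  then show "\<exists>i\<in>I. F (\<phi> l) \<in> W i \<and> (\<exists>N d. open N \<and> l \<in> N \<and> (\<forall>l\<in>N \<inter> L. u (\<phi> l) = d * \<omega> i (F (\<phi> l))))"
    using i M(1,2) by blast
qed

lemma flat_single:
  assumes "i \<in> I" "F ` K \<subseteq> W i"
  shows "flat K F (\<lambda>k. \<omega> i (F k))"
  unfolding flat_def
proof (intro ballI conjI)
  fix k assume k: "k \<in> K"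
  show "\<omega> i (F k) \<noteq> 0" using assms k nz by auto
  have "\<forall>l\<in>UNIV \<inter> K. \<omega> i (F l) = 1 * \<omega> i (F l)" by simp
  then show "\<exists>j\<in>I. F k \<in> W j \<and> (\<exists>N c. open N \<and> k \<in> N \<and> (\<forall>l\<in>N \<inter> K. \<omega> i (F l) = c * \<omega> j (F l)))"
    using assms k open_UNIV by blast
qed

text \<open>Over one trivialisation both sections are constant multiples of the same
  \<open>\<omega> i\<close>, so their quotient is locally constant.\<close>

lemma flat_unique:
  assumes K: "connected K" and F: "continuous_on K F" and u: "flat K F u" and v: "flat K F v"
    and ab: "a \<in> K" "b \<in> K"
  shows "v a / u a = v b / u b"
proof (rule connected_local_const[OF K ab])
  show "\<forall>a\<in>K. eventually (\<lambda>b. v a / u a = v b / u b) (at a within K)"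
  proof
    fix k assume k: "k \<in> K"
    obtain i where i: "i \<in> I" "F k \<in> W i" using cover by blast
    obtain N c where N: "open N" "k \<in> N" "\<forall>l\<in>N \<inter> K. F l \<in> W i \<and> u l = c * \<omega> i (F l)"
      using flat_local[OF F u k i] by blast
    obtain M d where M: "open M" "k \<in> M" "\<forall>l\<in>M \<inter> K. F l \<in> W i \<and> v l = d * \<omega> i (F l)"
      using flat_local[OF F v k i] by blast
    have "v l / u l = d / c" if "l \<in> N \<inter> M \<inter> K" for l
      using that N M nz[OF i(1), of "F l"] by simp
    then have "v k / u k = v l / u l" if "l \<in> N \<inter> M \<inter> K" for l
      using that N(2) M(2) k by (metis IntI)
    moreover have "open (N \<inter> M)" "k \<in> N \<inter> M" using N M by auto
    ultimately show "eventually (\<lambda>b. v k / u k = v b / u b) (at k within K)"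
      unfolding eventually_at_topological by blast
  qed
qed

text \<open>A point in only one of the sets has a neighbourhood that misses the other, since that
  one is closed. At a common point the constants of both sides coincide, because
  \<open>\<omega> i\<close> does not vanish.\<close>

lemma flat_glue:
  assumes cl: "closed K" "closed L" and F: "continuous_on (K \<union> L) F"
    and u: "flat K F u" and v: "flat L F v" and eq: "\<And>k. k \<in> K \<Longrightarrow> k \<in> L \<Longrightarrow> u k = v k"
  shows "flat (K \<union> L) F (\<lambda>k. if k \<in> K then u k else v k)" (is "flat _ _ ?w")
  unfolding flat_def
proof (intro ballI conjI)
  have FK: "continuous_on K F" and FL: "continuous_on L F" using F continuous_on_subset by blast+
  fix k assume k: "k \<in> K \<union> L"
  show "?w k \<noteq> 0" using k flat_nonzero[OF u] flat_nonzero[OF v] by auto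
  obtain i where i: "i \<in> I" "F k \<in> W i" using cover by blast
  have "\<exists>N c. open N \<and> k \<in> N \<and> (\<forall>l\<in>N \<inter> (K \<union> L). ?w l = c * \<omega> i (F l))"
  proof (cases "k \<in> K")
    case kK: True
    obtain N c where N: "open N" "k \<in> N" "\<forall>l\<in>N \<inter> K. F l \<in> W i \<and> u l = c * \<omega> i (F l)"
      using flat_local[OF FK u kK i] by blast
    show ?thesis
    proof (cases "k \<in> L")
      case kL: True
      obtain M d where M: "open M" "k \<in> M" "\<forall>l\<in>M \<inter> L. F l \<in> W i \<and> v l = d * \<omega> i (F l)"
        using flat_local[OF FL v kL i] by blast
      have "c * \<omega> i (F k) = d * \<omega> i (F k)" using N M kK kL eq[of k] by auto
      then have "c = d" using nz[OF i] by simp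
      then show ?thesis using N M by (intro exI[of _ "N \<inter> M"] exI[of _ c]) auto
    next
      case False
      then show ?thesis using N cl by (intro exI[of _ "N \<inter> - L"] exI[of _ c]) auto
    qed
  next
    case False
    then have kL: "k \<in> L" using k by auto
    obtain M d where M: "open M" "k \<in> M" "\<forall>l\<in>M \<inter> L. F l \<in> W i \<and> v l = d * \<omega> i (F l)"
      using flat_local[OF FL v kL i] by blast
    then show ?thesis using cl False by (intro exI[of _ "M \<inter> - K"] exI[of _ d]) auto
  qed
  then show "\<exists>i\<in>I. F k \<in> W i \<and> (\<exists>N c. open N \<and> k \<in> N \<and> (\<forall>l\<in>N \<inter> (K \<union> L). ?w l = c * \<omega> i (F l)))"
    using i by blast
qed

text \<open>On the connected intersection the two sections are proportional; rescaling the second by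
  the ratio at \<open>x\<close> makes them agree.\<close>

lemma flat_glue_connected:
  assumes cl: "closed K" "closed L" and con: "connected (K \<inter> L)" "x \<in> K" "x \<in> L"
    and F: "continuous_on (K \<union> L) F" and u: "flat K F u" and v: "flat L F v"
  shows "flat (K \<union> L) F (\<lambda>k. if k \<in> K then u k else u x / v x * v k)"
proof (rule flat_glue[OF cl F u flat_cmult[OF v]])
  show "u x / v x \<noteq> 0" using flat_nonzero[OF u con(2)] flat_nonzero[OF v con(3)] by simp
  fix k assume k: "k \<in> K" "k \<in> L"
  have sub: "flat (K \<inter> L) F u" "flat (K \<inter> L) F v"
    using flat_pullback[OF u, of "K \<inter> L" "\<lambda>x. x"] flat_pullback[OF v, of "K \<inter> L" "\<lambda>x. x"] by auto
  have "continuous_on (K \<inter> L) F" by (rule continuous_on_subset[OF F]) auto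
  from flat_unique[OF con(1) this sub(2,1), of x k] con k
  show "u k = u x / v x * v k" using flat_nonzero[OF v k(2)] by (simp add: field_simps)
qed

text \<open>Flat sections exist over small rectangles and are extended to the square by bisection,
  in one coordinate after the other. \<open>G\<close> lives on the whole plane so that intervals
  around a boundary point need no truncation.\<close>

lemma ex_flat_square:
  fixes G :: "real \<times> real \<Rightarrow> 'a"
  assumes G: "continuous_on UNIV G"
  shows "\<exists>u. flat ({0..1} \<times> {0..1}) G u"
proof -
  have GS: "continuous_on S G" for S using G continuous_on_subset by blast
  have loc: "\<exists>e>0. \<forall>a b c d. a \<le> x \<and> x \<le> b \<and> b - a < e \<and> c \<le> y \<and> y \<le> d \<and> d - c < e \<longrightarrow>
      (\<exists>u. flat ({a..b} \<times> {c..d}) G u)" for x y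
  proof -
    obtain i where i: "i \<in> I" "G (x, y) \<in> W i" using cover by blast
    obtain V where V: "open V" "(x, y) \<in> V" "\<forall>z. z \<in> V \<longrightarrow> G z \<in> W i"
      using G i open_W unfolding continuous_on_topological by (metis UNIV_I)
    obtain S T where ST: "open S" "x \<in> S" "open T" "y \<in> T" "S \<times> T \<subseteq> V"
      using V by (auto elim!: open_prod_elim)
    obtain e1 where e1: "e1 > 0" "ball x e1 \<subseteq> S" using ST open_contains_ball by blast
    obtain e2 where e2: "e2 > 0" "ball y e2 \<subseteq> T" using ST open_contains_ball by blast
    have "\<exists>u. flat ({a..b} \<times> {c..d}) G u"
      if "a \<le> x \<and> x \<le> b \<and> b - a < min e1 e2 \<and> c \<le> y \<and> y \<le> d \<and> d - c < min e1 e2" for a b c d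
    proof -
      have "{a..b} \<subseteq> ball x e1" "{c..d} \<subseteq> ball y e2" using that by (auto simp: dist_real_def)
      then have "{a..b} \<times> {c..d} \<subseteq> V" using e1 e2 ST by blast
      then have "G ` ({a..b} \<times> {c..d}) \<subseteq> W i" using V by auto
      then show ?thesis using flat_single[OF i(1)] by blast
    qed
    then show ?thesis using e1 e2 by (intro exI[of _ "min e1 e2"]) auto
  qed
  \<comment> \<open>Bisection in the second coordinate: thin strips around \<open>x\<close> carry a
    flat section over their full height. The admissible width shrinks with each gluing, hence the
    quantified \<open>e\<close>.\<close>
  have strip: "\<exists>e>0. \<forall>a b. a \<le> x \<and> x \<le> b \<and> b - a < e \<longrightarrow> (\<exists>u. flat ({a..b} \<times> {0..1}) G u)" for x
  proof (rule Bolzano[of 0 1 "\<lambda>c d. \<exists>e>0. \<forall>a b. a \<le> x \<and> x \<le> b \<and> b - a < e \<longrightarrow> (\<exists>u. flat ({a..b} \<times> {c..d}) G u)"])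
    fix c d f :: real
    assume 1: "\<exists>e>0. \<forall>a b. a \<le> x \<and> x \<le> b \<and> b - a < e \<longrightarrow> (\<exists>u. flat ({a..b} \<times> {c..d}) G u)"
      and 2: "\<exists>e>0. \<forall>a b. a \<le> x \<and> x \<le> b \<and> b - a < e \<longrightarrow> (\<exists>u. flat ({a..b} \<times> {d..f}) G u)"
      and cd: "c \<le> d" "d \<le> f"
    obtain e1 where e1: "e1 > 0" "\<And>a b. a \<le> x \<and> x \<le> b \<and> b - a < e1 \<Longrightarrow> \<exists>u. flat ({a..b} \<times> {c..d}) G u" using 1 by blast
    obtain e2 where e2: "e2 > 0" "\<And>a b. a \<le> x \<and> x \<le> b \<and> b - a < e2 \<Longrightarrow> \<exists>u. flat ({a..b} \<times> {d..f}) G u" using 2 by blast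
    have "\<exists>u. flat ({a..b} \<times> {c..f}) G u" if ab: "a \<le> x \<and> x \<le> b \<and> b - a < min e1 e2" for a b
    proof -
      obtain u v where u: "flat ({a..b} \<times> {c..d}) G u" and v: "flat ({a..b} \<times> {d..f}) G v"
        using e1(2)[of a b] e2(2)[of a b] ab by auto
      have int: "{a..b} \<times> {c..d} \<inter> {a..b} \<times> {d..f} = {a..b} \<times> {d}" using cd by auto
      have un: "{a..b} \<times> {c..d} \<union> {a..b} \<times> {d..f} = {a..b} \<times> {c..f}" using cd by auto
      have "connected ({a..b} \<times> {d})" by (intro connected_Times) auto
      from flat_glue_connected[of "{a..b} \<times> {c..d}" "{a..b} \<times> {d..f}" "(x, d)", OF _ _ _ _ _ GS u v, unfolded int un, OF _ _ this] ab cd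
      show ?thesis by (auto simp: closed_Times)
    qed
    then show "\<exists>e>0. \<forall>a b. a \<le> x \<and> x \<le> b \<and> b - a < e \<longrightarrow> (\<exists>u. flat ({a..b} \<times> {c..f}) G u)"
      using e1(1) e2(1) by (intro exI[of _ "min e1 e2"]) auto
  next
    fix y :: real
    obtain e where "e > 0" "\<And>a b c d. a \<le> x \<and> x \<le> b \<and> b - a < e \<and> c \<le> y \<and> y \<le> d \<and> d - c < e \<Longrightarrow>
      \<exists>u. flat ({a..b} \<times> {c..d}) G u" using loc[of x y] by blast
    then show "\<exists>d>0. \<forall>a b. a \<le> y \<and> y \<le> b \<and> b - a < d \<longrightarrow>
        (\<exists>e>0. \<forall>a' b'. a' \<le> x \<and> x \<le> b' \<and> b' - a' < e \<longrightarrow> (\<exists>u. flat ({a'..b'} \<times> {a..b}) G u))"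
      by (intro exI[of _ e]) auto
  qed simp
  \<comment> \<open>Bisection in the first coordinate; neighbouring strips meet in a segment, which
    is connected.\<close>
  show ?thesis
  proof (rule Bolzano[of 0 1 "\<lambda>a b. \<exists>u. flat ({a..b} \<times> {0..1}) G u"])
    fix a b c :: real
    assume 1: "\<exists>u. flat ({a..b} \<times> {0..1}) G u" and 2: "\<exists>u. flat ({b..c} \<times> {0..1}) G u" and abc: "a \<le> b" "b \<le> c"
    obtain u v where u: "flat ({a..b} \<times> {0..1}) G u" and v: "flat ({b..c} \<times> {0..1}) G v" using 1 2 by blast
    have int: "{a..b} \<times> {0..1::real} \<inter> {b..c} \<times> {0..1} = {b} \<times> {0..1}" using abc by auto
    have un: "{a..b} \<times> {0..1::real} \<union> {b..c} \<times> {0..1} = {a..c} \<times> {0..1}" using abc by auto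
    have "connected ({b} \<times> {0..1::real})" by (intro connected_Times) auto
    from flat_glue_connected[of "{a..b} \<times> {0..1}" "{b..c} \<times> {0..1}" "(b, 0)", OF _ _ _ _ _ GS u v, unfolded int un, OF _ _ this] abc
    show "\<exists>u. flat ({a..c} \<times> {0..1}) G u" by (auto simp: closed_Times)
  qed (use strip in auto)
qed

lemma ex_flat_square_on:
  fixes H :: "real \<times> real \<Rightarrow> 'a"
  assumes H: "continuous_on ({0..1} \<times> {0..1}) H"
  shows "\<exists>u. flat ({0..1} \<times> {0..1}) H u"
proof -
  \<comment> \<open>Clamping both coordinates retracts the plane onto the square and so extends
    \<open>H\<close>.\<close>
  let ?k = "\<lambda>z :: real \<times> real. (max 0 (min 1 (fst z)), max 0 (min 1 (snd z)))"
  have "continuous_on UNIV (\<lambda>z. H (?k z))"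
    by (rule continuous_on_compose2[OF H]) (auto intro!: continuous_intros)
  then obtain u where "flat ({0..1} \<times> {0..1}) (\<lambda>z. H (?k z)) u" using ex_flat_square by blast
  then have "flat ({0..1} \<times> {0..1}) H u" by (rule flat_cong[rotated]) auto
  then show ?thesis by blast
qed

text \<open>A path gives a square that is constant in the second coordinate; restricting a flat
  section to an edge and rescaling yields the normalised section.\<close>

lemma ex_flat_path:
  assumes "path \<gamma>"
  obtains u where "flat {0..1} \<gamma> u" "u 0 = 1"
proof -
  have "continuous_on ({0..1} \<times> {0..1}) (\<lambda>z :: real \<times> real. \<gamma> (fst z))"
    by (rule continuous_on_compose2[of "{0..1}" \<gamma>]) (use assms in \<open>auto simp: path_def intro!: continuous_intros\<close>)
  then obtain u where u: "flat ({0..1} \<times> {0..1}) (\<lambda>z :: real \<times> real. \<gamma> (fst z)) u" using ex_flat_square_on by blast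
  have "flat {0..1} \<gamma> (\<lambda>t. u (t, 0))"
    by (rule flat_cong[OF _ flat_pullback[OF u, of "{0..1}" "\<lambda>t. (t, 0)"]]) (auto intro!: continuous_intros)
  then show ?thesis
    using that[of "\<lambda>t. 1 / u (0, 0) * u (t, 0)"] flat_cmult[of "{0..1}" \<gamma> "\<lambda>t. u (t, 0)" "1 / u (0, 0)"]
      flat_nonzero[of "{0..1}" \<gamma> "\<lambda>t. u (t, 0)" 0] by auto
qed

text \<open>\<open>v\<close> is rescaled to start with the value at which \<open>u\<close> ends; the
  end value of \<open>w\<close> records that transport along a join is the product of the
  transports.\<close>

lemma flat_join:
  assumes "path \<gamma>" "path \<delta>" "pathfinish \<gamma> = pathstart \<delta>" and u: "flat {0..1} \<gamma> u" and v: "flat {0..1} \<delta> v"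
  obtains w where "flat {0..1} (\<gamma> +++ \<delta>) w" "w 0 = u 0" "w 1 = u 1 / v 0 * v 1"
proof -
  have p: "path (\<gamma> +++ \<delta>)" using assms by simp
  have un: "{0..1/2} \<union> {1/2..1} = {0..1::real}" and int: "{0..1/2} \<inter> {1/2..1} = {1/2::real}" by auto
  have 1: "flat {0..1/2} (\<gamma> +++ \<delta>) (\<lambda>t. u (2 * t))"
    by (rule flat_cong[OF _ flat_pullback[OF u, of "{0..1/2}" "\<lambda>t. 2 * t"]])
      (auto simp: joinpaths_def intro!: continuous_intros)
  have 2: "flat {1/2..1} (\<gamma> +++ \<delta>) (\<lambda>t. v (2 * t - 1))"
  proof (rule flat_cong[OF _ flat_pullback[OF v, of "{1/2..1}" "\<lambda>t. 2 * t - 1"]])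
    show "\<delta> (2 * t - 1) = (\<gamma> +++ \<delta>) t" if "t \<in> {1/2..1}" for t
    proof (cases "t = 1/2")
      case True
      then show ?thesis using assms(3) unfolding True by (simp add: joinpaths_def pathfinish_def pathstart_def)
    qed (use that in \<open>auto simp: joinpaths_def\<close>)
  qed (auto intro!: continuous_intros)
  have "continuous_on {0..1} (\<gamma> +++ \<delta>)" using p by (simp add: path_def)
  from flat_glue_connected[of "{0..1/2}" "{1/2..1}" "1/2", OF _ _ _ _ _ _ 1 2, unfolded un int, OF _ _ _ _ _ this]
  have "flat {0..1} (\<gamma> +++ \<delta>) (\<lambda>t. if t \<in> {0..1/2} then u (2 * t) else u 1 / v 0 * v (2 * t - 1))" by (simp cong: if_cong)
  then show ?thesis using that by fastforce
qed

text \<open>Triviality of the monodromy. A free homotopy to a constant loop gives a flat section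
  over the square. It is constant on the side over \<open>a\<close>, and the two lateral sides lie
  over the same path, so the side over \<open>p\<close> has equal end values.\<close>

lemma flat_loop:
  assumes sc: "simply_connected (UNIV :: 'a set)" and p: "path p" "pathfinish p = pathstart p"
    and u: "flat {0..1} p u"
  shows "u 1 = u 0"
proof -
  define a where "a = pathstart p"
  have "homotopic_loops UNIV p (\<lambda>_. a)"
    using sc p unfolding simply_connected_def
    by (simp add: path_def pathfinish_def pathstart_def)
  then obtain h where h: "continuous_on ({0..1::real} \<times> {0..1}) h"
    "\<And>x. x \<in> {0..1} \<Longrightarrow> h (0, x) = p x" "\<And>x. x \<in> {0..1} \<Longrightarrow> h (1, x) = a"
    "\<And>t. t \<in> {0..1} \<Longrightarrow> h (t, 1) = h (t, 0)"
    unfolding homotopic_loops by (auto simp: pathfinish_def pathstart_def)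
  obtain U where U: "flat ({0..1} \<times> {0..1}) h U" using ex_flat_square_on[OF h(1)] by blast
  have U0: "U (0, 0) \<noteq> 0" "U (1, 0) \<noteq> 0" using flat_nonzero[OF U] by auto
  have slice: "flat {0..1} (\<lambda>t. h (\<phi> t)) (\<lambda>t. U (\<phi> t))" "continuous_on {0..1} (\<lambda>t. h (\<phi> t))"
    if "continuous_on {0..1} \<phi>" "\<phi> ` {0..1} \<subseteq> {0..1} \<times> {0..1}" for \<phi> :: "real \<Rightarrow> real \<times> real"
    using flat_pullback[OF U that] continuous_on_compose2[OF h(1) that] by auto
  have bot: "flat {0..1} p (\<lambda>t. U (0, t))"
    by (rule flat_cong[OF _ slice(1)[of "\<lambda>t. (0, t)"]]) (auto simp: h(2) intro!: continuous_intros)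
  have top: "flat {0..1} (\<lambda>_. a) (\<lambda>t. U (1, t))"
    by (rule flat_cong[OF _ slice(1)[of "\<lambda>t. (1, t)"]]) (auto simp: h(3) intro!: continuous_intros)
  have left: "flat {0..1} (\<lambda>t. h (t, 0)) (\<lambda>t. U (t, 0))" "continuous_on {0..1} (\<lambda>t. h (t, 0))"
    by (rule slice; auto intro!: continuous_intros)+
  have right: "flat {0..1} (\<lambda>t. h (t, 0)) (\<lambda>t. U (t, 1))"
    by (rule flat_cong[OF _ slice(1)[of "\<lambda>t. (t, 1)"]]) (auto simp: h(4) intro!: continuous_intros)
  obtain i where i: "i \<in> I" "a \<in> W i" using cover by blast
  have const: "flat {0..1::real} (\<lambda>_. a) (\<lambda>_. \<omega> i a)" by (rule flat_single[OF i(1)]) (use i in auto)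
  have con: "connected {0..1::real}" by simp
  have "U (1, 0) / \<omega> i a = U (1, 1) / \<omega> i a"
    using flat_unique[OF con _ const top, of 0 1] by simp
  then have "U (1, 0) = U (1, 1)" using nz[OF i] by simp
  moreover have "U (0, 1) / U (0, 0) = U (1, 1) / U (1, 0)"
    using flat_unique[OF con left(2,1) right, of 0 1] by simp
  ultimately have "U (0, 1) = U (0, 0)" using U0 by simp
  moreover have "u 0 / U (0, 0) = u 1 / U (0, 1)"
    using flat_unique[OF con _ bot u, of 0 1] p(1) by (simp add: path_def)
  ultimately show ?thesis using U0 by simp
qed

text \<open>The value 1 at a base point is transported along paths, with a result independent of the
  path by \<open>flat_loop\<close>. Path-connectedness of \<open>W i\<close> lets the last piece
  stay in \<open>W i\<close>, where transport is proportional to \<open>\<omega> i\<close>.\<close>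

lemma simply_connected_global_section:
  assumes sc: "simply_connected (UNIV :: 'a set)" and pc: "\<And>i. i \<in> I \<Longrightarrow> path_connected (W i)"
  shows "\<exists>s. \<forall>i\<in>I. \<exists>c. c \<noteq> 0 \<and> (\<forall>x\<in>W i. s x = c * \<omega> i x)"
proof -
  define a where "a = (undefined :: 'a)"
  have ex_path: "\<exists>\<gamma>. path \<gamma> \<and> pathstart \<gamma> = a \<and> pathfinish \<gamma> = q" for q
  proof -
    \<comment> \<open>Simple connectedness says that any two loops are freely homotopic, also the
      constant ones at \<open>a\<close> and \<open>q\<close>; the track of the base point is then a
      path between them.\<close>
    have "homotopic_loops UNIV (\<lambda>_. a) (\<lambda>_. q)"
      using sc unfolding simply_connected_def by (simp add: path_def pathfinish_def pathstart_def)
    then obtain h where h: "continuous_on ({0..1::real} \<times> {0..1::real}) h"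
      "\<And>x. x \<in> {0..1} \<Longrightarrow> h (0, x) = a" "\<And>x. x \<in> {0..1} \<Longrightarrow> h (1, x) = q"
      unfolding homotopic_loops by auto
    have "path (\<lambda>t. h (t, 0))"
      unfolding path_def by (rule continuous_on_compose2[OF h(1)]) (auto intro!: continuous_intros)
    then show ?thesis using h by (intro exI[of _ "\<lambda>t. h (t, 0)"]) (auto simp: pathfinish_def pathstart_def)
  qed
  define P where "P q r \<longleftrightarrow> (\<exists>\<gamma> u. path \<gamma> \<and> pathstart \<gamma> = a \<and> pathfinish \<gamma> = q \<and> flat {0..1} \<gamma> u \<and> u 0 = 1 \<and> u 1 = r)" for q r
  have exP: "\<exists>r. P q r" for q
  proof -
    obtain \<gamma> where g: "path \<gamma>" "pathstart \<gamma> = a" "pathfinish \<gamma> = q" using ex_path by blast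
    obtain u where "flat {0..1} \<gamma> u" "u 0 = 1" by (rule ex_flat_path[OF g(1)])
    then show ?thesis using g unfolding P_def by blast
  qed
  have uniqP: "r = r'" if pq: "P q r" "P q r'" for q r r'
  proof -
    obtain \<gamma> u where g: "path \<gamma>" "pathstart \<gamma> = a" "pathfinish \<gamma> = q" "flat {0..1} \<gamma> u" "u 0 = 1" "u 1 = r"
      using pq(1) unfolding P_def by blast
    obtain \<delta> v where d: "path \<delta>" "pathstart \<delta> = a" "pathfinish \<delta> = q" "flat {0..1} \<delta> v" "v 0 = 1" "v 1 = r'"
      using pq(2) unfolding P_def by blast
    have rv: "flat {0..1} (reversepath \<delta>) (\<lambda>t. v (1 - t))"
      by (rule flat_cong[OF _ flat_pullback[OF d(4), of "{0..1}" "\<lambda>t. 1 - t"]])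
        (auto simp: reversepath_def intro!: continuous_intros)
    have join: "pathfinish \<gamma> = pathstart (reversepath \<delta>)" "path (reversepath \<delta>)" using g d by auto
    obtain w where w: "flat {0..1} (\<gamma> +++ reversepath \<delta>) w" "w 0 = u 0" "w 1 = u 1 / v (1 - 0) * v (1 - 1)"
      by (rule flat_join[OF g(1) join(2,1) g(4) rv])
    \<comment> \<open>The loop runs along \<open>\<gamma>\<close> and back along
      \<open>\<delta>\<close>; its trivial transport forces the end values \<open>r\<close> and
      \<open>r'\<close> to agree.\<close>
    have "w 1 = w 0" by (rule flat_loop[OF sc _ _ w(1)]) (use g d in auto)
    then show ?thesis using w g d flat_nonzero[OF d(4), of 1] by simp
  qed
  define s where "s q = (THE r. P q r)" for q
  have s: "s q = r" if "P q r" for q r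
    unfolding s_def using that uniqP by blast
  have "\<exists>c. c \<noteq> 0 \<and> (\<forall>x\<in>W i. s x = c * \<omega> i x)" if i: "i \<in> I" for i
  proof (cases "W i = {}")
    case True
    then show ?thesis by (intro exI[of _ 1]) auto
  next
    case False
    then obtain q0 where q0: "q0 \<in> W i" by blast
    obtain r where "P q0 r" using exP by blast
    then obtain \<gamma> u where g: "path \<gamma>" "pathstart \<gamma> = a" "pathfinish \<gamma> = q0" "flat {0..1} \<gamma> u" "u 0 = 1" "u 1 = r"
      unfolding P_def by blast
    have r: "r \<noteq> 0" using flat_nonzero[OF g(4), of 1] g(6) by simp
    have "s q = r / \<omega> i q0 * \<omega> i q" if q: "q \<in> W i" for q
    proof (rule s)
      obtain \<delta> where d: "path \<delta>" "path_image \<delta> \<subseteq> W i" "pathstart \<delta> = q0" "pathfinish \<delta> = q"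
        using pc[OF i] q q0 unfolding path_connected_def by blast
      have v: "flat {0..1} \<delta> (\<lambda>t. \<omega> i (\<delta> t))"
        by (rule flat_single[OF i]) (use d in \<open>auto simp: path_image_def\<close>)
      have j: "pathfinish \<gamma> = pathstart \<delta>" using g d by simp
      obtain w where w: "flat {0..1} (\<gamma> +++ \<delta>) w" "w 0 = u 0" "w 1 = u 1 / \<omega> i (\<delta> 0) * \<omega> i (\<delta> 1)"
        by (rule flat_join[OF g(1) d(1) j g(4) v])
      have "\<delta> 0 = q0" "\<delta> 1 = q" using d by (auto simp: pathstart_def pathfinish_def)
      then show "P q (r / \<omega> i q0 * \<omega> i q)"
        unfolding P_def using w g d by (intro exI[of _ "\<gamma> +++ \<delta>"] exI[of _ w]) auto
    qed
    then show ?thesis using r nz[OF i q0] by (intro exI[of _ "r / \<omega> i q0"]) auto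
  qed
  then show ?thesis by blast
qed

end

section \<open>Existence of the volume form\<close>

context smooth_manifold
begin

lemma smooth_at_open_preimage:
  assumes F: "smooth_at p F" and T: "open T" "F p \<in> T"
  obtains U where "open U" "p \<in> U" "\<And>q. q \<in> U \<Longrightarrow> F q \<in> T"
proof -
  obtain c where c: "c \<in> A" "p \<in> fst c" using ex_chart by blast
  obtain V where V: "open V" "snd c p \<in> V" "smooth_on V (\<lambda>x. F (chart_inv c x))"
    using F smooth_at_iff[OF c] by auto
  let ?W = "V \<inter> (\<lambda>x. F (chart_inv c x)) -` T"
  have W: "open ?W" by (rule continuous_open_preimage[OF smooth_on_continuous[OF V(3)] V(1) T(1)])
  show ?thesis
  proof
    show "open (fst c \<inter> snd c -` ?W)" by (rule open_preimage[OF c(1) W])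
    show "p \<in> fst c \<inter> snd c -` ?W" using c V T by (simp add: chart_inv_snd)
    show "F q \<in> T" if "q \<in> fst c \<inter> snd c -` ?W" for q using that by (auto simp: chart_inv_snd[OF c(1)])
  qed
qed

text \<open>In the chart the derivative vanishes on a ball, which is convex; \<open>V\<close> is the
  preimage of this ball.\<close>

lemma chart_deriv_zero_locally_constant:
  fixes f :: "'a \<Rightarrow> real"
  assumes c: "c \<in> A" and U: "open U" "p \<in> U" "U \<subseteq> fst c"
    and f: "\<And>q. q \<in> U \<Longrightarrow> smooth_at q f" "\<And>q v. q \<in> U \<Longrightarrow> chart_deriv c f q v = 0"
  obtains V where "open V" "p \<in> V" "V \<subseteq> U" "\<And>q. q \<in> V \<Longrightarrow> f q = f p"
proof -
  have "open (snd c ` U)" "snd c p \<in> snd c ` U" using open_snd_image[OF c U(1,3)] U by auto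
  then obtain e where e: "e > 0" "ball (snd c p) e \<subseteq> snd c ` U" using open_contains_ball by blast
  let ?B = "ball (snd c p) e"
  have der: "((\<lambda>x. f (chart_inv c x)) has_derivative (\<lambda>h. 0)) (at x within ?B)" if x: "x \<in> ?B" for x
  proof -
    obtain q where q: "q \<in> U" "x = snd c q" using e x by blast
    have "((\<lambda>x. f (chart_inv c x)) has_derivative chart_deriv c f q) (at (snd c q))"
      using q U by (intro chart_deriv_has_derivative c f) auto
    moreover have "chart_deriv c f q = (\<lambda>h. 0)" using f(2)[OF q(1)] by blast
    ultimately show ?thesis using q(2) has_derivative_at_withinI by metis
  qed
  show ?thesis
  proof
    show "open (U \<inter> (fst c \<inter> snd c -` ?B))" using U open_preimage[OF c, of ?B] by blast
    show "p \<in> U \<inter> (fst c \<inter> snd c -` ?B)" "U \<inter> (fst c \<inter> snd c -` ?B) \<subseteq> U" using U e by auto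
    fix q assume q: "q \<in> U \<inter> (fst c \<inter> snd c -` ?B)"
    have "f (chart_inv c (snd c q)) = f (chart_inv c (snd c p))"
      by (rule has_derivative_zero_unique[of ?B "\<lambda>x. f (chart_inv c x)"]) (use der q e in auto)
    then show "f q = f p" using q U by (simp add: chart_inv_snd[OF c] subset_iff)
  qed
qed

text \<open>One bump around every point, thinned out to countably many by Lindelof's theorem, which
  rests on second countability.\<close>

lemma countable_bumps:
  obtains ch :: "nat \<Rightarrow> ('a, 'n) chart" and \<phi> :: "nat \<Rightarrow> 'a \<Rightarrow> real" and V K :: "nat \<Rightarrow> 'a set" where
    "\<And>k. ch k \<in> A" "\<And>k. \<phi> k \<in> smooth_functions A" "\<And>k. open (V k)" "\<And>k q. q \<in> V k \<Longrightarrow> \<phi> k q = 1"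
    "\<And>k. closed (K k)" "\<And>k. K k \<subseteq> fst (ch k)" "\<And>k q. q \<notin> K k \<Longrightarrow> \<phi> k q = 0" "\<And>q. \<exists>k. q \<in> V k"
proof -
  have "\<forall>p. \<exists>c \<phi> N K. c \<in> A \<and> \<phi> \<in> smooth_functions A \<and> open N \<and> p \<in> N \<and> (\<forall>q\<in>N. \<phi> q = 1) \<and>
      closed K \<and> K \<subseteq> fst c \<and> (\<forall>q. q \<notin> K \<longrightarrow> \<phi> q = 0)"
  proof
    fix p
    obtain c where c: "c \<in> A" "p \<in> fst c" using ex_chart by blast
    obtain \<phi> N K where *: "\<phi> \<in> smooth_functions A" "open N" "p \<in> N" "N \<subseteq> fst c" "\<And>q. q \<in> N \<Longrightarrow> \<phi> q = 1"
      "closed K" "K \<subseteq> fst c" "\<And>q. q \<notin> K \<Longrightarrow> \<phi> q = 0"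
      by (rule manifold_bump[OF open_chart[OF c(1)] c(2)]) blast
    show "\<exists>c \<phi> N K. c \<in> A \<and> \<phi> \<in> smooth_functions A \<and> open N \<and> p \<in> N \<and> (\<forall>q\<in>N. \<phi> q = 1) \<and>
        closed K \<and> K \<subseteq> fst c \<and> (\<forall>q. q \<notin> K \<longrightarrow> \<phi> q = 0)"
      by (rule exI[of _ c], rule exI[of _ \<phi>], rule exI[of _ N], rule exI[of _ K]) (use c * in auto)
  qed
  then obtain c \<phi> N K where *: "\<And>p. c p \<in> A \<and> \<phi> p \<in> smooth_functions A \<and> open (N p) \<and> p \<in> N p \<and> (\<forall>q\<in>N p. \<phi> p q = 1) \<and>
      closed (K p) \<and> K p \<subseteq> fst (c p) \<and> (\<forall>q. q \<notin> K p \<longrightarrow> \<phi> p q = 0)"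
    by (elim choice[THEN exE] exE) metis
  have "\<And>S. S \<in> range N \<Longrightarrow> open S" using * by auto
  then obtain F' where F': "F' \<subseteq> range N" "countable F'" "\<Union> F' = \<Union> (range N)" by (rule Lindelof)
  then obtain C where C: "countable C" "F' = N ` C" using countable_subset_image[of F' N UNIV] by blast
  have un: "\<exists>p\<in>C. q \<in> N p" for q using F'(3) C(2) * by blast
  \<comment> \<open>Types are nonempty, so \<open>C\<close> is; it can then be enumerated by all
    natural numbers, with repetitions if it is finite.\<close>
  then have "C \<noteq> {}" by blast
  then have r: "range (from_nat_into C) = C" using C(1) by (rule range_from_nat_into)
  have "\<exists>k. q \<in> N (from_nat_into C k)" for q using un[of q] r by (metis imageE)
  note cov = this
  show ?thesis
  proof (rule that[of "\<lambda>k. c (from_nat_into C k)" "\<lambda>k. \<phi> (from_nat_into C k)" "\<lambda>k. N (from_nat_into C k)" "\<lambda>k. K (from_nat_into C k)"])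
    fix k q
    note k = *[of "from_nat_into C k"]
    show "c (from_nat_into C k) \<in> A" "\<phi> (from_nat_into C k) \<in> smooth_functions A" "open (N (from_nat_into C k))"
      "closed (K (from_nat_into C k))" "K (from_nat_into C k) \<subseteq> fst (c (from_nat_into C k))"
      using k by simp_all
    show "\<phi> (from_nat_into C k) q = 1" if "q \<in> N (from_nat_into C k)" using k that by simp
    show "\<phi> (from_nat_into C k) q = 0" if "q \<notin> K (from_nat_into C k)" using k that by simp
    show "\<exists>k. q \<in> N (from_nat_into C k)" by (rule cov)
  qed
qed

text \<open>A positive density, given by the logarithms \<open>h c\<close> of its components: the partition of unity
  \<open>\<psi> k = \<phi> k * (\<Prod>j<k. 1 - \<phi> j)\<close> averages the logarithms of the coordinate densities.
  On \<open>V j\<close> all \<open>\<psi> k\<close> with \<open>k > j\<close> vanish, so no paracompactness is needed.\<close>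

lemma ex_log_density:
  obtains h :: "('a, 'n) chart \<Rightarrow> 'a \<Rightarrow> real" where
    "\<And>c p. c \<in> A \<Longrightarrow> p \<in> fst c \<Longrightarrow> smooth_at p (h c)"
    "\<And>c d p. c \<in> A \<Longrightarrow> d \<in> A \<Longrightarrow> p \<in> fst c \<Longrightarrow> p \<in> fst d \<Longrightarrow> h c p = h d p + ln \<bar>jac c d p\<bar>"
proof -
  obtain ch :: "nat \<Rightarrow> ('a, 'n) chart" and \<phi> :: "nat \<Rightarrow> 'a \<Rightarrow> real" and V K :: "nat \<Rightarrow> 'a set" where
    ch: "\<And>k. ch k \<in> A" and \<phi>: "\<And>k. \<phi> k \<in> smooth_functions A" and V: "\<And>k. open (V k)" "\<And>k q. q \<in> V k \<Longrightarrow> \<phi> k q = 1"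
    and K: "\<And>k. closed (K k)" "\<And>k. K k \<subseteq> fst (ch k)" "\<And>k q. q \<notin> K k \<Longrightarrow> \<phi> k q = 0" and cov: "\<And>q. \<exists>k. q \<in> V k"
    using countable_bumps by blast
  define \<psi> where "\<psi> k q = \<phi> k q * (\<Prod>j<k. 1 - \<phi> j q)" for k q
  \<comment> \<open>The first index whose set \<open>V k\<close> contains \<open>q\<close>. All
    later terms of the partition vanish at \<open>q\<close>, so stopping there loses
    nothing.\<close>
  define M where "M q = (LEAST k. q \<in> V k)" for q
  define h where "h c q = (\<Sum>k\<le>M q. \<psi> k q * ln \<bar>jac c (ch k) q\<bar>)" for c q
  have M: "q \<in> V (M q)" for q unfolding M_def using cov LeastI_ex by fast
  have \<psi>0: "\<psi> k q = 0" if "q \<in> V j" "j < k" for j k q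
    using V(2)[OF that(1)] that(2) by (auto simp: \<psi>_def intro!: prod_zero bexI[of _ j])
  \<comment> \<open>The sum telescopes: the missing mass after \<open>n\<close> is the product of
    the \<open>1 - \<phi> k\<close>, which is 0 as soon as one bump has value 1.\<close>
  have sum: "(\<Sum>k\<le>n. \<psi> k q) = 1 - (\<Prod>k\<le>n. 1 - \<phi> k q)" for n q
  proof (induction n)
    case (Suc n)
    have "\<psi> (Suc n) q = \<phi> (Suc n) q * (\<Prod>j\<le>n. 1 - \<phi> j q)" by (simp only: \<psi>_def lessThan_Suc_atMost)
    then show ?case by (simp add: Suc algebra_simps)
  qed (simp add: \<psi>_def)
  have one: "(\<Sum>k\<le>M q. \<psi> k q) = 1" for q
  proof -
    have "(\<Prod>k\<le>M q. 1 - \<phi> k q) = 0" using V(2)[OF M[of q]] by (auto intro!: prod_zero bexI[of _ "M q"])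
    then show ?thesis by (simp add: sum)
  qed
  \<comment> \<open>On \<open>V j\<close> the variable bound \<open>M q\<close> may be replaced by
    the fixed bound \<open>j\<close>; smoothness is read off from this formula.\<close>
  have hV: "h c q = (\<Sum>k\<le>j. \<psi> k q * ln \<bar>jac c (ch k) q\<bar>)" if q: "q \<in> V j" for c q j
  proof -
    have "M q \<le> j" unfolding M_def by (rule Least_le[of "\<lambda>k. q \<in> V k", OF q])
    then show ?thesis
      unfolding h_def using \<psi>0[OF M] by (intro sum.mono_neutral_left) auto
  qed
  show ?thesis
  proof
    fix c p assume c: "c \<in> A" "p \<in> fst c"
    have \<psi>s: "smooth_at q (\<psi> k)" for k q
      unfolding \<psi>_def by (intro smooth_at_mult smooth_at_prod smooth_at_diff smooth_at_const smooth_functionsD \<phi>)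
    have "smooth_at p (\<lambda>q. \<psi> k q * ln \<bar>jac c (ch k) q\<bar>)" for k
    proof (cases "p \<in> fst (ch k)")
      case True
      then show ?thesis
        using c ch by (intro smooth_at_mult \<psi>s smooth_at_ln_abs smooth_at_jac jac_nonzero) auto
    next
      case False
      then have p: "p \<in> - K k" "open (- K k)" using K by auto
      show ?thesis
        by (rule smooth_at_cong[OF p(2,1) _ smooth_at_const[of p 0]]) (simp add: \<psi>_def K(3))
    qed
    then have "smooth_at p (\<lambda>q. \<Sum>k\<le>M p. \<psi> k q * ln \<bar>jac c (ch k) q\<bar>)" by (rule smooth_at_sum)
    then show "smooth_at p (h c)"
      by (rule smooth_at_cong[OF V(1) M, rotated]) (simp add: hV)
  next
    fix c d p assume c: "c \<in> A" "d \<in> A" "p \<in> fst c" "p \<in> fst d"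
    have "\<psi> k p * ln \<bar>jac c (ch k) p\<bar> = \<psi> k p * ln \<bar>jac d (ch k) p\<bar> + \<psi> k p * ln \<bar>jac c d p\<bar>" for k
    proof (cases "p \<in> fst (ch k)")
      case True
      then show ?thesis
        using c ch[of k] jac_nonzero[of c d p] jac_nonzero[of d "ch k" p]
        by (simp add: jac_compose[of c d "ch k" p] abs_mult ln_mult algebra_simps)
    next
      case False
      then have "p \<notin> K k" using K(2)[of k] by blast
      then have "\<psi> k p = 0" by (simp add: \<psi>_def K(3))
      then show ?thesis by simp
    qed
    then have "h c p = h d p + (\<Sum>k\<le>M p. \<psi> k p) * ln \<bar>jac c d p\<bar>"
      by (simp add: h_def sum.distrib sum_distrib_right)
    then show "h c p = h d p + ln \<bar>jac c d p\<bar>" by (simp add: one)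
  qed
qed

text \<open>\<open>\<sigma> c p\<close> is the sign of the Jacobian from \<open>c\<close> to an
  oriented chart at \<open>p\<close>; the choice is immaterial because Jacobians within
  \<open>B\<close> are positive. The charts of \<open>A\<close> may have mixed orientations, so
  comparisons take place in the joint atlas \<open>A \<union> B\<close>.\<close>

lemma ex_orientation_signs:
  assumes "orientable A"
  obtains \<sigma> :: "('a, 'n) chart \<Rightarrow> 'a \<Rightarrow> real" where
    "\<And>c p. c \<in> A \<Longrightarrow> p \<in> fst c \<Longrightarrow> \<bar>\<sigma> c p\<bar> = 1"
    "\<And>c d p. c \<in> A \<Longrightarrow> d \<in> A \<Longrightarrow> p \<in> fst c \<Longrightarrow> p \<in> fst d \<Longrightarrow> \<sigma> c p = sgn (jac c d p) * \<sigma> d p"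
    "\<And>c p. c \<in> A \<Longrightarrow> p \<in> fst c \<Longrightarrow> \<exists>U. open U \<and> p \<in> U \<and> (\<forall>q\<in>U. \<sigma> c q = \<sigma> c p)"
proof -
  obtain B where B: "smooth_atlas B" and AB: "smooth_atlas (A \<union> B)"
    and pos: "\<And>c d p. c \<in> B \<Longrightarrow> d \<in> B \<Longrightarrow> p \<in> fst c \<inter> fst d \<Longrightarrow>
        0 < det (matrix (frechet_derivative (transition c d) (at (snd c p))))"
    using assms unfolding orientable_def by blast
  interpret B: smooth_manifold B by unfold_locales (rule B)
  interpret AB: smooth_manifold "A \<union> B" by unfold_locales (rule AB)
  define ch where "ch p = (SOME b. b \<in> B \<and> p \<in> fst b)" for p
  have ch: "ch p \<in> B" "p \<in> fst (ch p)" for p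
  proof -
    obtain b where "b \<in> B" "p \<in> fst b" using B.ex_chart by blast
    then have "ch p \<in> B \<and> p \<in> fst (ch p)" unfolding ch_def using someI[of "\<lambda>b. b \<in> B \<and> p \<in> fst b"] by blast
    then show "ch p \<in> B" "p \<in> fst (ch p)" by auto
  qed
  define \<sigma> where "\<sigma> c p = sgn (jac c (ch p) p)" for c p
  have nz: "jac c b p \<noteq> 0" if "c \<in> A \<union> B" "b \<in> A \<union> B" "p \<in> fst c" "p \<in> fst b" for c b p
    by (rule AB.jac_nonzero[OF that])
  have \<sigma>: "\<sigma> c p = sgn (jac c b p)" if c: "c \<in> A" "p \<in> fst c" and b: "b \<in> B" "p \<in> fst b" for c b p
  proof -
    have "jac b (ch p) p > 0" using pos[of b "ch p" p] b ch by (simp add: jac_def tmap_def)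
    then show ?thesis
      using AB.jac_compose[of c b "ch p" p] c b ch by (simp add: \<sigma>_def sgn_mult)
  qed
  show ?thesis
  proof
    fix c p assume c: "c \<in> A" "p \<in> fst c"
    show "\<bar>\<sigma> c p\<bar> = 1" using nz[of c "ch p" p] c ch by (simp add: \<sigma>_def sgn_real_def)
    \<comment> \<open>Near \<open>p\<close> this one chart may serve for all points \<open>q\<close>
      in place of \<open>ch q\<close>, so \<open>\<sigma> c\<close> is locally the sign of a
      continuous function without zeros.\<close>
    let ?b = "ch p"
    have b: "?b \<in> A \<union> B" "c \<in> A \<union> B" using c ch by auto
    have s: "AB.smooth_at p (jac c ?b)" by (rule AB.smooth_at_jac[OF b(2,1) c(2) ch(2)])
    have "\<exists>U. open U \<and> p \<in> U \<and> (\<forall>q\<in>U. sgn (jac c ?b q) = sgn (jac c ?b p))"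
    proof (cases "jac c ?b p > 0")
      case True
      then have m: "jac c ?b p \<in> {0<..}" by simp
      obtain U where "open U" "p \<in> U" "\<And>q. q \<in> U \<Longrightarrow> jac c ?b q \<in> {0<..}"
        by (rule AB.smooth_at_open_preimage[OF s open_greaterThan m]) (rule that)
      then show ?thesis using True by (intro exI[of _ U]) auto
    next
      case False
      then have m: "jac c ?b p \<in> {..<0}" using nz[OF b(2,1) c(2) ch(2)] by simp
      obtain U where "open U" "p \<in> U" "\<And>q. q \<in> U \<Longrightarrow> jac c ?b q \<in> {..<0}"
        by (rule AB.smooth_at_open_preimage[OF s open_lessThan m]) (rule that)
      then show ?thesis using m by (intro exI[of _ U]) auto
    qed
    then obtain U where U: "open U" "p \<in> U" "\<forall>q\<in>U. sgn (jac c ?b q) = sgn (jac c ?b p)" by blast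
    have "open (U \<inter> fst c \<inter> fst ?b)" using U open_chart[OF c(1)] B.open_chart[OF ch(1)] by (intro open_Int)
    moreover have "p \<in> U \<inter> fst c \<inter> fst ?b" using U(2) c(2) ch(2)[of p] by simp
    moreover have "\<forall>q\<in>U \<inter> fst c \<inter> fst ?b. \<sigma> c q = \<sigma> c p"
    proof
      fix q assume q: "q \<in> U \<inter> fst c \<inter> fst ?b"
      have "\<sigma> c q = sgn (jac c ?b q)" by (rule \<sigma>[OF c(1) _ ch(1)]) (use q in simp_all)
      then show "\<sigma> c q = \<sigma> c p" using q U(3) \<sigma>[OF c ch] by simp
    qed
    ultimately show "\<exists>U. open U \<and> p \<in> U \<and> (\<forall>q\<in>U. \<sigma> c q = \<sigma> c p)" by blast
  next
    fix c d p assume c: "c \<in> A" "d \<in> A" "p \<in> fst c" "p \<in> fst d"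
    then show "\<sigma> c p = sgn (jac c d p) * \<sigma> d p"
      using AB.jac_compose[of c d "ch p" p] ch[of p] by (simp add: \<sigma>_def sgn_mult)
  qed
qed

end

section \<open>The two existence arguments\<close>

context divergence_operator
begin

text \<open>An index of the local system is a chart, a path-connected open set and a potential
  \<open>L\<close> of the coefficients there, and stands for the form \<open>exp L dx\<close>. By
  \<open>potential_change\<close> two such forms differ by a locally constant factor.\<close>

lemma simply_connected_case:
  assumes sc: "simply_connected (UNIV :: 'a set)"
  shows "\<exists>\<Omega>. volume_form A \<Omega> \<and> (\<forall>X\<in>vector_fields A. D X = divergence A \<Omega> X)"
proof -
  define ch where "ch p = (SOME c. c \<in> A \<and> p \<in> fst c)" for p
  have ch: "ch p \<in> A" "p \<in> fst (ch p)" for p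
  proof -
    obtain b where "b \<in> A" "p \<in> fst b" using ex_chart by blast
    then have "ch p \<in> A \<and> p \<in> fst (ch p)" unfolding ch_def using someI[of "\<lambda>b. b \<in> A \<and> p \<in> fst b"] by blast
    then show "ch p \<in> A" "p \<in> fst (ch p)" by auto
  qed
  define I where "I = {(c, U, L). c \<in> A \<and> open U \<and> path_connected U \<and> U \<subseteq> fst c \<and>
      (\<forall>q\<in>U. smooth_at q L \<and> (\<forall>v. chart_deriv c L q v = dcoeff c q \<bullet> v))}"
  define W :: "('a, 'n) chart \<times> 'a set \<times> ('a \<Rightarrow> real) \<Rightarrow> 'a set" where "W = (\<lambda>(c, U, L). U)"
  \<comment> \<open>The component of the form \<open>exp L dx\<close> of the chart \<open>c\<close>,
    taken in the chart chosen at \<open>q\<close>. It need not be continuous in \<open>q\<close>,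
    but the choice cancels in all ratios.\<close>
  define \<omega> :: "('a, 'n) chart \<times> 'a set \<times> ('a \<Rightarrow> real) \<Rightarrow> 'a \<Rightarrow> real" where
    "\<omega> = (\<lambda>(c, U, L) q. exp (L q) * jac (ch q) c q)"
  have ex_index: "\<exists>U L. (c, U, L) \<in> I \<and> p \<in> U" if c: "c \<in> A" "p \<in> fst c" for c p
  proof -
    obtain e L where e: "e > 0" "ball (snd c p) e \<subseteq> chart_image c" and
      L: "\<forall>q\<in>fst c \<inter> snd c -` ball (snd c p) e. smooth_at q L \<and> (\<forall>v. chart_deriv c L q v = dcoeff c q \<bullet> v)"
      using local_potential[OF c] by blast
    let ?U = "fst c \<inter> snd c -` ball (snd c p) e"
    have "?U = chart_inv c ` ball (snd c p) e"
      using e(2) chart_inv_in[OF c(1)] snd_chart_inv[OF c(1)] chart_inv_snd[OF c(1)]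
      by (auto simp: image_iff subset_iff) (metis mem_ball)+
    moreover have "path_connected (chart_inv c ` ball (snd c p) e)"
      by (rule path_connected_continuous_image[OF continuous_on_subset[OF cont_chart_inv[OF c(1)] e(2)]])
        (simp add: convex_imp_path_connected)
    ultimately have "path_connected ?U" by simp
    then have "(c, ?U, L) \<in> I" using L c open_preimage[OF c(1), of "ball (snd c p) e"] by (simp add: I_def)
    then show ?thesis using c(2) e(1) by (intro exI[of _ ?U] exI[of _ L]) simp
  qed
  interpret local_system I W \<omega>
  proof
    show "open (W i)" if "i \<in> I" for i using that by (auto simp: I_def W_def)
    show "\<exists>i\<in>I. x \<in> W i" for x
    proof -
      obtain U L where "(ch x, U, L) \<in> I" "x \<in> U" using ex_index[OF ch] by blast
      then show ?thesis by (intro bexI[of _ "(ch x, U, L)"]) (auto simp: W_def)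
    qed
    show "\<omega> i x \<noteq> 0" if "i \<in> I" "x \<in> W i" for i x
      using that jac_nonzero[of "ch x" "fst i" x] ch[of x] by (auto simp: I_def W_def \<omega>_def)
    fix i j x assume ij: "i \<in> I" "j \<in> I" and x: "x \<in> W i" "x \<in> W j"
    obtain c U L where i: "i = (c, U, L)" by (cases i)
    obtain d U' M where j: "j = (d, U', M)" by (cases j)
    have c: "c \<in> A" "open U" "U \<subseteq> fst c" "\<And>q. q \<in> U \<Longrightarrow> smooth_at q L" "\<And>q v. q \<in> U \<Longrightarrow> chart_deriv c L q v = dcoeff c q \<bullet> v"
      and d: "d \<in> A" "open U'" "U' \<subseteq> fst d" "\<And>q. q \<in> U' \<Longrightarrow> smooth_at q M" "\<And>q v. q \<in> U' \<Longrightarrow> chart_deriv d M q v = dcoeff d q \<bullet> v"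
      using ij by (auto simp: I_def i j)
    have xU: "x \<in> U" "x \<in> U'" using x by (auto simp: W_def i j)
    let ?f = "\<lambda>q. L q - (M q + ln \<bar>jac c d q\<bar>)"
    have sm: "smooth_at q L" "smooth_at q (\<lambda>q. M q + ln \<bar>jac c d q\<bar>)" if "q \<in> U \<inter> U'" for q
    proof -
      have q: "q \<in> U" "q \<in> U'" "q \<in> fst c" "q \<in> fst d" using that c(3) d(3) by auto
      show "smooth_at q L" by (rule c(4)[OF q(1)])
      show "smooth_at q (\<lambda>q. M q + ln \<bar>jac c d q\<bar>)"
        by (intro smooth_at_add smooth_at_ln_abs smooth_at_jac jac_nonzero d(4) c(1) d(1) q)
    qed
    \<comment> \<open>Both parts of \<open>?f\<close> are potentials of the coefficients in the
      chart \<open>c\<close>.\<close>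
    have f0: "chart_deriv c ?f q v = 0" if q: "q \<in> U \<inter> U'" for q v
      using q c(3) potential_change[OF d c(1), of q v] sm[OF q] c(5) by (subst chart_deriv_diff[OF c(1)]) auto
    have fs: "smooth_at q ?f" if q: "q \<in> U \<inter> U'" for q by (rule smooth_at_diff[OF sm[OF q]])
    have oU: "open (U \<inter> U')" "x \<in> U \<inter> U'" "U \<inter> U' \<subseteq> fst c" using c(2,3) d(2) xU by auto
    obtain V where V: "open V" "x \<in> V" "V \<subseteq> U \<inter> U'" "\<And>q. q \<in> V \<Longrightarrow> ?f q = ?f x"
      by (rule chart_deriv_zero_locally_constant[OF c(1) oU fs f0], assumption, assumption) (rule that)
    have xcd: "x \<in> fst c" "x \<in> fst d" using xU c d by auto
    have sj: "smooth_at x (jac c d)" by (rule smooth_at_jac[OF c(1) d(1) xcd])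
    \<comment> \<open>Positivity of the product says that the Jacobian has the same sign at
      \<open>q\<close> as at \<open>x\<close>.\<close>
    obtain S where S: "open S" "x \<in> S" "\<And>q. q \<in> S \<Longrightarrow> jac c d q * jac c d x \<in> {0<..}"
    proof (rule smooth_at_open_preimage[OF smooth_at_mult[OF sj smooth_at_const] open_greaterThan])
      show "jac c d x * jac c d x \<in> {0<..}"
        using jac_nonzero[OF c(1) d(1) xcd] by (auto simp: zero_less_mult_iff linorder_neq_iff)
    qed (rule that)
    have main: "\<omega> i q = (exp (?f x) / sgn (jac c d x)) * \<omega> j q" if q: "q \<in> V \<inter> S" for q
    proof -
      have qc: "q \<in> fst c" "q \<in> fst d" using q V c d by auto
      have nz: "jac c d q \<noteq> 0" by (rule jac_nonzero[OF c(1) d(1) qc])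
      have sg: "sgn (jac c d q) = sgn (jac c d x)" using S(3)[of q] q
        by (auto simp: sgn_real_def zero_less_mult_iff split: if_splits)
      have fq: "?f q = ?f x" using V(4) q by blast
      have "exp (L q) = exp (?f q) * exp (M q) * \<bar>jac c d q\<bar>"
        using nz by (simp add: exp_diff exp_add)
      then have "exp (L q) = exp (?f x) * exp (M q) * \<bar>jac c d q\<bar>" by (simp only: fq)
      moreover have "\<bar>jac c d q\<bar> = jac c d q / sgn (jac c d q)" using nz by (simp add: sgn_real_def)
      ultimately have "exp (L q) = exp (?f x) * exp (M q) * (jac c d q / sgn (jac c d x))" by (simp only: sg)
      moreover have "jac (ch q) d q = jac (ch q) c q * jac c d q"
        by (rule jac_compose[OF ch(1) c(1) d(1) ch(2) qc])
      ultimately show ?thesis by (simp add: \<omega>_def i j ac_simps)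
    qed
    have "open (V \<inter> S)" "x \<in> V \<inter> S" using V(1,2) S(1,2) by auto
    then show "\<exists>V e. open V \<and> x \<in> V \<and> (\<forall>y\<in>V. \<omega> i y = e * \<omega> j y)"
      by (intro exI[of _ "V \<inter> S"] exI[of _ "exp (?f x) / sgn (jac c d x)"] conjI ballI main)
  qed
  have "path_connected (W i)" if "i \<in> I" for i using that by (auto simp: I_def W_def)
  from simply_connected_global_section[OF sc this]
  obtain s where s: "\<And>i. i \<in> I \<Longrightarrow> \<exists>k. k \<noteq> 0 \<and> (\<forall>x\<in>W i. s x = k * \<omega> i x)" by blast
  \<comment> \<open>Undoes the choice of charts: \<open>s q\<close> is a component in
    \<open>ch q\<close>, and the Jacobian converts it to the chart \<open>c\<close>.\<close>
  define \<rho> where "\<rho> c q = s q * jac c (ch q) q" for c q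
  have loc: "\<exists>U L k. open U \<and> p \<in> U \<and> k \<noteq> 0 \<and> smooth_at p L \<and> (\<forall>v. chart_deriv c L p v = dcoeff c p \<bullet> v) \<and> (\<forall>q\<in>U. \<rho> c q = k * exp (L q))"
    if c: "c \<in> A" "p \<in> fst c" for c p
  proof -
    obtain U L where UL: "(c, U, L) \<in> I" "p \<in> U" using ex_index[OF c] by blast
    obtain k where k: "k \<noteq> 0" "\<And>q. q \<in> U \<Longrightarrow> s q = k * (exp (L q) * jac (ch q) c q)"
      using s[OF UL(1)] by (auto simp: W_def \<omega>_def)
    have "\<rho> c q = k * exp (L q)" if q: "q \<in> U" for q
    proof -
      have "q \<in> fst c" using q UL by (auto simp: I_def)
      then have "jac (ch q) c q * jac c (ch q) q = 1" using jac_inverse[OF ch(1) c(1) ch(2)] by blast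
      then show ?thesis by (simp add: \<rho>_def k(2)[OF q] mult.assoc)
    qed
    then show ?thesis using UL k(1) by (intro exI[of _ U] exI[of _ L] exI[of _ k]) (auto simp: I_def)
  qed
  show ?thesis
  proof (rule volume_form_from_densities[of \<rho>])
    fix c d p assume "c \<in> A" "d \<in> A" "p \<in> fst c" "p \<in> fst d"
    then show "\<rho> c p = jac c d p * \<rho> d p" using jac_compose[of c d "ch p" p] ch[of p] by (simp add: \<rho>_def)
  next
    fix c p assume c: "c \<in> A" "p \<in> fst c"
    obtain U L k where U: "open U" "p \<in> U" and k: "k \<noteq> 0" and L: "smooth_at p L" "\<And>v. chart_deriv c L p v = dcoeff c p \<bullet> v"
      and \<rho>: "\<And>q. q \<in> U \<Longrightarrow> \<rho> c q = k * exp (L q)" using loc[OF c] by blast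
    have "smooth_at p (\<lambda>q. k * exp (L q))" by (intro smooth_at_mult smooth_at_const smooth_at_exp L)
    then show "smooth_at p (\<rho> c)" by (rule smooth_at_cong[OF U, rotated]) (simp add: \<rho>)
    show "\<rho> c p \<noteq> 0" using \<rho>[OF U(2)] k by simp
    fix v
    have "chart_deriv c (\<lambda>q. ln \<bar>\<rho> c q\<bar>) p v = chart_deriv c (\<lambda>q. ln \<bar>k\<bar> + L q) p v"
      by (rule fun_cong[OF chart_deriv_cong[OF c U]]) (use \<rho> k in \<open>simp add: abs_mult ln_mult\<close>)
    also have "\<dots> = dcoeff c p \<bullet> v"
      using chart_deriv_add[OF c smooth_at_const[of p "ln \<bar>k\<bar>"] L(1)] L(2) by (simp add: chart_deriv_const)
    finally show "chart_deriv c (\<lambda>q. ln \<bar>\<rho> c q\<bar>) p v = dcoeff c p \<bullet> v" .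
  qed
qed

lemma ex_value: "c \<in> A \<Longrightarrow> p \<in> fst c \<Longrightarrow> \<exists>X\<in>vector_fields A. vcomp c X p = v"
  using local_vf[OF _ open_chart _ subset_refl smooth_at_const[of _ v], of c p] by blast

lemma orientable_case:
  assumes orient: "orientable A" and H1: "de_Rham_H1 A = {de_Rham_class A (\<lambda>p v. 0)}"
  shows "\<exists>\<Omega>. volume_form A \<Omega> \<and> (\<forall>X\<in>vector_fields A. D X = divergence A \<Omega> X)"
proof -
  obtain h where h: "\<And>c p. c \<in> A \<Longrightarrow> p \<in> fst c \<Longrightarrow> smooth_at p (h c)"
    "\<And>c d p. c \<in> A \<Longrightarrow> d \<in> A \<Longrightarrow> p \<in> fst c \<Longrightarrow> p \<in> fst d \<Longrightarrow> h c p = h d p + ln \<bar>jac c d p\<bar>"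
    by (rule ex_log_density) (rule that)
  obtain \<sigma> where \<sigma>: "\<And>c p. c \<in> A \<Longrightarrow> p \<in> fst c \<Longrightarrow> \<bar>\<sigma> c p\<bar> = 1"
    "\<And>c d p. c \<in> A \<Longrightarrow> d \<in> A \<Longrightarrow> p \<in> fst c \<Longrightarrow> p \<in> fst d \<Longrightarrow> \<sigma> c p = sgn (jac c d p) * \<sigma> d p"
    "\<And>c p. c \<in> A \<Longrightarrow> p \<in> fst c \<Longrightarrow> \<exists>U. open U \<and> p \<in> U \<and> (\<forall>q\<in>U. \<sigma> c q = \<sigma> c p)"
    by (rule ex_orientation_signs[OF orient]) (rule that)
  have compat: "\<sigma> c p * exp (f p + h c p) = jac c d p * (\<sigma> d p * exp (f p + h d p))"
    if "c \<in> A" "d \<in> A" "p \<in> fst c" "p \<in> fst d" for c d p and f :: "'a \<Rightarrow> real"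
  proof -
    have nz: "jac c d p \<noteq> 0" by (rule jac_nonzero[OF that])
    have "exp (f p + h c p) = exp (f p + h d p) * \<bar>jac c d p\<bar>"
      using nz by (simp add: h(2)[OF that] exp_add)
    moreover have "sgn (jac c d p) * \<bar>jac c d p\<bar> = jac c d p" by (simp add: sgn_mult_abs)
    ultimately show ?thesis using \<sigma>(2)[OF that] by (simp add: algebra_simps)
  qed
  have smooth: "smooth_at p (\<lambda>q. \<sigma> c q * exp (f q + h c q))" if c: "c \<in> A" "p \<in> fst c" and f: "smooth_at p f"
    for c p and f :: "'a \<Rightarrow> real"
  proof -
    obtain U where U: "open U" "p \<in> U" "\<forall>q\<in>U. \<sigma> c q = \<sigma> c p" using \<sigma>(3)[OF c] by blast
    have "smooth_at p (\<lambda>q. \<sigma> c p * exp (f q + h c q))"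
      by (intro smooth_at_mult smooth_at_const smooth_at_exp smooth_at_add f h(1) c)
    then show ?thesis by (rule smooth_at_cong[OF U(1,2), rotated]) (use U(3) in simp)
  qed
  have ln: "ln \<bar>\<sigma> c q * exp (f q + h c q)\<bar> = f q + h c q" if "c \<in> A" "q \<in> fst c" for c q and f :: "'a \<Rightarrow> real"
    using \<sigma>(1)[OF that] by (simp add: abs_mult)
  have nonzero: "\<sigma> c q * exp (f q + h c q) \<noteq> 0" if "c \<in> A" "q \<in> fst c" for c q and f :: "'a \<Rightarrow> real"
    using \<sigma>(1)[OF that] by auto
  \<comment> \<open>With exponent 0 the formulas above give the reference form
    \<open>\<Omega>0\<close>; at the end the exponent will be a primitive of
    \<open>\<alpha>\<close>.\<close>
  define z :: "'a \<Rightarrow> real" where "z = (\<lambda>_. 0)"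
  define \<rho>0 where "\<rho>0 c q = \<sigma> c q * exp (z q + h c q)" for c q
  define \<Omega>0 where "\<Omega>0 = form_of \<rho>0"
  have form: "\<Omega>0 \<in> differential_forms A" "\<And>c p. c \<in> A \<Longrightarrow> p \<in> fst c \<Longrightarrow> density \<Omega>0 c p = \<rho>0 c p"
  proof -
    have c: "\<rho>0 c p = jac c d p * \<rho>0 d p" if "c \<in> A" "d \<in> A" "p \<in> fst c" "p \<in> fst d" for c d p
      unfolding \<rho>0_def by (rule compat[OF that])
    have s: "smooth_at p (\<rho>0 c)" if "c \<in> A" "p \<in> fst c" for c p
      unfolding \<rho>0_def by (rule smooth[OF that]) (simp add: z_def)
    show "\<Omega>0 \<in> differential_forms A" "\<And>c p. c \<in> A \<Longrightarrow> p \<in> fst c \<Longrightarrow> density \<Omega>0 c p = \<rho>0 c p"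
      unfolding \<Omega>0_def by (rule form_of[of \<rho>0, OF c s]; assumption)+
  qed
  have vol: "volume_form A \<Omega>0"
    unfolding volume_form_iff using form nonzero by (simp add: \<rho>0_def)
  have ln0: "ln \<bar>\<rho>0 c q\<bar> = h c q" if "c \<in> A" "q \<in> fst c" for c q
    using ln[OF that, of z] by (simp add: \<rho>0_def z_def)
  define D0 where "D0 = divergence A \<Omega>0"
  have D0: "D0 X p = coord_div c X p + chart_deriv c (h c) p (vcomp c X p)" if X: "X \<in> vector_fields A" and c: "c \<in> A" "p \<in> fst c" for X c p
  proof -
    have "chart_deriv c (\<lambda>q. ln \<bar>density \<Omega>0 c q\<bar>) p v = chart_deriv c (h c) p v" for v
      by (rule fun_cong[OF chart_deriv_cong[OF c open_chart[OF c(1)] c(2)]])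
        (simp add: form(2) ln0 c(1))
    then show ?thesis unfolding D0_def divergence_density(2)[OF vol X c] by simp
  qed
  have D0s: "D0 X \<in> smooth_functions A" if "X \<in> vector_fields A" for X
    unfolding D0_def by (rule divergence_density(1)[OF vol that])
  have "bracket_rule A D0" unfolding D0_def using divergence_rules[OF vol] by blast
  then have D0br: "D0 (lie_bracket X Y) p = vf_apply X (D0 Y) p - vf_apply Y (D0 X) p"
    if "X \<in> vector_fields A" "Y \<in> vector_fields A" for X Y p
    using that by (simp add: bracket_rule_def)
  \<comment> \<open>Under a change of charts both terms pick up the same differential of
    \<open>ln \<bar>jac\<bar>\<close>, so their difference behaves like the components of a
    one-form.\<close>
  define w where "w c p = dcoeff c p - cgrad c (h c) p" for c p
  have w: "w c p \<bullet> vcomp c X p = D X p - D0 X p" if "X \<in> vector_fields A" "c \<in> A" "p \<in> fst c" for c p X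
    using D_coeff[of c X p] D0[of X c p] that by (simp add: w_def inner_diff_left cgrad_inner h(1))
  define \<alpha> :: "'a one_form" where "\<alpha> p v = (let c = (SOME c. c \<in> A \<and> p \<in> fst c) in
      if v () \<in> tangent_space A p then w c p \<bullet> pcomp c p (v ()) else 0)" for p v
  have \<alpha>: "\<alpha> p v = (if v () \<in> tangent_space A p then w c p \<bullet> pcomp c p (v ()) else 0)" if c: "c \<in> A" "p \<in> fst c" for c p v
  proof -
    define d where "d = (SOME c. c \<in> A \<and> p \<in> fst c)"
    have d: "d \<in> A" "p \<in> fst d" using someI[of "\<lambda>c. c \<in> A \<and> p \<in> fst c" c] c by (auto simp: d_def)
    \<comment> \<open>Instead of a transformation law for \<open>w\<close>, a global field through
      the given vector is used: in either chart the pairing equals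
      \<open>D X p - D0 X p\<close>.\<close>
    have "w d p \<bullet> pcomp d p (v ()) = w c p \<bullet> pcomp c p (v ())" if v: "v () \<in> tangent_space A p"
    proof -
      obtain X where X: "X \<in> vector_fields A" "vcomp c X p = pcomp c p (v ())" using ex_value[OF c] by blast
      have "X p = v ()" using vf_coord[OF X(1) c] X(2) coord_pcomp[OF c v] by simp
      then have "vcomp d X p = pcomp d p (v ())" by (simp add: vcomp_def)
      then show ?thesis using w[OF X(1) c] w[OF X(1) d] X(2) by simp
    qed
    then show ?thesis by (simp add: \<alpha>_def d_def[symmetric])
  qed
  have eval: "form_eval \<alpha> (\<lambda>_. X) = (\<lambda>p. D X p - D0 X p)" if X: "X \<in> vector_fields A" for X
  proof
    fix p
    obtain c where c: "c \<in> A" "p \<in> fst c" using ex_chart by blast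
    show "form_eval \<alpha> (\<lambda>_. X) p = D X p - D0 X p"
      using w[OF X c] vf_tangent[OF X] by (simp add: form_eval_def \<alpha>[OF c] vcomp_def)
  qed
  have "\<alpha> \<in> differential_forms A"
    unfolding differential_forms_def
  proof (intro CollectI conjI allI ballI)
    fix p
    obtain c where c: "c \<in> A" "p \<in> fst c" using ex_chart by blast
    have un: "i = ()" for i :: unit by simp
    show "alternating_form A p (\<alpha> p)"
      unfolding alternating_form_def
      by (auto simp: \<alpha>[OF c] un pcomp_add[OF c] pcomp_scale[OF c] tangent_space_add tangent_space_scale inner_add_right)
  next
    fix c and \<iota> :: "unit \<Rightarrow> 'n" assume c: "c \<in> A"
    have "\<forall>p\<in>fst c. smooth_at p (\<lambda>p. \<alpha> p (\<lambda>k. coord_vector A c p (axis (\<iota> k) 1)))"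
    proof
      fix p assume p: "p \<in> fst c"
      have "smooth_at p (dcoeff c)" using has_coeff_dcoeff[OF c] p by (simp add: has_coeff_def)
      then have "smooth_at p (\<lambda>q. (dcoeff c q - cgrad c (h c) q) \<bullet> axis (\<iota> ()) 1)"
        by (intro smooth_at_inner smooth_at_diff smooth_at_const smooth_at_cgrad c p h(1))
      then show "smooth_at p (\<lambda>p. \<alpha> p (\<lambda>k. coord_vector A c p (axis (\<iota> k) 1)))"
        by (rule smooth_at_cong[OF open_chart[OF c] p, rotated]) (simp add: \<alpha>[OF c] c coord_vector_tangent w_def)
    qed
    then show "smooth_on (chart_image c) (\<lambda>x. \<alpha> (chart_inv c x) (\<lambda>k. coord_vector A c (chart_inv c x) (axis (\<iota> k) 1)))"
      using smooth_on_chart_iff[OF c, of "\<lambda>p. \<alpha> p (\<lambda>k. coord_vector A c p (axis (\<iota> k) 1))"] by simp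
  qed
  moreover have "ext_deriv1 \<alpha> X Y = (\<lambda>p. 0)" if X: "X \<in> vector_fields A" and Y: "Y \<in> vector_fields A" for X Y
  proof
    fix p
    have diff: "vf_apply X (\<lambda>p. D Y p - D0 Y p) p = vf_apply X (D Y) p - vf_apply X (D0 Y) p"
      if X: "X \<in> vector_fields A" and Y: "Y \<in> vector_fields A" for X Y
    proof -
      obtain c where c: "c \<in> A" "p \<in> fst c" using ex_chart by blast
      note s = D_smooth[OF Y] D0s[OF Y]
      have "(\<lambda>p. D Y p - D0 Y p) \<in> smooth_functions A" using s by (simp add: smooth_functions_iff smooth_at_diff)
      then show ?thesis
        using s by (simp add: vf_apply_chart_deriv[OF X _ c] chart_deriv_diff[OF c] smooth_functionsD)
    qed
    show "ext_deriv1 \<alpha> X Y p = 0"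
      unfolding ext_deriv1_def eval[OF X] eval[OF Y] eval[OF lie_bracket_in[OF X Y]] diff[OF X Y] diff[OF Y X]
        D_bracket[OF X Y] D0br[OF X Y] by simp
  qed
  ultimately have closed: "\<alpha> \<in> closed_one_forms A" by (simp add: closed_one_forms_def)
  have "ext_deriv0 A (\<lambda>_. 0) = (\<lambda>p v. 0)"
    by (auto simp: ext_deriv0_def fun_eq_iff tangent_const)
  then have "(\<lambda>p v. \<alpha> p v - \<alpha> p v) \<in> exact_one_forms A"
    unfolding exact_one_forms_def by (intro image_eqI[where x="\<lambda>_. 0"]) simp_all
  then have "\<alpha> \<in> de_Rham_class A \<alpha>" using closed by (simp add: de_Rham_class_def)
  \<comment> \<open>\<open>\<alpha>\<close> lies in its own class, and trivial cohomology identifies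
    this class with that of 0, which makes \<open>\<alpha>\<close> itself exact.\<close>
  moreover have "de_Rham_class A \<alpha> = de_Rham_class A (\<lambda>p v. 0)"
    using H1 closed unfolding de_Rham_H1_def by blast
  ultimately have "(\<lambda>p v. \<alpha> p v - 0) \<in> exact_one_forms A" unfolding de_Rham_class_def by blast
  then obtain f where f: "f \<in> smooth_functions A" and af: "\<alpha> = ext_deriv0 A f"
    by (auto simp: exact_one_forms_def)
  have fX: "D X p - D0 X p = chart_deriv c f p (vcomp c X p)" if X: "X \<in> vector_fields A" and c: "c \<in> A" "p \<in> fst c" for X c p
    using fun_cong[OF eval[OF X], of p] vf_tangent[OF X, of p] vf_apply_chart_deriv[OF X f c]
    by (simp add: form_eval_def af ext_deriv0_def vf_apply_def)
  show ?thesis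
  \<comment> \<open>Multiplying the reference form by \<open>exp f\<close> adds \<open>df\<close> to
    the logarithmic derivative, and \<open>df\<close> is the difference of the coefficients of the
    two operators.\<close>
  proof (rule volume_form_from_densities[of "\<lambda>c q. \<sigma> c q * exp (f q + h c q)"])
    fix c p v assume c: "c \<in> A" "p \<in> fst c"
    obtain X where X: "X \<in> vector_fields A" "vcomp c X p = v" using ex_value[OF c] by blast
    have "chart_deriv c (\<lambda>q. ln \<bar>\<sigma> c q * exp (f q + h c q)\<bar>) p v = chart_deriv c (\<lambda>q. f q + h c q) p v"
      by (rule fun_cong[OF chart_deriv_cong[OF c open_chart[OF c(1)] c(2)]]) (rule ln[OF c(1)])
    also have "\<dots> = chart_deriv c f p v + chart_deriv c (h c) p v" by (rule chart_deriv_add[OF c smooth_functionsD[OF f] h(1)[OF c]])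
    also have "\<dots> = dcoeff c p \<bullet> v"
      using fX[OF X(1) c] D0[OF X(1) c] D_coeff[OF c(1) X(1) c(2)] X(2) by simp
    finally show "chart_deriv c (\<lambda>q. ln \<bar>\<sigma> c q * exp (f q + h c q)\<bar>) p v = dcoeff c p \<bullet> v" .
  next
    show "\<sigma> c p * exp (f p + h c p) = jac c d p * (\<sigma> d p * exp (f p + h d p))"
      if "c \<in> A" "d \<in> A" "p \<in> fst c" "p \<in> fst d" for c d p by (rule compat[OF that])
    show "smooth_at p (\<lambda>q. \<sigma> c q * exp (f q + h c q))" if "c \<in> A" "p \<in> fst c" for c p
      by (rule smooth[OF that smooth_functionsD[OF f]])
    show "\<sigma> c p * exp (f p + h c p) \<noteq> 0" if "c \<in> A" "p \<in> fst c" for c p by (rule nonzero[OF that])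
  qed
qed

end

theorem theorem1p2:
  fixes A :: "('a::{t2_space,second_countable_topology}, 'n::finite) chart set"
    and D :: "'a vector_field \<Rightarrow> 'a \<Rightarrow> real"
  assumes "smooth_atlas A"
    and "linear_operator A D"
  shows "(orientable A \<and> de_Rham_H1 A = {de_Rham_class A (\<lambda>p v. 0)} \<longrightarrow>
            (bracket_rule A D \<and> product_rule A D \<longleftrightarrow>
              (\<exists>\<Omega>. volume_form A \<Omega> \<and> (\<forall>X\<in>vector_fields A. D X = divergence A \<Omega> X)))) \<and>
         (simply_connected (UNIV :: 'a set) \<longrightarrow>
            (bracket_rule A D \<and> product_rule A D \<longleftrightarrow>
              (\<exists>\<Omega>. volume_form A \<Omega> \<and> (\<forall>X\<in>vector_fields A. D X = divergence A \<Omega> X))))"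
proof -
  interpret smooth_manifold A by unfold_locales (rule assms(1))
  have "bracket_rule A D \<and> product_rule A D"
    if "\<exists>\<Omega>. volume_form A \<Omega> \<and> (\<forall>X\<in>vector_fields A. D X = divergence A \<Omega> X)"
    using that divergence_rules by blast
  moreover have "\<exists>\<Omega>. volume_form A \<Omega> \<and> (\<forall>X\<in>vector_fields A. D X = divergence A \<Omega> X)"
    if "bracket_rule A D \<and> product_rule A D"
      and case1: "orientable A \<and> de_Rham_H1 A = {de_Rham_class A (\<lambda>p v. 0)} \<or> simply_connected (UNIV :: 'a set)"
  proof -
    interpret divergence_operator A D by unfold_locales (use assms(2) that(1) in auto)
    show ?thesis using case1 orientable_case simply_connected_case by blast
  qed
  ultimately show ?thesis by blast
qed

end
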